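(* Let $X=(X_n)_{n\in\mathbb{N}}$ be the Harris chain and let $X_\infty$ be its almost sure Doob-Martin limit. Let $$Y_\infty:=\sum_{u\in\mathbb{V}}X_\infty(A_u)\,C\bigl(\rho(X_\infty,u)\bigr),\qquad W_\infty:=\sum_{u\in\mathbb{V}}X_\infty(A_u)^2.$$ Then, as $n\to\infty$, $$\frac1{n^2}\,\mathrm{WI}(X_n)-H_n\;\to\;Y_\infty-W_\infty,$$ almost surely and in $L^p$ for every $p>0$.
   Context: $\mathbb{N}=\{1,2,\ldots\}$ and $\mathbb{V}=\mathbb{N}^\star$ is the set of finite sequences of natural numbers (including the empty sequence $\emptyset$); $u+v$ denotes concatenation and $ui:=u+(i)$. For $u=(u_1,\ldots,u_l)\in\mathbb{V}$, $|u|:=l$ and $|u|_1:=\sum_{i=1}^l u_i$. A Harris tree is a finite nonempty set $x\subset\mathbb{V}$ such that (i) $u+v\in x$ implies $u\in x$, and (ii) $ui\in x$ with $i>1$ implies $uj\in x$ for $1\le j\le i-1$; as a graph, its edges are the pairs $\{u,ui\}$ with $u,ui\in x$. $\mathbb{H}_n$ is the set of Harris trees with $n$ nodes. For a Harris tree $x$, $x(u):=\{v\in\mathbb{V}:u+v\in x\}$. The Harris chain $X=(X_n)_{n\in\mathbb{N}}$ is the Markov chain with $X_1=\{\emptyset\}$ and, for $x_n\in\mathbb{H}_n$, $x_{n+1}\in\mathbb{H}_{n+1}$, $P(X_{n+1}=x_{n+1}\mid X_n=x_n)=1/n$ if $x_n\subset x_{n+1}$ and $0$ otherwise. (It is the image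 of the chain of random recursive trees, where each new node chooses its ancestor uniformly at random.) The Wiener index of a Harris tree $x$ is $\mathrm{WI}(x):=\frac12\sum_{(u,v)\in x\times x}d_\circ(u,v)$, where $d_\circ$ is the graph distance, i.e. $d_\circ(u,v)=|u|+|v|-2|u\wedge v|$ with $u\wedge v$ the longest common prefix of $u$ and $v$. $H_n:=\sum_{k=1}^n\frac1k$. $\bar{\mathbb{V}}:=\mathbb{N}^\star\sqcup\mathbb{N}^\infty\sqcup\bigsqcup_{k=0}^\infty\mathbb{N}^k\times\{\infty\}^\infty$; $A_u:=\{v\in\bar{\mathbb{V}}: u\text{ is a prefix of }v\}$ for $u\in\mathbb{V}$; $\mathcal{V}$ is the $\sigma$-field generated by the sets $A_u$, $u\in\mathbb{V}$. $X_\infty$ is the random probability measure on $(\bar{\mathbb{V}},\mathcal{V})$ with, almost surely, $X_\infty(A_u)=\lim_{n\to\infty}\frac1n\#X_n(u)$ for all $u\in\mathbb{V}$ (it is known that this limit exists almost surely). $\Sigma_\infty$ is the set of sequences $(s_i)_{i\in\mathbb{N}}$ with $s_i\ge0$ and $\sum_{i=1}^\infty s_i=1$. For $u\in\mathbb{V}$, $\rho(X_\infty,u)=(\rho_i(X_\infty,u))_{i\in\mathbb{N}}$ with $\rho_i(X_\infty,u):=X_\infty(A_{ui})/X_\infty(A_u)$, which is almost surely a well-defined element of $\Sigma_\infty$. The function $C:\Sigma_\infty\to[-\infty,1]$ is $C\bigl((s_i)_{i\in\mathbb{N}}\bigr):=1+\sum_{i=1}^\infty s_i\log s_i$ (with $0\log0:=0$).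 The infinite sum defining $Y_\infty$ is understood as the limit, in $L^p$ for all $p\ge1$, of the partial sums over $\{u\in\mathbb{V}:|u|_1\le k\}$ as $k\to\infty$ (this limit exists); the series of nonnegative terms defining $W_\infty$ converges almost surely and has moments of all orders. *)

theory Defs
  imports "HOL-Probability.Probability" "HOL-Library.Sublist"
begin

section \<open>Harris trees\<close>

text \<open>
  Nodes are finite sequences of positive integers, represented as lists of type \<^typ>\<open>nat list\<close>;
  as \<^typ>\<open>nat\<close> contains \<open>0\<close>, the node set is an explicit carrier.  The length
  \<open>|u|\<close> of a node is \<^term>\<open>length u\<close> and \<open>|u|\<^sub>1\<close> is \<^term>\<open>sum_list u\<close>.
\<close>

definition nodes :: "nat list set" where
  "nodes = {u. \<forall>i\<in>set u. 1 \<le> i}"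

definition harris_tree :: "nat list set \<Rightarrow> bool" where
  "harris_tree x \<longleftrightarrow> finite x \<and> x \<noteq> {} \<and> x \<subseteq> nodes \<and>
     (\<forall>u v. u @ v \<in> x \<longrightarrow> u \<in> x) \<and>
     (\<forall>u i j. u @ [i] \<in> x \<and> i > 1 \<and> 1 \<le> j \<and> j \<le> i - 1 \<longrightarrow> u @ [j] \<in> x)"

definition harris_trees :: "nat \<Rightarrow> nat list set set" where
  "harris_trees n = {x. harris_tree x \<and> card x = n}"

definition subtree :: "nat list set \<Rightarrow> nat list \<Rightarrow> nat list set" where
  "subtree x u = {v \<in> nodes. u @ v \<in> x}"

definition tree_edges :: "nat list set \<Rightarrow> (nat list \<times> nat list) set" where
  "tree_edges x = {(u, v). u \<in> x \<and> v \<in> x \<and> (\<exists>i. v = u @ [i] \<or> u = v @ [i])}"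

definition graph_dist :: "nat list set \<Rightarrow> nat list \<Rightarrow> nat list \<Rightarrow> nat" where
  "graph_dist x u v = (LEAST n. (u, v) \<in> tree_edges x ^^ n)"

definition wiener_index :: "nat list set \<Rightarrow> real" where
  "wiener_index x = (1/2) * (\<Sum>(u, v)\<in>x \<times> x. real (graph_dist x u v))"

lemma tree_path_up:
  assumes "harris_tree x" "p @ a \<in> x"
  shows "(p @ a, p) \<in> tree_edges x ^^ length a \<and> (p, p @ a) \<in> tree_edges x ^^ length a"
  using assms(2)
proof (induction a rule: rev_induct)
  case Nil
  then show ?case by simp
next
  case (snoc i a)
  have "(p @ a) @ [i] \<in> x" using snoc.prems by simp
  then have m: "p @ a \<in> x" using assms(1) unfolding harris_tree_def by blast
  have e: "(p @ a, p @ a @ [i]) \<in> tree_edges x" "(p @ a @ [i], p @ a) \<in> tree_edges x"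
    using m snoc.prems by (auto simp: tree_edges_def)
  have l: "length (a @ [i]) = Suc (length a)" by simp
  show ?case
    unfolding l
    using snoc.IH[OF m] e by (meson relpow_Suc_I relpow_Suc_I2)
qed

lemma tree_path_lower:
  "(u, v) \<in> tree_edges x ^^ n \<Longrightarrow>
     \<exists>p. prefix p u \<and> prefix p v \<and> length u + length v \<le> n + 2 * length p"
proof (induction n arbitrary: v)
  case 0
  then show ?case by (intro exI[of _ u]) simp
next
  case (Suc n)
  then obtain w where w: "(u, w) \<in> tree_edges x ^^ n" "(w, v) \<in> tree_edges x" by auto
  from Suc.IH[OF w(1)] obtain p where
    p: "prefix p u" "prefix p w" "length u + length w \<le> n + 2 * length p" by blast
  from w(2) obtain i where "v = w @ [i] \<or> w = v @ [i]" by (auto simp: tree_edges_def)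
  then show ?case
  proof
    assume "v = w @ [i]"
    then show ?thesis using p by (intro exI[of _ p]) auto
  next
    assume wv: "w = v @ [i]"
    show ?thesis
    proof (cases "p = w")
      case True
      then have "prefix v u" using p(1) wv by (auto simp: prefix_def)
      then show ?thesis using p wv True by (intro exI[of _ v]) auto
    next
      case False
      then have "prefix p v" using p(2) wv by (simp add: prefix_snoc)
      then show ?thesis using p wv by (intro exI[of _ p]) auto
    qed
  qed
qed

text \<open>
  In a Harris tree the graph distance is \<open>|u| + |v| - 2 |u \<and> v|\<close>, with \<open>u \<and> v\<close> the longest
  common prefix.
\<close>

lemma graph_dist_eq:
  assumes "harris_tree x" "u \<in> x" "v \<in> x"
  shows "graph_dist x u v = length u + length v - 2 * length (Longest_common_prefix {u, v})"
proof -
  let ?p = "Longest_common_prefix {u, v}"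
  have "prefix ?p u" "prefix ?p v" by (auto intro: Longest_common_prefix_prefix)
  then obtain a b where ab: "u = ?p @ a" "v = ?p @ b" by (auto simp: prefix_def)
  have "(u, ?p) \<in> tree_edges x ^^ length a" "(?p, v) \<in> tree_edges x ^^ length b"
    using tree_path_up[OF assms(1), of ?p a] tree_path_up[OF assms(1), of ?p b] assms ab by auto
  then have path: "(u, v) \<in> tree_edges x ^^ (length a + length b)"
    by (rule relpow_trans)
  have la: "length u = length ?p + length a" "length v = length ?p + length b"
    by (metis ab(1) length_append, metis ab(2) length_append)
  have low: "length a + length b \<le> n" if n: "(u, v) \<in> tree_edges x ^^ n" for n
  proof -
    from tree_path_lower[OF n] obtain q where
      q: "prefix q u" "prefix q v" "length u + length v \<le> n + 2 * length q" by blast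
    have "length q \<le> length ?p"
      by (rule Longest_common_prefix_longest) (use q in auto)
    then show ?thesis using q(3) la by linarith
  qed
  have "graph_dist x u v = length a + length b"
    unfolding graph_dist_def by (intro Least_equality path low)
  then show ?thesis using la by linarith
qed

section \<open>The Harris chain\<close>

text \<open>
  The time index starts at \<open>1\<close>; \<open>X 0\<close> is unconstrained.
\<close>

definition harris_chain :: "'w measure \<Rightarrow> (nat \<Rightarrow> 'w \<Rightarrow> nat list set) \<Rightarrow> bool" where
  "harris_chain M X \<longleftrightarrow>
     prob_space M \<and>
     (\<forall>n\<ge>1. X n \<in> M \<rightarrow>\<^sub>M count_space (harris_trees n)) \<and>
     (\<forall>\<omega>\<in>space M. X 1 \<omega> = {[]}) \<and>
     (\<forall>n\<ge>1. \<forall>x y. (\<forall>k\<in>{1..n}. x k \<in> harris_trees k) \<longrightarrow> y \<in> harris_trees (n + 1) \<longrightarrow>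
        \<P>(\<omega> in M. \<forall>k\<in>{1..n}. X k \<omega> = x k) > 0 \<longrightarrow>
        \<P>(\<omega> in M. X (n + 1) \<omega> = y \<bar> (\<forall>k\<in>{1..n}. X k \<omega> = x k)) =
        \<P>(\<omega> in M. X (n + 1) \<omega> = y \<bar> X n \<omega> = x n)) \<and>
     (\<forall>n\<ge>1. \<forall>x\<in>harris_trees n. \<forall>y\<in>harris_trees (n + 1).
        \<P>(\<omega> in M. X n \<omega> = x) > 0 \<longrightarrow>
        \<P>(\<omega> in M. X (n + 1) \<omega> = y \<bar> X n \<omega> = x) = (if x \<subseteq> y then 1 / real n else 0))"

section \<open>The compactification and the limit of the chain\<close>

text \<open>
  \<open>Inl\<close> carries the finite sequences; \<open>Inr\<close> carries the infinite ones, as functions into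
  \<^typ>\<open>enat\<close> whose argument \<open>i\<close> is the position counted from \<open>0\<close>.
\<close>

type_synonym bar_node = "nat list + (nat \<Rightarrow> enat)"

definition bar_nodes :: "bar_node set" where
  "bar_nodes =
     Inl ` nodes \<union>
     Inr ` {f. \<forall>i. f i \<in> enat ` {1..}} \<union>
     Inr ` (\<Union>k. {f. (\<forall>i<k. f i \<in> enat ` {1..}) \<and> (\<forall>i\<ge>k. f i = \<infinity>)})"

fun bar_prefix :: "nat list \<Rightarrow> bar_node \<Rightarrow> bool" where
  "bar_prefix u (Inl v) \<longleftrightarrow> prefix u v"
| "bar_prefix u (Inr f) \<longleftrightarrow> (\<forall>i<length u. f i = enat (u ! i))"

definition cyl :: "nat list \<Rightarrow> bar_node set" where
  "cyl u = {v \<in> bar_nodes. bar_prefix u v}"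

definition bar_space :: "bar_node measure" where
  "bar_space = sigma bar_nodes (cyl ` nodes)"

definition doob_martin_limit ::
  "'w measure \<Rightarrow> (nat \<Rightarrow> 'w \<Rightarrow> nat list set) \<Rightarrow> ('w \<Rightarrow> bar_node measure) \<Rightarrow> bool" where
  "doob_martin_limit M X Xinf \<longleftrightarrow>
     Xinf \<in> M \<rightarrow>\<^sub>M prob_algebra bar_space \<and>
     (AE \<omega> in M. \<forall>u\<in>nodes.
        (\<lambda>n. real (card (subtree (X n \<omega>) u)) / real n) \<longlonglongrightarrow> measure (Xinf \<omega>) (cyl u))"

section \<open>The functionals in the limit\<close>

text \<open>
  Sequences indexed by the positive integers are functions on \<^typ>\<open>nat\<close> whose value at \<open>0\<close>
  is never used.
\<close>

definition rho :: "bar_node measure \<Rightarrow> nat list \<Rightarrow> nat \<Rightarrow> real" where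
  "rho \<mu> u i = measure \<mu> (cyl (u @ [i])) / measure \<mu> (cyl u)"

text \<open>
  For \<open>0 \<le> s i \<le> 1\<close> all terms of the series are nonpositive, so it converges in
  \<^typ>\<open>ereal\<close>, possibly to \<open>-\<infinity>\<close>.  The convention \<open>0 log 0 = 0\<close> is automatic.
\<close>

definition C_fun :: "(nat \<Rightarrow> real) \<Rightarrow> ereal" where
  "C_fun s = 1 + (\<Sum>i. ereal (s (Suc i) * ln (s (Suc i))))"

definition Y_partial :: "nat \<Rightarrow> bar_node measure \<Rightarrow> ereal" where
  "Y_partial k \<mu> =
     (\<Sum>u\<in>{u\<in>nodes. sum_list u \<le> k}. ereal (measure \<mu> (cyl u)) * C_fun (rho \<mu> u))"

lemma finite_nodes_sum_le: "finite {u \<in> nodes. sum_list u \<le> k}"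
proof -
  have len: "length u \<le> sum_list u" if "u \<in> nodes" for u
    using that by (induction u) (auto simp: nodes_def)
  have "{u \<in> nodes. sum_list u \<le> k} \<subseteq> {u. set u \<subseteq> {..k} \<and> length u \<le> k}"
    using len member_le_sum_list by fastforce
  then show ?thesis
    using finite_lists_length_le[of "{..k}" k] finite_subset by blast
qed

definition W_inf :: "bar_node measure \<Rightarrow> real" where
  "W_inf \<mu> = (\<Sum>\<^sub>\<infinity>u\<in>nodes. (measure \<mu> (cyl u))\<^sup>2)"

text \<open>
  Convergence in \<open>L\<^sup>p\<close> for real \<open>p > 0\<close>.  It is expressed through the \<open>p\<close>-th moment of the
  difference, so that \<open>p < 1\<close> is covered as well.
\<close>

definition tendsto_Lp :: "'w measure \<Rightarrow> real \<Rightarrow> (nat \<Rightarrow> 'w \<Rightarrow> real) \<Rightarrow> ('w \<Rightarrow> real) \<Rightarrow> bool" where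
  "tendsto_Lp M p f g \<longleftrightarrow>
     (\<forall>n. f n \<in> borel_measurable M \<and> integrable M (\<lambda>\<omega>. \<bar>f n \<omega>\<bar> powr p)) \<and>
     g \<in> borel_measurable M \<and> integrable M (\<lambda>\<omega>. \<bar>g \<omega>\<bar> powr p) \<and>
     (\<lambda>n. \<integral>\<omega>. \<bar>f n \<omega> - g \<omega>\<bar> powr p \<partial>M) \<longlonglongrightarrow> 0"

text \<open>
  The sum over all nodes of \<open>X\<^sub>\<infinity>(A\<^sub>u) C(\<rho>(X\<^sub>\<infinity>, u))\<close> is the random variable \<open>Y\<close>, unique up to null
  sets, to which the partial sums converge in every \<open>L\<^sup>p\<close>, \<open>p \<ge> 1\<close>.  The partial sums are
  almost surely finite, hence the conversion to \<^typ>\<open>real\<close> matters only on a null set.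
\<close>

definition is_Y_inf :: "'w measure \<Rightarrow> ('w \<Rightarrow> bar_node measure) \<Rightarrow> ('w \<Rightarrow> real) \<Rightarrow> bool" where
  "is_Y_inf M Xinf Y \<longleftrightarrow>
     (\<forall>p\<ge>1. tendsto_Lp M p (\<lambda>k \<omega>. real_of_ereal (Y_partial k (Xinf \<omega>))) Y)"

section \<open>The rescaled Wiener index\<close>

text \<open>
  At the irrelevant index \<open>n = 0\<close> this is \<open>0\<close>, as \<open>1 / 0 = 0\<close>.
\<close>

definition rescaled_wiener :: "(nat \<Rightarrow> 'w \<Rightarrow> nat list set) \<Rightarrow> nat \<Rightarrow> 'w \<Rightarrow> real" where
  "rescaled_wiener X n \<omega> = 1 / (real n)\<^sup>2 * wiener_index (X n \<omega>) - harm n"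

end

theory Submission
  imports Defs "HOL-Real_Asymp.Real_Asymp"
begin

text \<open>
  The new node of the chain is attached to a uniformly chosen node, so that the average of a
  functional over the successors of a tree is an explicit finite sum.  The estimates below are
  obtained from such one-step averages.

  \<^bold>\<open>Convergence.\<close>  The quotient \<open>WI(X\<^sub>n) / (n (n+1))\<close> is a martingale after subtraction of a
  deterministic sequence (\<open>wiener_mart_drift\<close>).  Its increments are at most \<open>2 (h+1) / n\<close>, where
  \<open>h\<close> is the height, and all moments of the height are \<open>O(n\<^sup>1\<^sup>/\<^sup>2)\<close> (\<open>height_moments\<close>).  Hence the
  martingale is bounded in every \<open>L\<^sup>p\<close> (\<open>W_mart_even_moments\<close>), and it converges almost surely
  because its increments have summable variances (\<open>W_mart_maximal_inequality\<close>).  So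
  \<open>WI(X\<^sub>n) / n\<^sup>2 - H\<^sub>n\<close> has an almost sure limit \<open>R\<close>, with convergence in every \<open>L\<^sup>p\<close>, and it remains to
  see that \<open>R = Y\<^sub>\<infinity> - W\<^sub>\<infinity>\<close>.

  \<^bold>\<open>Cutting.\<close>  Double counting gives \<open>WI(x) = n \<Sum>\<^sub>v |v| - \<Sum>\<^sub>w (#x(w))\<^sup>2\<close>, the second sum being over
  \<open>w \<noteq> \<emptyset>\<close>.  Fix a finite Harris tree \<open>F\<close> and assign every node to its longest prefix in \<open>F\<close>.  The
  piece of \<open>u \<in> F\<close>, with \<open>N\<^sub>u\<close> nodes, grows like a tree of the same kind; its path length is the
  sum of the mean \<open>N\<^sub>u (H - 1)\<close>, \<open>H\<close> being the harmonic number of \<open>N\<^sub>u\<close>, and of a deviation.  The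
  total deviation has a second moment of at most half the mean of \<open>\<Sum>\<^sub>u N\<^sub>u (N\<^sub>u + 1)\<close>
  (\<open>cut_potential_drift\<close>).  The remaining terms involve finitely many subtree sizes only, and since
  \<open>(N\<^sub>u / n) (H - H\<^sub>n)\<close> tends to \<open>q ln q\<close> when \<open>N\<^sub>u / n\<close> tends to \<open>q\<close>, they converge to a finite
  entropy sum.

  \<^bold>\<open>Uniform smallness.\<close>  The deviation and the squares \<open>(#x(w))\<^sup>2\<close> with \<open>w \<notin> F\<close> are negligible
  for all large \<open>n\<close> if \<open>F\<close> contains all nodes with \<open>|u|\<^sub>1 \<le> k\<close> for a large \<open>k\<close>.  The reason is the
  bound \<open>O(n\<^sup>2)\<close> for the mean of a sum of squared subtree sizes in which \<open>w\<close> has the weight \<open>(5/4)\<close> to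
  the power \<open>|w|\<^sub>1\<close> (\<open>spread_drift\<close>).

  \<^bold>\<open>Identification.\<close>  Fatou's lemma is applied as \<open>n \<rightarrow> \<infinity>\<close> for fixed \<open>F\<close>, and then as \<open>l \<rightarrow> \<infinity>\<close>,
  where \<open>F\<close> consists of the nodes with \<open>|u|\<^sub>1 \<le> k\<close> and of their first \<open>l\<close> children; in the second
  limit the entropy sum turns into the partial sum \<open>Y\<^sub>k\<close>.  The outcome is a geometric bound for the
  mean of \<open>|R + W\<^sub>\<infinity> - Y\<^sub>k|\<close> (\<open>nn_integral_Y_partial\<close>), and \<open>k \<rightarrow> \<infinity>\<close> gives \<open>R + W\<^sub>\<infinity> = Y\<^sub>\<infinity>\<close>.
\<close>

section \<open>Growing a Harris tree\<close>

definition deg :: "nat list set \<Rightarrow> nat list \<Rightarrow> nat" where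
  "deg x u = card {i. u @ [i] \<in> x}"

definition new_node :: "nat list set \<Rightarrow> nat list \<Rightarrow> nat list" where
  "new_node x u = u @ [Suc (deg x u)]"

definition grow :: "nat list set \<Rightarrow> nat list \<Rightarrow> nat list set" where
  "grow x u = insert (new_node x u) x"

lemma harris_finite: "harris_tree x \<Longrightarrow> finite x"
  and harris_nodes: "harris_tree x \<Longrightarrow> x \<subseteq> nodes"
  and harris_ne: "harris_tree x \<Longrightarrow> x \<noteq> {}"
  by (auto simp: harris_tree_def)

lemma harris_prefix: "harris_tree x \<Longrightarrow> prefix u v \<Longrightarrow> v \<in> x \<Longrightarrow> u \<in> x"
  unfolding harris_tree_def prefix_def by blast

lemma harris_Nil: "harris_tree x \<Longrightarrow> [] \<in> x"
  using harris_ne harris_prefix[of x "[]"] by auto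

lemma card_harris_pos: "harris_tree x \<Longrightarrow> 0 < card x"
  using harris_ne harris_finite by (simp add: card_gt_0_iff)

lemma harris_sibling: "harris_tree x \<Longrightarrow> u @ [i] \<in> x \<Longrightarrow> 1 \<le> j \<Longrightarrow> j \<le> i \<Longrightarrow> u @ [j] \<in> x"
proof (cases "j = i")
  case False
  assume "harris_tree x" "u @ [i] \<in> x" "1 \<le> j" "j \<le> i"
  moreover from this False have "j \<le> i - 1" "i > 1" by auto
  ultimately show ?thesis unfolding harris_tree_def by blast
qed auto

lemma children_eq:
  assumes "harris_tree x"
  shows "{i. u @ [i] \<in> x} = {1..deg x u}"
proof -
  let ?C = "{i. u @ [i] \<in> x}"
  have fin: "finite ?C"
    using finite_vimageI[OF harris_finite[OF assms], of "\<lambda>i. u @ [i]"]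
    by (simp add: vimage_def inj_def)
  have pos: "1 \<le> i" if "i \<in> ?C" for i
    using that harris_nodes[OF assms] by (auto simp: nodes_def)
  have "\<exists>m. ?C = {1..m}"
  proof (cases "?C = {}")
    case True
    then show ?thesis by (intro exI[of _ 0]) simp
  next
    case False
    define m where "m = Max ?C"
    have "m \<in> ?C" unfolding m_def by (rule Max_in[OF fin False])
    then have m: "u @ [m] \<in> x" by simp
    have le: "i \<le> m" if "i \<in> ?C" for i
      unfolding m_def using fin that by (rule Max_ge)
    show ?thesis
    proof (intro exI equalityI subsetI)
      fix i assume "i \<in> ?C"
      then show "i \<in> {1..m}" using pos le by simp
    next
      fix i assume "i \<in> {1..m}"
      then show "i \<in> ?C" using harris_sibling[OF assms m, of i] by simp
    qed
  qed
  then obtain m where m: "?C = {1..m}" by blast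
  then have "deg x u = m" by (simp add: deg_def)
  then show ?thesis using m by simp
qed

lemma child_iff: "harris_tree x \<Longrightarrow> u @ [i] \<in> x \<longleftrightarrow> 1 \<le> i \<and> i \<le> deg x u"
  using children_eq[of x u] by (simp add: set_eq_iff)

lemma new_node_notin: "harris_tree x \<Longrightarrow> new_node x u \<notin> x"
  by (simp add: new_node_def child_iff)

lemma not_prefix_new_node: "harris_tree x \<Longrightarrow> w \<in> x \<Longrightarrow> \<not> prefix (new_node x u) w"
  using harris_prefix new_node_notin by blast

lemma prefix_new_node_iff: "prefix w (new_node x u) \<longleftrightarrow> w = new_node x u \<or> prefix w u"
  by (auto simp: new_node_def)

lemma card_grow: "harris_tree x \<Longrightarrow> card (grow x u) = Suc (card x)"
  by (simp add: grow_def new_node_notin harris_finite)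

lemma sum_grow:
  "harris_tree x \<Longrightarrow> (\<Sum>v\<in>grow x u. f v) = (\<Sum>v\<in>x. f v) + (f (new_node x u) :: real)"
  by (simp add: grow_def new_node_notin harris_finite)

lemma harris_grow:
  assumes x: "harris_tree x" and u: "u \<in> x"
  shows "harris_tree (grow x u)"
  unfolding harris_tree_def
proof (intro conjI allI impI)
  show "finite (grow x u)" "grow x u \<noteq> {}" "grow x u \<subseteq> nodes"
    using x u harris_nodes[OF x] by (auto simp: grow_def new_node_def harris_finite nodes_def)
  show "a \<in> grow x u" if "a @ b \<in> grow x u" for a b
  proof (cases "a @ b = new_node x u")
    case True
    then have "prefix a (new_node x u)" by (metis prefixI)
    then show ?thesis
      using u harris_prefix[OF x] unfolding prefix_new_node_iff grow_def by auto
  next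
    case False
    then have "a @ b \<in> x" using that by (simp add: grow_def)
    then show ?thesis using harris_prefix[OF x prefixI[OF refl]] by (auto simp: grow_def)
  qed
  show "a @ [j] \<in> grow x u" if "a @ [i] \<in> grow x u \<and> i > 1 \<and> 1 \<le> j \<and> j \<le> i - 1" for a i j
  proof (cases "a @ [i] = new_node x u")
    case True
    then show ?thesis using that by (auto simp: grow_def new_node_def child_iff[OF x])
  next
    case False
    then have "a @ [i] \<in> x" using that by (simp add: grow_def)
    then have "a @ [j] \<in> x" using that by (intro harris_sibling[OF x, of a i j]) auto
    then show ?thesis by (simp add: grow_def)
  qed
qed

lemma inj_grow: "harris_tree x \<Longrightarrow> inj_on (grow x) x"
  by (rule inj_onI) (metis append1_eq_conv grow_def insertI1 insertE new_node_def new_node_notin)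

text \<open>
  The additional node of a successor is a leaf, and by the sibling condition it can only be the
  next child of its parent.  So the successors correspond to the nodes of the tree.
\<close>

lemma successors_eq:
  assumes x: "harris_tree x"
  shows "{y \<in> harris_trees (card x + 1). x \<subseteq> y} = grow x ` x"
proof
  show "grow x ` x \<subseteq> {y \<in> harris_trees (card x + 1). x \<subseteq> y}"
    using x harris_grow card_grow by (auto simp: harris_trees_def grow_def)
  show "{y \<in> harris_trees (card x + 1). x \<subseteq> y} \<subseteq> grow x ` x"
  proof
    fix y assume "y \<in> {y \<in> harris_trees (card x + 1). x \<subseteq> y}"
    then have y: "harris_tree y" "card y = Suc (card x)" "x \<subseteq> y"
      by (auto simp: harris_trees_def)
    then have "card (y - x) = 1"
      using harris_finite[OF x] by (simp add: card_Diff_subset)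
    then obtain z where z: "y - x = {z}" by (auto simp: card_1_singleton_iff)
    then have yz: "y = insert z x" and zx: "z \<notin> x" using y(3) by auto
    have "z \<noteq> []" using zx harris_Nil[OF x] by auto
    then obtain u i where ui: "z = u @ [i]" by (metis rev_exhaust)
    have "u \<in> y" using harris_prefix[OF y(1), of u z] z ui by auto
    then have u: "u \<in> x" using yz ui by auto
    have "{1..deg y u} = insert i {1..deg x u}"
      unfolding children_eq[OF x, symmetric] children_eq[OF y(1), symmetric]
      using yz ui by auto
    moreover have ni: "i \<notin> {1..deg x u}"
      using zx unfolding children_eq[OF x, symmetric] ui by simp
    ultimately have *: "i \<in> {1..deg y u}" "{1..deg x u} = {1..deg y u} - {i}" by auto
    then have c: "deg y u = Suc (deg x u)"
      by (metis card_Suc_Diff1 card_atLeastAtMost diff_Suc_1 finite_atLeastAtMost)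
    have "i = Suc (deg x u)"
    proof (rule ccontr)
      assume "i \<noteq> Suc (deg x u)"
      then have "Suc (deg x u) \<in> {1..deg x u}" using *(2) c by auto
      then show False by simp
    qed
    then have "y = grow x u" by (simp add: yz ui grow_def new_node_def)
    then show "y \<in> grow x ` x" using u by blast
  qed
qed

lemma deg_grow:
  assumes x: "harris_tree x" and u: "u \<in> x" and v: "v \<in> grow x u"
  shows "deg (grow x u) v =
    (if v = new_node x u then 0 else if v = u then Suc (deg x u) else deg x v)"
proof -
  have *: "\<And>i. v = new_node x u \<Longrightarrow> v @ [i] \<notin> x"
    using harris_prefix[OF x] new_node_notin[OF x] by (metis prefixI)
  have "{i. v @ [i] \<in> grow x u} =
    (if v = new_node x u then {} else if v = u then {1..Suc (deg x u)} else {1..deg x v})"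
    using * u new_node_notin[OF x]
    by (auto simp: grow_def new_node_def child_iff[OF x] simp flip: append_assoc)
  then show ?thesis unfolding deg_def[of "grow x u"] by simp
qed

lemma finite_harris_trees: "finite (harris_trees n)"
proof -
  have "x \<subseteq> {u. set u \<subseteq> {..n} \<and> length u \<le> n}" if x: "harris_tree x" "card x = n" for x
  proof
    fix v assume v: "v \<in> x"
    have "set (prefixes v) \<subseteq> x"
      using v harris_prefix[OF x(1)] by auto
    then have "card (set (prefixes v)) \<le> n"
      using x card_mono harris_finite by blast
    then have len: "length v \<le> n" by (simp add: distinct_card)
    have "i \<le> n" if i: "i \<in> set v" for i
    proof -
      obtain a b where ab: "v = a @ i # b" using split_list[OF i] by blast
      then have "a @ [i] \<in> x" using v harris_prefix[OF x(1), of "a @ [i]" v] by auto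
      then have "(\<lambda>j. a @ [j]) ` {1..i} \<subseteq> x" using harris_sibling[OF x(1)] by auto
      then have "card ((\<lambda>j. a @ [j]) ` {1..i}) \<le> n"
        using x card_mono harris_finite by blast
      then show ?thesis by (subst (asm) card_image) (auto simp: inj_on_def)
    qed
    then show "v \<in> {u. set u \<subseteq> {..n} \<and> length u \<le> n}" using len by auto
  qed
  then have "harris_trees n \<subseteq> Pow {u. set u \<subseteq> {..n} \<and> length u \<le> n}"
    by (auto simp: harris_trees_def)
  then show ?thesis
    using finite_lists_length_le[of "{..n}" n] finite_subset by blast
qed

section \<open>Averaging along the chain\<close>

locale harris_process =
  fixes M :: "'w measure" and X :: "nat \<Rightarrow> 'w \<Rightarrow> nat list set"
  assumes chain: "harris_chain M X"
begin

sublocale prob_space M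
  using chain by (simp add: harris_chain_def)

text \<open>
  A tree does not determine the order in which its nodes arrived.  The orthogonality of
  martingale increments requires conditioning on the whole past, which takes finitely many values.
\<close>

definition history :: "nat \<Rightarrow> 'w \<Rightarrow> nat \<Rightarrow> nat list set" where
  "history n \<omega> = restrict (\<lambda>k. X k \<omega>) {1..n}"

lemma X_measurable: "n \<ge> 1 \<Longrightarrow> X n \<in> M \<rightarrow>\<^sub>M count_space (harris_trees n)"
  using chain by (simp add: harris_chain_def)

lemma X_in: "n \<ge> 1 \<Longrightarrow> \<omega> \<in> space M \<Longrightarrow> X n \<omega> \<in> harris_trees n"
  using measurable_space[OF X_measurable] by simp

lemma X_harris: "n \<ge> 1 \<Longrightarrow> \<omega> \<in> space M \<Longrightarrow> harris_tree (X n \<omega>)"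
  and X_card: "n \<ge> 1 \<Longrightarrow> \<omega> \<in> space M \<Longrightarrow> card (X n \<omega>) = n"
  using X_in by (auto simp: harris_trees_def)

lemma X_1: "\<omega> \<in> space M \<Longrightarrow> X 1 \<omega> = {[]}"
  using chain by (simp add: harris_chain_def)

lemma expectation_finite_range:
  assumes "T \<in> M \<rightarrow>\<^sub>M count_space A" "finite A"
  shows "integrable M (\<lambda>\<omega>. f (T \<omega>) :: real)"
    and "(\<integral>\<omega>. f (T \<omega>) \<partial>M) = (\<Sum>a\<in>A. f a * \<P>(\<omega> in M. T \<omega> = a))"
proof -
  have *: "f (T \<omega>) = (\<Sum>a\<in>A. f a * indicator {\<omega> \<in> space M. T \<omega> = a} \<omega>)"
    if "\<omega> \<in> space M" for \<omega>
    using measurable_space[OF assms(1) that] assms(2) that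
    by (simp add: indicator_def if_distrib[of "\<lambda>z. _ * z"] cong: if_cong)
  have meas: "{\<omega> \<in> space M. T \<omega> = a} \<in> sets M" if "a \<in> A" for a
    using measurable_sets[OF assms(1), of "{a}"] that
    by (simp add: vimage_def Int_def conj_commute)
  have int: "integrable M (\<lambda>\<omega>. \<Sum>a\<in>A. f a * indicator {\<omega> \<in> space M. T \<omega> = a} \<omega>)"
    using meas by (intro Bochner_Integration.integrable_sum integrable_mult_right)
      (auto simp: less_top[symmetric])
  show "integrable M (\<lambda>\<omega>. f (T \<omega>))"
    using int * by (subst Bochner_Integration.integrable_cong[OF refl]) auto
  have "(\<integral>\<omega>. f (T \<omega>) \<partial>M) = (\<integral>\<omega>. (\<Sum>a\<in>A. f a * indicator {\<omega> \<in> space M. T \<omega> = a} \<omega>) \<partial>M)"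
    using * by (intro Bochner_Integration.integral_cong) auto
  also have "\<dots> = (\<Sum>a\<in>A. f a * \<P>(\<omega> in M. T \<omega> = a))"
    using meas by (subst Bochner_Integration.integral_sum) (auto simp: less_top[symmetric])
  finally show "(\<integral>\<omega>. f (T \<omega>) \<partial>M) = (\<Sum>a\<in>A. f a * \<P>(\<omega> in M. T \<omega> = a))" .
qed

lemma measurable_finite_range:
  assumes "finite A" "\<And>\<omega>. \<omega> \<in> space M \<Longrightarrow> T \<omega> \<in> A" "\<And>a. a \<in> A \<Longrightarrow> {\<omega> \<in> space M. T \<omega> = a} \<in> sets M"
  shows "T \<in> M \<rightarrow>\<^sub>M count_space A"
proof -
  have "T -` {a} \<inter> space M = {\<omega> \<in> space M. T \<omega> = a}" for a by auto
  then show ?thesis using assms by (auto simp: measurable_count_space_eq2)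
qed

lemma sets_X_eq: "k \<ge> 1 \<Longrightarrow> {\<omega> \<in> space M. X k \<omega> = y} \<in> sets M"
proof (cases "y \<in> harris_trees k")
  case True
  assume "k \<ge> 1"
  then show ?thesis
    using measurable_sets[OF X_measurable, of k "{y}"] True
    by (simp add: vimage_def Int_def conj_commute)
next
  case False
  assume "k \<ge> 1"
  then have "{\<omega> \<in> space M. X k \<omega> = y} = {}" using False X_in by auto
  then show ?thesis by (metis sets.empty_sets)
qed

lemma history_eq_iff:
  assumes "h \<in> PiE {1..n} harris_trees"
  shows "history n \<omega> = h \<longleftrightarrow> (\<forall>k\<in>{1..n}. X k \<omega> = h k)"
proof
  assume "history n \<omega> = h"
  then show "\<forall>k\<in>{1..n}. X k \<omega> = h k" by (auto simp: history_def)
next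
  assume "\<forall>k\<in>{1..n}. X k \<omega> = h k"
  then show "history n \<omega> = h"
    using assms by (intro ext) (auto simp: history_def PiE_def extensional_def)
qed

lemma history_measurable:
  "history n \<in> M \<rightarrow>\<^sub>M count_space (PiE {1..n} harris_trees)"
proof (rule measurable_finite_range)
  show "finite (PiE {1..n} harris_trees)"
    by (intro finite_PiE) (auto simp: finite_harris_trees)
  show "history n \<omega> \<in> PiE {1..n} harris_trees" if "\<omega> \<in> space M" for \<omega>
    using that X_in by (auto simp: history_def)
  show "{\<omega> \<in> space M. history n \<omega> = h} \<in> sets M" if h: "h \<in> PiE {1..n} harris_trees" for h
    unfolding history_eq_iff[OF h] by (intro sets.sets_Collect_finite_All sets_X_eq) auto
qed

lemma prob_history_step:
  assumes n: "n \<ge> 1" and h: "h \<in> PiE {1..n} harris_trees" and y: "y \<in> harris_trees (n + 1)"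
  shows "\<P>(\<omega> in M. history n \<omega> = h \<and> X (Suc n) \<omega> = y) =
    \<P>(\<omega> in M. history n \<omega> = h) * (if h n \<subseteq> y then 1 / real n else 0)"
proof (cases "\<P>(\<omega> in M. history n \<omega> = h) > 0")
  case False
  then have "\<P>(\<omega> in M. history n \<omega> = h) = 0" by (simp add: zero_less_measure_iff)
  moreover have "\<P>(\<omega> in M. history n \<omega> = h \<and> X (Suc n) \<omega> = y) \<le> \<P>(\<omega> in M. history n \<omega> = h)"
    unfolding history_eq_iff[OF h]
    by (intro finite_measure_mono sets.sets_Collect_finite_All sets_X_eq) auto
  ultimately show ?thesis by (simp add: measure_le_0_iff)
next
  case True
  have "\<P>(\<omega> in M. history n \<omega> = h) \<le> \<P>(\<omega> in M. X n \<omega> = h n)"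
    unfolding history_eq_iff[OF h]
    by (intro finite_measure_mono sets_X_eq n) (use n in auto)
  then have pos: "\<P>(\<omega> in M. X n \<omega> = h n) > 0" using True by linarith
  have hk: "\<forall>k\<in>{1..n}. h k \<in> harris_trees k" using h by auto
  have c: "\<P>(\<omega> in M. X (n + 1) \<omega> = y \<bar> (\<forall>k\<in>{1..n}. X k \<omega> = h k)) =
      \<P>(\<omega> in M. X (n + 1) \<omega> = y \<bar> X n \<omega> = h n)"
    using chain n hk y True unfolding harris_chain_def history_eq_iff[OF h] by blast
  have d: "\<P>(\<omega> in M. X (n + 1) \<omega> = y \<bar> X n \<omega> = h n) = (if h n \<subseteq> y then 1 / real n else 0)"
    using chain n hk y pos unfolding harris_chain_def by auto
  show ?thesis
    using True c[unfolded d] unfolding cond_prob_def history_eq_iff[OF h]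
    by (simp add: field_simps conj_commute split: if_splits)
qed

text \<open>
  Given the past, the \<open>n\<close> successors of the current tree are equally likely.
\<close>

lemma expectation_step:
  assumes n: "n \<ge> 1"
  shows "(\<integral>\<omega>. F (history n \<omega>) (X (Suc n) \<omega>) \<partial>M) =
    (\<integral>\<omega>. (\<Sum>v\<in>X n \<omega>. F (history n \<omega>) (grow (X n \<omega>) v)) / real n \<partial>M)"
    (is "?L = ?R")
proof -
  let ?H = "PiE {1..n} harris_trees" and ?T = "harris_trees (n + 1)"
  let ?G = "\<lambda>h. (\<Sum>v\<in>h n. F h (grow (h n) v)) / real n"
  have fin: "finite ?H" by (intro finite_PiE) (auto simp: finite_harris_trees)
  have hn: "history n \<omega> n = X n \<omega>" for \<omega> using n by (simp add: history_def)
  have pair: "(\<lambda>\<omega>. (history n \<omega>, X (Suc n) \<omega>)) \<in> M \<rightarrow>\<^sub>M count_space (?H \<times> ?T)"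
  proof (rule measurable_finite_range)
    show "finite (?H \<times> ?T)" using fin finite_harris_trees by blast
    show "(history n \<omega>, X (Suc n) \<omega>) \<in> ?H \<times> ?T" if "\<omega> \<in> space M" for \<omega>
      using that X_in[of "Suc n"] measurable_space[OF history_measurable that] by simp
    show "{\<omega> \<in> space M. (history n \<omega>, X (Suc n) \<omega>) = a} \<in> sets M" if "a \<in> ?H \<times> ?T" for a
    proof -
      obtain h y where a: "a = (h, y)" by fastforce
      then have h: "h \<in> ?H" using that by auto
      show ?thesis unfolding a prod.inject history_eq_iff[OF h]
        by (intro sets.sets_Collect_conj sets.sets_Collect_finite_All sets_X_eq) auto
    qed
  qed
  have "?L = (\<Sum>a\<in>?H \<times> ?T. F (fst a) (snd a) * \<P>(\<omega> in M. (history n \<omega>, X (Suc n) \<omega>) = a))"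
    using expectation_finite_range(2)[OF pair, of "\<lambda>a. F (fst a) (snd a)"] fin finite_harris_trees
    by simp
  also have "\<dots> = (\<Sum>h\<in>?H. \<Sum>y\<in>?T. F h y * \<P>(\<omega> in M. history n \<omega> = h \<and> X (Suc n) \<omega> = y))"
    by (simp add: sum.cartesian_product case_prod_unfold prod_eq_iff)
  also have "\<dots> = (\<Sum>h\<in>?H. ?G h * \<P>(\<omega> in M. history n \<omega> = h))"
  proof (rule sum.cong[OF refl])
    fix h assume h: "h \<in> ?H"
    then have "h n \<in> harris_trees n" using n by auto
    then have x: "harris_tree (h n)" "card (h n) = n" by (auto simp: harris_trees_def)
    have "(\<Sum>y\<in>?T. F h y * \<P>(\<omega> in M. history n \<omega> = h \<and> X (Suc n) \<omega> = y)) =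
        (\<Sum>y\<in>?T. if h n \<subseteq> y then F h y * (\<P>(\<omega> in M. history n \<omega> = h) / real n) else 0)"
      by (intro sum.cong refl) (simp add: prob_history_step[OF n h])
    also have "\<dots> = (\<Sum>y\<in>{y \<in> ?T. h n \<subseteq> y}. F h y * (\<P>(\<omega> in M. history n \<omega> = h) / real n))"
      by (rule sum.inter_filter[symmetric]) (rule finite_harris_trees)
    also have "{y \<in> ?T. h n \<subseteq> y} = grow (h n) ` h n"
      using successors_eq[OF x(1)] x(2) by simp
    finally show "(\<Sum>y\<in>?T. F h y * \<P>(\<omega> in M. history n \<omega> = h \<and> X (Suc n) \<omega> = y)) =
        ?G h * \<P>(\<omega> in M. history n \<omega> = h)"
      by (simp add: sum.reindex[OF inj_grow[OF x(1)]] sum_distrib_right sum_divide_distrib)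
  qed
  also have "\<dots> = ?R"
    using expectation_finite_range(2)[OF history_measurable fin, of ?G] by (simp add: hn)
  finally show ?thesis .
qed

lemma integrable_history: "integrable M (\<lambda>\<omega>. f (history n \<omega>) :: real)"
  by (rule expectation_finite_range(1)[OF history_measurable])
     (intro finite_PiE; simp add: finite_harris_trees)

lemma integrable_X: "n \<ge> 1 \<Longrightarrow> integrable M (\<lambda>\<omega>. f (X n \<omega>) :: real)"
  using expectation_finite_range(1)[OF X_measurable finite_harris_trees] .

lemma measurable_X: "n \<ge> 1 \<Longrightarrow> (\<lambda>\<omega>. f (X n \<omega>) :: real) \<in> borel_measurable M"
  by (rule borel_measurable_integrable[OF integrable_X])

definition mean :: "nat \<Rightarrow> (nat list set \<Rightarrow> real) \<Rightarrow> real" where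
  "mean n f = (\<integral>\<omega>. f (X n \<omega>) \<partial>M)"

lemma mean_mono:
  assumes "n \<ge> 1" "\<And>x. harris_tree x \<Longrightarrow> card x = n \<Longrightarrow> f x \<le> g x"
  shows "mean n f \<le> mean n g"
  unfolding mean_def using assms X_harris X_card
  by (intro integral_mono integrable_X) auto

lemma mean_add: "n \<ge> 1 \<Longrightarrow> mean n (\<lambda>x. f x + g x) = mean n f + mean n g"
  and mean_cmult: "mean n (\<lambda>x. c * f x) = c * mean n f"
  and mean_divide: "mean n (\<lambda>x. f x / c) = mean n f / c"
  and mean_const: "mean n (\<lambda>x. c) = c"
  unfolding mean_def using integrable_X[of n f] integrable_X[of n g] by (simp_all add: prob_space)

lemma mean_Suc:
  "n \<ge> 1 \<Longrightarrow> mean (Suc n) f = mean n (\<lambda>x. (\<Sum>v\<in>x. f (grow x v)) / real n)"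
  unfolding mean_def by (rule expectation_step[of n "\<lambda>_. f"])

text \<open>
  All moment bounds below come from this principle: a functional whose average over the
  possible successors of a tree with \<open>n\<close> nodes is at most \<open>1 + 2/n\<close> times its value has an
  expectation that grows at most like \<open>(1 + 2/1) (1 + 2/2) \<dots> (1 + 2/(n-1)) = n (n+1) / 2\<close>.
\<close>

lemma quadratic_drift:
  assumes drift: "\<And>x. harris_tree x \<Longrightarrow> (\<Sum>v\<in>x. f (grow x v)) \<le> (real (card x) + 2) * f x"
    and n: "n \<ge> 1"
  shows "mean n f \<le> real n * (real n + 1) / 2 * f {[]}"
  using n
proof (induction n rule: nat_induct_at_least)
  case base
  have "mean 1 f = mean 1 (\<lambda>_. f {[]})"
    unfolding mean_def by (intro Bochner_Integration.integral_cong) (use X_1 in simp_all)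
  then show ?case by (simp add: mean_const)
next
  case (Suc n)
  have "mean (Suc n) f \<le> mean n (\<lambda>x. (real n + 2) / real n * f x)"
    unfolding mean_Suc[OF Suc.hyps]
  proof (rule mean_mono[OF Suc.hyps])
    fix x assume "harris_tree x" "card x = n"
    with divide_right_mono[OF drift, of x "real n"]
    show "(\<Sum>v\<in>x. f (grow x v)) / real n \<le> (real n + 2) / real n * f x" by simp
  qed
  also have "\<dots> \<le> (real n + 2) / real n * (real n * (real n + 1) / 2 * f {[]})"
    unfolding mean_cmult by (intro mult_left_mono Suc.IH) auto
  also have "\<dots> = real (Suc n) * (real (Suc n) + 1) / 2 * f {[]}"
    using Suc.hyps by (simp add: field_simps)
  finally show ?case .
qed

end

section \<open>Distances and the Wiener index\<close>

text \<open>
  Counting common prefixes, instead of taking the longest one, turns sums of \<open>|u \<and> v|\<close> over pairs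
  into sums over nodes of squared subtree sizes.
\<close>

definition common_depth :: "nat list \<Rightarrow> nat list \<Rightarrow> nat" where
  "common_depth u v = card {w. w \<noteq> [] \<and> prefix w u \<and> prefix w v}"

definition tree_dist :: "nat list \<Rightarrow> nat list \<Rightarrow> real" where
  "tree_dist u v = real (length u) + real (length v) - 2 * real (common_depth u v)"

lemma card_prefixes: "card {w. w \<noteq> [] \<and> prefix w u} = length u"
proof -
  have "{w. w \<noteq> [] \<and> prefix w u} = set (prefixes u) - {[]}" by auto
  then show ?thesis by (simp add: card_Diff_singleton)
qed

lemma common_depth_eq: "common_depth u v = length (Longest_common_prefix {u, v})"
proof -
  let ?l = "Longest_common_prefix {u, v}"
  have "prefix ?l u" "prefix ?l v" by (auto intro: Longest_common_prefix_prefix)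
  then have "prefix w u \<and> prefix w v \<longleftrightarrow> prefix w ?l" for w
    using Longest_common_prefix_max_prefix[of "{u, v}" w] prefix_order.trans[of w ?l] by blast
  then show ?thesis unfolding common_depth_def by (simp add: card_prefixes)
qed

lemma common_depth_le: "common_depth u v \<le> length u" "common_depth u v \<le> length v"
  unfolding common_depth_eq by (auto intro!: prefix_length_le Longest_common_prefix_prefix)

lemma graph_dist_tree_dist:
  assumes "harris_tree x" "u \<in> x" "v \<in> x"
  shows "real (graph_dist x u v) = tree_dist u v"
  unfolding graph_dist_eq[OF assms] common_depth_eq[symmetric] tree_dist_def
  using common_depth_le[of u v] by (simp add: of_nat_diff)

lemma tree_dist_nonneg: "0 \<le> tree_dist u v"
  using common_depth_le[of u v] by (simp add: tree_dist_def)

lemma tree_dist_le: "tree_dist u v \<le> real (length u) + real (length v)"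
  by (simp add: tree_dist_def)

lemma tree_dist_commute: "tree_dist u v = tree_dist v u"
  by (simp add: tree_dist_def common_depth_def conj_commute)

lemma tree_dist_self [simp]: "tree_dist u u = 0"
  by (simp add: tree_dist_def common_depth_def card_prefixes)

text \<open>
  A new leaf is not a prefix of any old node, so that all paths to it pass through its parent.
\<close>

lemma tree_dist_new_node:
  assumes "harris_tree x" "w \<in> x"
  shows "tree_dist (new_node x u) w = tree_dist u w + 1"
proof -
  have "common_depth (new_node x u) w = common_depth u w"
    unfolding common_depth_def prefix_new_node_iff
    by (metis not_prefix_new_node[OF assms])
  then show ?thesis by (simp add: tree_dist_def new_node_def)
qed

lemma wiener_eq:
  assumes "harris_tree x"
  shows "wiener_index x = (\<Sum>u\<in>x. \<Sum>v\<in>x. tree_dist u v) / 2"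
proof -
  have "(\<Sum>(u, v)\<in>x \<times> x. real (graph_dist x u v)) = (\<Sum>(u, v)\<in>x \<times> x. tree_dist u v)"
    using graph_dist_tree_dist[OF assms] by (intro sum.cong) auto
  then show ?thesis unfolding wiener_index_def by (simp add: sum.cartesian_product)
qed

lemma wiener_nonneg: "0 \<le> wiener_index x"
  by (auto simp: wiener_index_def intro!: sum_nonneg)

lemma wiener_grow:
  assumes x: "harris_tree x" and u: "u \<in> x"
  shows "wiener_index (grow x u) = wiener_index x + (\<Sum>w\<in>x. tree_dist u w + 1)"
proof -
  let ?z = "new_node x u"
  have "(\<Sum>a\<in>grow x u. \<Sum>b\<in>grow x u. tree_dist a b) =
      (\<Sum>a\<in>x. \<Sum>b\<in>x. tree_dist a b) + (\<Sum>a\<in>x. tree_dist a ?z) + (\<Sum>b\<in>x. tree_dist ?z b)"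
    by (simp add: sum_grow[OF x] sum.distrib)
  also have "(\<Sum>a\<in>x. tree_dist a ?z) = (\<Sum>b\<in>x. tree_dist ?z b)"
    by (simp add: tree_dist_commute)
  also have "(\<Sum>b\<in>x. tree_dist ?z b) = (\<Sum>w\<in>x. tree_dist u w + 1)"
    by (intro sum.cong refl) (simp add: tree_dist_new_node[OF x])
  finally show ?thesis by (simp add: wiener_eq[OF x] wiener_eq[OF harris_grow[OF x u]])
qed

section \<open>The Wiener martingale\<close>

text \<open>The increment \<open>\<Sum>\<^sub>w (d(u,w) + 1)\<close> has mean \<open>n + 2 WI(x) / n\<close> over \<open>u \<in> x\<close>, so that
  \<open>WI(X\<^sub>n) / (n (n+1))\<close> is a martingale up to deterministic increments; the latter sum up to
  the harmonic expression subtracted here.\<close>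

definition wiener_mart :: "nat list set \<Rightarrow> real" where
  "wiener_mart x = wiener_index x / (real (card x) * (real (card x) + 1)) -
     (harm (card x) - 2 + 2 / (real (card x) + 1))"

definition tree_height :: "nat list set \<Rightarrow> nat" where
  "tree_height x = Max (length ` x)"

lemma length_le_height: "harris_tree x \<Longrightarrow> v \<in> x \<Longrightarrow> length v \<le> tree_height x"
  unfolding tree_height_def by (intro Max_ge) (auto simp: harris_finite)

lemma wiener_mart_grow:
  assumes x: "harris_tree x" and u: "u \<in> x"
  defines "n \<equiv> real (card x)"
  shows "wiener_mart (grow x u) - wiener_mart x =
    ((\<Sum>w\<in>x. tree_dist u w + 1) - (n + 2 * wiener_index x / n)) / ((n + 1) * (n + 2))"
proof -
  have n: "n > 0" using card_harris_pos[OF x] by (simp add: n_def)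
  have alg: "(W + D) / ((n + 1) * (n + 2)) - (h + 1 / (n + 1) - 2 + 2 / (n + 2)) -
      (W / (n * (n + 1)) - (h - 2 + 2 / (n + 1))) = (D - (n + 2 * W / n)) / ((n + 1) * (n + 2))"
    for W D h
    using n by (simp add: divide_simps) algebra
  show ?thesis
    unfolding wiener_mart_def card_grow[OF x] wiener_grow[OF x u] harm_Suc
    using alg[of "wiener_index x" "\<Sum>w\<in>x. tree_dist u w + 1" "harm (card x)"]
    by (simp add: n_def inverse_eq_divide add.commute)
qed

lemma wiener_mart_drift:
  assumes x: "harris_tree x"
  shows "(\<Sum>u\<in>x. wiener_mart (grow x u) - wiener_mart x) = 0"
proof -
  let ?n = "real (card x)"
  have n: "?n > 0" using card_harris_pos[OF x] by simp
  have "(\<Sum>u\<in>x. wiener_mart (grow x u) - wiener_mart x) =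
      (\<Sum>u\<in>x. (\<Sum>w\<in>x. tree_dist u w + 1) - (?n + 2 * wiener_index x / ?n)) / ((?n + 1) * (?n + 2))"
    by (simp add: wiener_mart_grow[OF x] sum_divide_distrib)
  also have "(\<Sum>u\<in>x. (\<Sum>w\<in>x. tree_dist u w + 1) - (?n + 2 * wiener_index x / ?n)) = 0"
    using n by (simp add: wiener_eq[OF x] sum_subtractf sum.distrib)
  finally show ?thesis by simp
qed

lemma wiener_mart_increment:
  assumes x: "harris_tree x" and u: "u \<in> x"
  shows "\<bar>wiener_mart (grow x u) - wiener_mart x\<bar> \<le> 2 * real (tree_height x + 1) / real (card x)"
proof -
  let ?n = "real (card x)" and ?h = "real (tree_height x)"
  have n: "?n \<ge> 1" using card_harris_pos[OF x] by simp
  have d: "tree_dist a b \<le> 2 * ?h" if "a \<in> x" "b \<in> x" for a b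
    using tree_dist_le[of a b] length_le_height[OF x] that by (smt (verit) of_nat_mono)
  have "(\<Sum>w\<in>x. tree_dist u w + 1) \<le> (\<Sum>w\<in>x. 2 * ?h + 1)"
    using d u by (intro sum_mono) auto
  moreover have "0 \<le> (\<Sum>w\<in>x. tree_dist u w + 1)"
    by (intro sum_nonneg) (simp add: tree_dist_nonneg)
  moreover have "wiener_index x \<le> (\<Sum>a\<in>x. \<Sum>b\<in>x. 2 * ?h) / 2"
    unfolding wiener_eq[OF x] using d by (intro divide_right_mono sum_mono) auto
  then have "2 * wiener_index x / ?n \<le> ?n * (2 * ?h)"
    using n by (simp add: field_simps)
  moreover have "0 \<le> 2 * wiener_index x / ?n" by (simp add: wiener_nonneg)
  ultimately have D: "\<bar>(\<Sum>w\<in>x. tree_dist u w + 1) - (?n + 2 * wiener_index x / ?n)\<bar>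
      \<le> ?n * (2 * ?h + 1)"
    using n by (auto simp: algebra_simps)
  have "\<bar>wiener_mart (grow x u) - wiener_mart x\<bar> \<le> ?n * (2 * ?h + 1) / ((?n + 1) * (?n + 2))"
    unfolding wiener_mart_grow[OF x u] using D n by (simp add: divide_right_mono)
  also have "\<dots> \<le> ?n * (2 * (?h + 1)) / (?n * ?n)"
    using n by (intro frac_le mult_left_mono mult_mono) auto
  finally show ?thesis using n by (simp add: add.commute)
qed

section \<open>Moments of the height\<close>

lemma exp_height_le:
  assumes x: "harris_tree x"
  shows "2 ^ tree_height x \<le> (\<Sum>v\<in>x. (2::real) ^ length v)"
proof -
  have "tree_height x \<in> length ` x"
    unfolding tree_height_def using x harris_ne by (intro Max_in) (auto simp: harris_finite)
  then obtain v where "v \<in> x" "tree_height x = length v" by auto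
  then show ?thesis
    using member_le_sum[of v x "\<lambda>v. (2::real) ^ length v"] harris_finite[OF x] by simp
qed

lemma power_le_exp_quarter:
  "\<exists>C>0. \<forall>h::nat. real (h + 1) ^ q \<le> C * (2 ^ h) powr (1/4)"
proof -
  have "(\<lambda>h::nat. real (h + 1) ^ q / (2 ^ h) powr (1/4)) \<longlonglongrightarrow> 0"
    by real_asymp
  then have "Bseq (\<lambda>h::nat. real (h + 1) ^ q / (2 ^ h) powr (1/4))"
    by (intro convergent_imp_Bseq) (auto simp: convergent_def)
  then obtain C where "C > 0" "\<And>h::nat. norm (real (h + 1) ^ q / (2 ^ h) powr (1/4)) \<le> C"
    unfolding Bseq_def by blast
  then show ?thesis by (intro exI[of _ C]) (auto simp: divide_simps)
qed

text \<open>
  An upper bound that is affine in \<open>y\<close>, so that a bound \<open>n\<^sup>2\<close> for the mean of \<open>y\<close> yields a bound of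
  order \<open>n\<^sup>1\<^sup>/\<^sup>2\<close> for the mean of the fourth root.
\<close>

lemma quarter_power_le:
  fixes y n :: real
  assumes "y > 0" "n \<ge> 1"
  shows "y powr (1/4) \<le> n powr (1/2) + y * n powr (- 3/2)"
proof (cases "y \<le> n ^ 2")
  case True
  then have "y powr (1/4) \<le> (n ^ 2) powr (1/4)" using assms by (intro powr_mono2) auto
  also have "\<dots> = n powr (1/2)" using assms by (simp add: powr_powr flip: powr_numeral)
  finally show ?thesis using assms by (simp add: add_increasing2)
next
  case False
  have "y powr (1/4) = y * y powr (- 3/4)" using assms by (simp add: powr_mult_base)
  also have "\<dots> \<le> y * (n ^ 2) powr (- 3/4)"
    using assms False by (intro mult_left_mono powr_mono2') auto
  also have "(n ^ 2) powr (- 3/4) = n powr (- 3/2)"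
    using assms by (simp add: powr_powr flip: powr_numeral)
  finally show ?thesis by (simp add: add_increasing)
qed

context harris_process
begin

text \<open>
  A child of \<open>u\<close> adds \<open>2 \<cdot> 2\<^sup>l\<close> with \<open>l = |u|\<close> to the sum; on average this multiplies it by exactly
  \<open>1 + 2/n\<close>.
\<close>

lemma mean_exp_depth:
  assumes n: "n \<ge> 1"
  shows "mean n (\<lambda>x. \<Sum>v\<in>x. 2 ^ length v) \<le> real n ^ 2"
proof -
  have "mean n (\<lambda>x. \<Sum>v\<in>x. 2 ^ length v) \<le>
      real n * (real n + 1) / 2 * (\<Sum>v\<in>{[]}. (2::real) ^ length (v :: nat list))"
  proof (rule quadratic_drift[OF _ n])
    fix x assume x: "harris_tree x"
    show "(\<Sum>v\<in>x. \<Sum>w\<in>grow x v. (2::real) ^ length w) \<le>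
        (real (card x) + 2) * (\<Sum>v\<in>x. 2 ^ length v)"
      by (simp add: sum_grow[OF x] sum.distrib new_node_def sum_distrib_left algebra_simps)
  qed
  also have "\<dots> \<le> real n * (real n + real n) / 2" using n by (simp add: mult_left_mono)
  finally show ?thesis by (simp add: power2_eq_square)
qed

text \<open>
  The height grows logarithmically; any power of it is dominated by the fourth root of \<open>2\<close> to the
  power of the height, which is at most the sum of the preceding lemma.
\<close>

lemma height_moments:
  "\<exists>C>0. \<forall>n\<ge>1. mean n (\<lambda>x. real (tree_height x + 1) ^ q) \<le> C * real n powr (1/2)"
proof -
  obtain C where C: "C > 0" "\<And>h::nat. real (h + 1) ^ q \<le> C * (2 ^ h) powr (1/4)"
    using power_le_exp_quarter by blast
  have "mean n (\<lambda>x. real (tree_height x + 1) ^ q) \<le> 2 * C * real n powr (1/2)" if n: "n \<ge> 1" for n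
  proof -
    let ?S = "\<lambda>x. (\<Sum>v\<in>x. (2::real) ^ length (v :: nat list))"
    have "mean n (\<lambda>x. real (tree_height x + 1) ^ q) \<le>
        mean n (\<lambda>x. C * (real n powr (1/2) + real n powr (- 3/2) * ?S x))"
    proof (rule mean_mono[OF n])
      fix x assume x: "harris_tree x"
      have "real (tree_height x + 1) ^ q \<le> C * (2 ^ tree_height x) powr (1/4)" by (rule C)
      also have "(2 ^ tree_height x) powr (1/4) \<le>
          real n powr (1/2) + 2 ^ tree_height x * real n powr (- 3/2)"
        using n by (intro quarter_power_le) auto
      also have "\<dots> \<le> real n powr (1/2) + ?S x * real n powr (- 3/2)"
        by (intro add_left_mono mult_right_mono exp_height_le x) auto
      finally show "real (tree_height x + 1) ^ q \<le>
          C * (real n powr (1/2) + real n powr (- 3/2) * ?S x)"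
        using C(1) by (simp add: mult.commute)
    qed
    also have "\<dots> = C * (real n powr (1/2) + real n powr (- 3/2) * mean n ?S)"
      using n by (simp add: mean_cmult mean_add mean_const)
    also have "\<dots> \<le> C * (real n powr (1/2) + real n powr (- 3/2) * real n ^ 2)"
      using C(1) mean_exp_depth[OF n] by (intro mult_left_mono add_left_mono) auto
    also have "real n powr (- 3/2) * real n ^ 2 = real n powr (1/2)"
      using n by (simp flip: powr_numeral powr_add)
    finally show ?thesis by simp
  qed
  then show ?thesis using C(1) by (intro exI[of _ "2 * C"]) auto
qed

end

section \<open>Bounds on powers of sums\<close>

text \<open>
  The increment is written as \<open>e b\<close> with \<open>b\<close> of order one: the linear term has mean zero for a
  martingale, and all further terms carry the factor \<open>e\<^sup>2\<close>.
\<close>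

lemma power_taylor_bound:
  fixes a b e :: real
  assumes M: "M \<ge> 2" and e: "0 \<le> e" "e \<le> 1"
  shows "(a + e * b) ^ M \<le>
    a ^ M + real M * a ^ (M - 1) * (e * b) + 2 ^ M * e ^ 2 * (\<bar>a\<bar> ^ M + \<bar>b\<bar> ^ M)"
proof -
  let ?t = "\<lambda>k. real (M choose k) * (e * b) ^ k * a ^ (M - k)"
  have "(a + e * b) ^ M = (\<Sum>k\<le>M. ?t k)"
    by (subst add.commute) (simp add: binomial_ring)
  also have "{..M} = insert 0 (insert 1 {2..M})" using M by auto
  also have "(\<Sum>k\<in>insert 0 (insert 1 {2..M}). ?t k) = a ^ M + real M * a ^ (M - 1) * (e * b) + (\<Sum>k\<in>{2..M}. ?t k)"
    using M by simp
  also have "(\<Sum>k\<in>{2..M}. ?t k) \<le> (\<Sum>k\<in>{2..M}. real (M choose k) * (e ^ 2 * (\<bar>a\<bar> ^ M + \<bar>b\<bar> ^ M)))"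
  proof (rule sum_mono)
    fix k assume k: "k \<in> {2..M}"
    let ?m = "max \<bar>a\<bar> \<bar>b\<bar>"
    have "?t k \<le> \<bar>?t k\<bar>" by simp
    also have "\<dots> = real (M choose k) * (e ^ k * (\<bar>b\<bar> ^ k * \<bar>a\<bar> ^ (M - k)))"
      using e by (simp add: abs_mult power_abs power_mult_distrib)
    also have "\<bar>b\<bar> ^ k * \<bar>a\<bar> ^ (M - k) \<le> ?m ^ k * ?m ^ (M - k)"
      by (intro mult_mono power_mono) auto
    also have "?m ^ k * ?m ^ (M - k) = ?m ^ M" using k by (simp flip: power_add)
    also have "?m ^ M \<le> \<bar>a\<bar> ^ M + \<bar>b\<bar> ^ M" by (simp add: max_def)
    also have "e ^ k \<le> e ^ 2" using k e by (intro power_decreasing) auto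
    finally show "?t k \<le> real (M choose k) * (e ^ 2 * (\<bar>a\<bar> ^ M + \<bar>b\<bar> ^ M))"
      using e by (simp add: mult_left_mono mult_right_mono)
  qed
  also have "\<dots> = (\<Sum>k\<in>{2..M}. real (M choose k)) * (e ^ 2 * (\<bar>a\<bar> ^ M + \<bar>b\<bar> ^ M))"
    by (simp add: sum_distrib_right)
  also have "\<dots> \<le> 2 ^ M * (e ^ 2 * (\<bar>a\<bar> ^ M + \<bar>b\<bar> ^ M))"
  proof (rule mult_right_mono)
    have "(\<Sum>k\<in>{2..M}. real (M choose k)) \<le> (\<Sum>k\<le>M. real (M choose k))"
      by (intro sum_mono2) auto
    also have "\<dots> = 2 ^ M" using choose_row_sum[of M] by (simp flip: of_nat_sum)
    finally show "(\<Sum>k\<in>{2..M}. real (M choose k)) \<le> 2 ^ M" .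
  qed auto
  finally show ?thesis by (simp add: mult.assoc)
qed

lemma power_sum_bound:
  fixes a b :: real
  shows "\<bar>a + b\<bar> ^ q \<le> 2 ^ q * (\<bar>a\<bar> ^ q + \<bar>b\<bar> ^ q)"
proof -
  let ?m = "max \<bar>a\<bar> \<bar>b\<bar>"
  have "\<bar>a + b\<bar> ^ q \<le> (2 * ?m) ^ q" by (intro power_mono) auto
  also have "\<dots> = 2 ^ q * ?m ^ q" by (simp add: power_mult_distrib)
  also have "?m ^ q \<le> \<bar>a\<bar> ^ q + \<bar>b\<bar> ^ q" by (simp add: max_def)
  finally show ?thesis by simp
qed

lemma multiplicative_gronwall:
  fixes u e :: "nat \<Rightarrow> real"
  assumes step: "\<And>n. n \<ge> 1 \<Longrightarrow> u (Suc n) \<le> (1 + e n) * u n" and e: "\<And>n. e n \<ge> 0"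
    and sum: "summable e" and u: "u 1 \<ge> 0" and n: "n \<ge> 1"
  shows "u n \<le> exp (suminf e) * u 1"
proof -
  have "u n \<le> exp (\<Sum>k<n. e k) * u 1" using n
  proof (induction n rule: nat_induct_at_least)
    case base
    then show ?case using u e[of 0] by (simp add: mult_le_cancel_right1)
  next
    case (Suc n)
    have "u (Suc n) \<le> (1 + e n) * u n" by (rule step[OF Suc.hyps])
    also have "\<dots> \<le> (1 + e n) * (exp (\<Sum>k<n. e k) * u 1)"
      using e[of n] by (intro mult_left_mono Suc.IH) auto
    also have "\<dots> \<le> exp (e n) * (exp (\<Sum>k<n. e k) * u 1)"
      using u by (intro mult_right_mono exp_ge_add_one_self) auto
    finally show ?case by (simp add: exp_add mult_ac)
  qed
  also have "\<dots> \<le> exp (suminf e) * u 1"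
    using u e sum by (intro mult_right_mono) (auto intro: sum_le_suminf)
  finally show ?thesis .
qed

section \<open>Moments and convergence of the Wiener martingale\<close>

context harris_process
begin

abbreviation W_mart :: "nat \<Rightarrow> 'w \<Rightarrow> real" where
  "W_mart n \<omega> \<equiv> wiener_mart (X n \<omega>)"

lemma integrable_past:
  assumes "\<And>h h'. (\<And>k. 1 \<le> k \<Longrightarrow> k \<le> N \<Longrightarrow> h k = h' k) \<Longrightarrow> f h = f h'"
  shows "integrable M (\<lambda>\<omega>. f (\<lambda>k. X k \<omega>) :: real)"
proof -
  have "f (\<lambda>k. X k \<omega>) = f (history N \<omega>)" for \<omega>
    by (rule assms) (simp add: history_def)
  then show ?thesis using integrable_history[of f N] by simp
qed

lemma integrable_X2: "m \<ge> 1 \<Longrightarrow> n \<ge> 1 \<Longrightarrow> integrable M (\<lambda>\<omega>. g (X m \<omega>) (X n \<omega>) :: real)"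
  by (rule integrable_past[of "max m n" "\<lambda>h. g (h m) (h n)"]) simp

lemma W_mart_orthogonal:
  assumes n: "n \<ge> 1" and past: "\<And>h h'. (\<And>k. 1 \<le> k \<Longrightarrow> k \<le> n \<Longrightarrow> h k = h' k) \<Longrightarrow> f h = f h'"
  shows "(\<integral>\<omega>. f (\<lambda>k. X k \<omega>) * (W_mart (Suc n) \<omega> - W_mart n \<omega>) \<partial>M) = 0"
proof -
  let ?F = "\<lambda>h y. f h * (wiener_mart y - wiener_mart (h n))"
  have hn: "history n \<omega> n = X n \<omega>" for \<omega> using n by (simp add: history_def)
  have f: "f (\<lambda>k. X k \<omega>) = f (history n \<omega>)" for \<omega>
    by (rule past) (simp add: history_def)
  have "(\<integral>\<omega>. ?F (history n \<omega>) (X (Suc n) \<omega>) \<partial>M) = (\<integral>\<omega>. 0 \<partial>M)"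
    unfolding expectation_step[OF n, of ?F]
    using wiener_mart_drift X_harris[OF n]
    by (intro Bochner_Integration.integral_cong refl) (simp add: hn flip: sum_distrib_left)
  then show ?thesis by (simp add: f hn)
qed

lemma increment_moments:
  "\<exists>C>0. \<forall>n\<ge>1. (\<integral>\<omega>. \<bar>W_mart (Suc n) \<omega> - W_mart n \<omega>\<bar> ^ q \<partial>M) \<le> C * real n powr (1/2) / real n ^ q"
proof -
  obtain C where C: "C > 0"
    "\<And>n. n \<ge> 1 \<Longrightarrow> mean n (\<lambda>x. real (tree_height x + 1) ^ q) \<le> C * real n powr (1/2)"
    using height_moments by blast
  have "(\<integral>\<omega>. \<bar>W_mart (Suc n) \<omega> - W_mart n \<omega>\<bar> ^ q \<partial>M) \<le> 2 ^ q * C * real n powr (1/2) / real n ^ q"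
    if n: "n \<ge> 1" for n
  proof -
    let ?F = "\<lambda>h y. \<bar>wiener_mart y - wiener_mart (h n)\<bar> ^ q"
    let ?b = "\<lambda>x. (2 / real n) ^ q * real (tree_height x + 1) ^ q"
    have hn: "history n \<omega> n = X n \<omega>" for \<omega> using n by (simp add: history_def)
    have "(\<integral>\<omega>. \<bar>W_mart (Suc n) \<omega> - W_mart n \<omega>\<bar> ^ q \<partial>M) =
        mean n (\<lambda>x. (\<Sum>v\<in>x. \<bar>wiener_mart (grow x v) - wiener_mart x\<bar> ^ q) / real n)"
      using expectation_step[OF n, of ?F] by (simp add: hn mean_def)
    also have "\<dots> \<le> mean n ?b"
    proof (rule mean_mono[OF n])
      fix x assume x: "harris_tree x" and c: "card x = n"
      have "(\<Sum>v\<in>x. \<bar>wiener_mart (grow x v) - wiener_mart x\<bar> ^ q) \<le> (\<Sum>v\<in>x. ?b x)"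
      proof (rule sum_mono)
        fix v assume "v \<in> x"
        from wiener_mart_increment[OF x this]
        have "\<bar>wiener_mart (grow x v) - wiener_mart x\<bar> ^ q \<le>
            (2 * real (tree_height x + 1) / real n) ^ q"
          by (intro power_mono) (auto simp: c)
        then show "\<bar>wiener_mart (grow x v) - wiener_mart x\<bar> ^ q \<le> ?b x"
          by (simp only: times_divide_eq_left[symmetric] power_mult_distrib)
      qed
      then show "(\<Sum>v\<in>x. \<bar>wiener_mart (grow x v) - wiener_mart x\<bar> ^ q) / real n \<le> ?b x"
        using n by (simp add: c field_simps)
    qed
    also have "\<dots> \<le> (2 / real n) ^ q * (C * real n powr (1/2))"
      unfolding mean_cmult by (intro mult_left_mono C(2) n) auto
    finally show ?thesis by (simp add: power_divide mult_ac)
  qed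
  then show ?thesis using C(1) by (intro exI[of _ "2 ^ q * C"]) auto
qed

text \<open>
  With \<open>e\<close> equal to \<open>n\<close> to the power \<open>-3/4\<close>, the increments divided by \<open>e\<close> have bounded moments.
  The Taylor bound then shows that the moments, up to an additive constant, grow by factors
  \<open>1 + O(e\<^sup>2)\<close>, and the sum of the \<open>e\<^sup>2\<close> converges.
\<close>

lemma W_mart_even_moments:
  assumes m: "m \<ge> 1"
  shows "\<exists>C. \<forall>n\<ge>1. mean n (\<lambda>x. wiener_mart x ^ (2 * m)) \<le> C"
proof -
  let ?M = "2 * m"
  obtain C where C: "C > 0" "\<And>n. n \<ge> 1 \<Longrightarrow>
      (\<integral>\<omega>. \<bar>W_mart (Suc n) \<omega> - W_mart n \<omega>\<bar> ^ ?M \<partial>M) \<le> C * real n powr (1/2) / real n ^ ?M"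
    using increment_moments by blast
  define u where "u n = (\<integral>\<omega>. W_mart n \<omega> ^ ?M \<partial>M) + C" for n
  define e where "e n = 2 ^ ?M * real n powr (- 3/2)" for n
  have u0: "u n \<ge> 0" for n using C(1) by (simp add: u_def integral_nonneg)
  have "u (Suc n) \<le> (1 + e n) * u n" if n: "n \<ge> 1" for n
  proof -
    let ?D = "\<lambda>\<omega>. W_mart (Suc n) \<omega> - W_mart n \<omega>"
    let ?e = "real n powr (- 3/4)"
    let ?b = "\<lambda>\<omega>. \<bar>?D \<omega>\<bar> ^ ?M / ?e ^ ?M"
    have e: "0 < ?e" "?e \<le> 1" using n powr_mono[of "- 3/4" 0 "real n"] by auto
    have e2: "?e ^ 2 = real n powr (- 3/2)" using n by (simp flip: powr_realpow add: powr_powr)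
    have eM: "?e ^ ?M = real n powr (- 3/2 * real m)"
      using n by (simp flip: powr_realpow add: powr_powr)
    have "(\<integral>\<omega>. W_mart (Suc n) \<omega> ^ ?M \<partial>M) \<le> (\<integral>\<omega>. W_mart n \<omega> ^ ?M +
        real ?M * W_mart n \<omega> ^ (?M - 1) * ?D \<omega> + 2 ^ ?M * ?e ^ 2 * (W_mart n \<omega> ^ ?M + ?b \<omega>) \<partial>M)"
    proof (rule integral_mono)
      show "integrable M (\<lambda>\<omega>. W_mart (Suc n) \<omega> ^ ?M)"
        by (rule integrable_X[of "Suc n" "\<lambda>x. wiener_mart x ^ ?M"]) simp
      show "integrable M (\<lambda>\<omega>. W_mart n \<omega> ^ ?M +
        real ?M * W_mart n \<omega> ^ (?M - 1) * ?D \<omega> + 2 ^ ?M * ?e ^ 2 * (W_mart n \<omega> ^ ?M + ?b \<omega>))"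
        by (rule integrable_X2[OF n, of "Suc n" "\<lambda>x y. wiener_mart x ^ ?M +
          real ?M * wiener_mart x ^ (?M - 1) * (wiener_mart y - wiener_mart x) +
          2 ^ ?M * ?e ^ 2 * (wiener_mart x ^ ?M + \<bar>wiener_mart y - wiener_mart x\<bar> ^ ?M / ?e ^ ?M)"]) simp
      fix \<omega>
      show "W_mart (Suc n) \<omega> ^ ?M \<le> W_mart n \<omega> ^ ?M +
        real ?M * W_mart n \<omega> ^ (?M - 1) * ?D \<omega> + 2 ^ ?M * ?e ^ 2 * (W_mart n \<omega> ^ ?M + ?b \<omega>)"
        using power_taylor_bound[of ?M ?e "W_mart n \<omega>" "?D \<omega> / ?e"] e m
        by (simp add: power_even_abs power_divide)
    qed
    also have "\<dots> = (\<integral>\<omega>. W_mart n \<omega> ^ ?M \<partial>M) +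
        (\<integral>\<omega>. real ?M * W_mart n \<omega> ^ (?M - 1) * ?D \<omega> \<partial>M) +
        2 ^ ?M * ?e ^ 2 * ((\<integral>\<omega>. W_mart n \<omega> ^ ?M \<partial>M) + (\<integral>\<omega>. \<bar>?D \<omega>\<bar> ^ ?M \<partial>M) / ?e ^ ?M)"
      using integrable_X[OF n, of "\<lambda>x. wiener_mart x ^ ?M"]
        integrable_X2[OF n, of "Suc n" "\<lambda>x y. real ?M * wiener_mart x ^ (?M - 1) * (wiener_mart y - wiener_mart x)"]
        integrable_X2[OF n, of "Suc n" "\<lambda>x y. \<bar>wiener_mart y - wiener_mart x\<bar> ^ ?M"]
      by simp
    also have "(\<integral>\<omega>. real ?M * W_mart n \<omega> ^ (?M - 1) * ?D \<omega> \<partial>M) = 0"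
      by (rule W_mart_orthogonal[OF n, of "\<lambda>h. real ?M * wiener_mart (h n) ^ (?M - 1)"]) (use n in simp)
    finally have 1: "(\<integral>\<omega>. W_mart (Suc n) \<omega> ^ ?M \<partial>M) \<le> (\<integral>\<omega>. W_mart n \<omega> ^ ?M \<partial>M) +
        2 ^ ?M * ?e ^ 2 * ((\<integral>\<omega>. W_mart n \<omega> ^ ?M \<partial>M) + (\<integral>\<omega>. \<bar>?D \<omega>\<bar> ^ ?M \<partial>M) / ?e ^ ?M)"
      by simp
    have "(\<integral>\<omega>. \<bar>?D \<omega>\<bar> ^ ?M \<partial>M) / ?e ^ ?M \<le> C"
    proof -
      have "(\<integral>\<omega>. \<bar>?D \<omega>\<bar> ^ ?M \<partial>M) \<le> C * real n powr (1/2) / real n ^ ?M" by (rule C(2)[OF n])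
      also have "\<dots> = C * real n powr (1/2 - 2 * real m)"
        using n by (simp add: powr_diff powr_realpow[symmetric])
      also have "\<dots> \<le> C * real n powr (- 3/2 * real m)"
        using C(1) n m by (intro mult_left_mono powr_mono) auto
      finally show ?thesis unfolding eM using n by (simp add: pos_divide_le_eq)
    qed
    then have 2: "2 ^ ?M * ?e ^ 2 * ((\<integral>\<omega>. W_mart n \<omega> ^ ?M \<partial>M) +
        (\<integral>\<omega>. \<bar>?D \<omega>\<bar> ^ ?M \<partial>M) / ?e ^ ?M) \<le> 2 ^ ?M * ?e ^ 2 * u n"
      unfolding u_def by (intro mult_left_mono add_left_mono) auto
    from 1 2 have "(\<integral>\<omega>. W_mart (Suc n) \<omega> ^ ?M \<partial>M) \<le>
        (\<integral>\<omega>. W_mart n \<omega> ^ ?M \<partial>M) + 2 ^ ?M * ?e ^ 2 * u n"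
      by linarith
    then show ?thesis unfolding e2 by (simp add: u_def e_def algebra_simps)
  qed
  moreover have "summable e"
    unfolding e_def by (intro summable_mult) (simp add: summable_real_powr_iff)
  moreover have "e n \<ge> 0" for n by (simp add: e_def)
  ultimately have "u n \<le> exp (suminf e) * u 1" if "n \<ge> 1" for n
    using u0 that by (intro multiplicative_gronwall) auto
  moreover have "mean n (\<lambda>x. wiener_mart x ^ ?M) \<le> u n" for n
    using C(1) by (simp add: u_def mean_def)
  ultimately show ?thesis
    by (intro exI[of _ "exp (suminf e) * u 1"]) (meson order_trans)
qed

text \<open>
  A telescoping upper bound for the variances of the increments.
\<close>

lemma inverse_power_three_halves_le:
  fixes l :: real
  assumes "l \<ge> 1"
  shows "l powr (- 3/2) \<le> 4 * (1 / sqrt l - 1 / sqrt (l + 1))"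
proof -
  define a b where "a = sqrt l" and "b = sqrt (l + 1)"
  have ab: "a \<ge> 1" "b > 0" "b ^ 2 = a ^ 2 + 1" "l = a ^ 2" "b \<ge> a"
    using assms by (auto simp: a_def b_def)
  have b2: "b \<le> 3/2 * a"
  proof (rule power2_le_imp_le)
    have "1 \<le> a ^ 2" using ab(1) by simp
    then show "b ^ 2 \<le> (3/2 * a) ^ 2" by (simp add: ab(3) power_mult_distrib power_divide)
  qed (use ab in auto)
  have "l powr (- 3/2) = 1 / a ^ 3"
  proof -
    have "l = a powr 2" using ab(1) by (simp add: ab(4))
    then have "l powr (- 3/2) = a powr (- 3)" by (simp add: powr_powr)
    then show ?thesis using ab(1) by (simp add: powr_minus inverse_eq_divide)
  qed
  also have "\<dots> \<le> 4 * (1 / (a * b * (a + b)))"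
  proof -
    have "a * b * (a + b) \<le> a * (3/2 * a) * (a + 3/2 * a)"
      using ab b2 by (intro mult_mono add_left_mono) auto
    also have "\<dots> \<le> 4 * a ^ 3" using ab(1) by (simp add: power3_eq_cube)
    finally have "1 / (4 * a ^ 3) \<le> 1 / (a * b * (a + b))"
      using ab by (intro divide_left_mono) auto
    then show ?thesis by simp
  qed
  also have "1 / (a * b * (a + b)) = 1 / a - 1 / b"
  proof -
    have "(b - a) * (a + b) = 1" using ab(3) by (simp add: algebra_simps power2_eq_square)
    then show ?thesis using ab by (simp add: divide_simps)
  qed
  finally show ?thesis by (simp add: a_def b_def)
qed

primrec stopped :: "nat \<Rightarrow> real \<Rightarrow> (nat \<Rightarrow> nat list set) \<Rightarrow> nat \<Rightarrow> real" where
  "stopped m e h 0 = 0"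
| "stopped m e h (Suc j) = (if \<bar>stopped m e h j\<bar> > e then stopped m e h j
     else wiener_mart (h (m + Suc j)) - wiener_mart (h m))"

lemma stopped_eq: "\<bar>stopped m e h j\<bar> \<le> e \<Longrightarrow> stopped m e h j = wiener_mart (h (m + j)) - wiener_mart (h m)"
  by (cases j) (auto split: if_splits)

text \<open>
  The martingale, started at time \<open>m\<close> and stopped when it leaves \<open>{-e..e}\<close>, remembers that it did.
\<close>

lemma stopped_exceeds:
  "e \<ge> 0 \<Longrightarrow> \<bar>wiener_mart (h (m + i)) - wiener_mart (h m)\<bar> > e \<Longrightarrow> i \<le> j \<Longrightarrow> \<bar>stopped m e h j\<bar> > e"
  by (induction j) (auto simp: le_Suc_eq)

lemma stopped_cong:
  "m \<ge> 1 \<Longrightarrow> (\<And>k. 1 \<le> k \<Longrightarrow> k \<le> m + j \<Longrightarrow> h k = h' k) \<Longrightarrow> stopped m e h j = stopped m e h' j"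
  by (induction j) auto

abbreviation W_stopped :: "nat \<Rightarrow> real \<Rightarrow> nat \<Rightarrow> 'w \<Rightarrow> real" where
  "W_stopped m e j \<omega> \<equiv> stopped m e (\<lambda>k. X k \<omega>) j"

lemma integrable_stopped: "m \<ge> 1 \<Longrightarrow> integrable M (\<lambda>\<omega>. f (W_stopped m e j \<omega>) :: real)"
  by (rule integrable_past[of "m + j" "\<lambda>h. f (stopped m e h j)"]) (metis stopped_cong)

lemma stopped_second_moment:
  "\<exists>C>0. \<forall>m\<ge>1. \<forall>e j. (\<integral>\<omega>. W_stopped m e j \<omega> ^ 2 \<partial>M) \<le> C / sqrt (real m)"
proof -
  obtain C where C: "C > 0" "\<And>n. n \<ge> 1 \<Longrightarrow>
      (\<integral>\<omega>. \<bar>W_mart (Suc n) \<omega> - W_mart n \<omega>\<bar> ^ 2 \<partial>M) \<le> C * real n powr (1/2) / real n ^ 2"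
    using increment_moments by blast
  have "(\<integral>\<omega>. W_stopped m e j \<omega> ^ 2 \<partial>M) \<le> 4 * C * (1 / sqrt (real m) - 1 / sqrt (real (m + j)))"
    if m: "m \<ge> 1" for m e j
  proof (induction j)
    case (Suc j)
    define n where "n = m + j"
    have n: "n \<ge> 1" using m by (simp add: n_def)
    let ?K = "W_stopped m e j" and ?D = "\<lambda>\<omega>. W_mart (Suc n) \<omega> - W_mart n \<omega>"
    let ?g = "\<lambda>h. 2 * stopped m e h j * of_bool (\<bar>stopped m e h j\<bar> \<le> e)"
    have past: "?g h = ?g h'" if "\<And>k. 1 \<le> k \<Longrightarrow> k \<le> n \<Longrightarrow> h k = h' k" for h h'
      using stopped_cong[OF m, of j h h'] that by (simp add: n_def)
    have int: "integrable M (\<lambda>\<omega>. ?g (\<lambda>k. X k \<omega>) * ?D \<omega>)"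
    proof (rule integrable_past[of "Suc n" "\<lambda>h. ?g h * (wiener_mart (h (Suc n)) - wiener_mart (h n))"])
      fix h h' :: "nat \<Rightarrow> nat list set"
      assume eq: "\<And>k. 1 \<le> k \<Longrightarrow> k \<le> Suc n \<Longrightarrow> h k = h' k"
      have "?g h = ?g h'" by (rule past) (rule eq, auto)
      moreover have "h n = h' n" "h (Suc n) = h' (Suc n)" using eq n by auto
      ultimately show "?g h * (wiener_mart (h (Suc n)) - wiener_mart (h n)) =
          ?g h' * (wiener_mart (h' (Suc n)) - wiener_mart (h' n))" by (simp only:)
    qed
    have int': "integrable M (\<lambda>\<omega>. \<bar>?D \<omega>\<bar> ^ 2)"
      by (rule integrable_X2[OF n, of "Suc n" "\<lambda>x y. \<bar>wiener_mart y - wiener_mart x\<bar> ^ 2"]) simp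
    have "W_stopped m e (Suc j) \<omega> = ?K \<omega> + of_bool (\<bar>?K \<omega>\<bar> \<le> e) * ?D \<omega>" for \<omega>
    proof (cases "\<bar>?K \<omega>\<bar> \<le> e")
      case True
      with stopped_eq[OF this] show ?thesis by (simp add: n_def)
    qed simp
    moreover have "(k + of_bool P * d) ^ 2 \<le> k ^ 2 + 2 * k * of_bool P * d + \<bar>d\<bar> ^ 2" for k d :: real and P
      by (cases P) (simp_all add: power2_sum)
    ultimately have "W_stopped m e (Suc j) \<omega> ^ 2 \<le> ?K \<omega> ^ 2 + ?g (\<lambda>k. X k \<omega>) * ?D \<omega> + \<bar>?D \<omega>\<bar> ^ 2" for \<omega>
      by (simp only:)
    then have "(\<integral>\<omega>. W_stopped m e (Suc j) \<omega> ^ 2 \<partial>M) \<le>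
        (\<integral>\<omega>. ?K \<omega> ^ 2 + ?g (\<lambda>k. X k \<omega>) * ?D \<omega> + \<bar>?D \<omega>\<bar> ^ 2 \<partial>M)"
      using integrable_stopped[OF m, of "\<lambda>z. z ^ 2"] integrable_stopped[OF m, of "\<lambda>z. z ^ 2" e "Suc j"] int int'
      by (intro integral_mono Bochner_Integration.integrable_add)
    also have "\<dots> = (\<integral>\<omega>. ?K \<omega> ^ 2 \<partial>M) + (\<integral>\<omega>. ?g (\<lambda>k. X k \<omega>) * ?D \<omega> \<partial>M) + (\<integral>\<omega>. \<bar>?D \<omega>\<bar> ^ 2 \<partial>M)"
      using integrable_stopped[OF m, of "\<lambda>z. z ^ 2"] int int' by (simp only: Bochner_Integration.integral_add Bochner_Integration.integrable_add)
    also have "(\<integral>\<omega>. ?g (\<lambda>k. X k \<omega>) * ?D \<omega> \<partial>M) = 0"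
      by (rule W_mart_orthogonal[OF n past])
    also have "(\<integral>\<omega>. \<bar>?D \<omega>\<bar> ^ 2 \<partial>M) \<le> C * real n powr (- 3/2)"
    proof -
      have "real n powr (- 3/2) = real n powr (1/2 - 2)" by simp
      also have "\<dots> = real n powr (1/2) / real n ^ 2"
        using n by (simp only: powr_diff) simp
      finally show ?thesis using C(2)[OF n] by simp
    qed
    also have "\<dots> \<le> C * (4 * (1 / sqrt (real n) - 1 / sqrt (real n + 1)))"
      using C(1) n by (intro mult_left_mono inverse_power_three_halves_le) auto
    finally show ?case using Suc.IH by (simp add: n_def algebra_simps)
  qed simp
  moreover have "4 * C * (1 / sqrt (real m) - 1 / sqrt (real n)) \<le> 4 * C / sqrt (real m)" for m n
    using C(1) by (simp add: field_simps)
  ultimately show ?thesis using C(1)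
    by (intro exI[of _ "4 * C"]) (meson order_trans mult_pos_pos zero_less_numeral)
qed

text \<open>
  Kolmogorov's inequality: the second moment of the stopped martingale is at most the sum of the
  variances of the increments, which from time \<open>m\<close> on is of order \<open>m\<close> to the power \<open>-1/2\<close>.
\<close>

lemma W_mart_maximal_inequality:
  "\<exists>C>0. \<forall>m\<ge>1. \<forall>e>0. \<P>(\<omega> in M. \<exists>i. \<bar>W_mart (m + i) \<omega> - W_mart m \<omega>\<bar> > e) \<le> C / sqrt (real m) / e ^ 2"
proof -
  obtain C where C: "C > 0" "\<And>m e j. m \<ge> 1 \<Longrightarrow> (\<integral>\<omega>. W_stopped m e j \<omega> ^ 2 \<partial>M) \<le> C / sqrt (real m)"
    using stopped_second_moment by blast
  have "\<P>(\<omega> in M. \<exists>i. \<bar>W_mart (m + i) \<omega> - W_mart m \<omega>\<bar> > e) \<le> C / sqrt (real m) / e ^ 2"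
    if m: "m \<ge> 1" and e: "e > 0" for m e
  proof -
    define A where "A j = {\<omega> \<in> space M. \<exists>i\<le>j. \<bar>W_mart (m + i) \<omega> - W_mart m \<omega>\<bar> > e}" for j
    have [measurable]: "(\<lambda>\<omega>. W_mart (m + i) \<omega>) \<in> borel_measurable M" "W_mart m \<in> borel_measurable M" for i
      using m by (auto intro!: measurable_X[of _ wiener_mart])
    have A: "A j \<in> sets M" for j unfolding A_def by measurable
    have "prob (A j) \<le> C / sqrt (real m) / e ^ 2" for j
    proof -
      let ?B = "{\<omega> \<in> space M. W_stopped m e j \<omega> ^ 2 \<ge> e ^ 2}"
      have int: "integrable M (\<lambda>\<omega>. W_stopped m e j \<omega> ^ 2)"
        by (rule integrable_stopped[OF m, of "\<lambda>z. z ^ 2"])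
      have "A j \<subseteq> ?B"
      proof
        fix \<omega> assume "\<omega> \<in> A j"
        then obtain i where i: "\<omega> \<in> space M" "i \<le> j" "\<bar>W_mart (m + i) \<omega> - W_mart m \<omega>\<bar> > e"
          by (auto simp: A_def)
        have "e < \<bar>W_stopped m e j \<omega>\<bar>" by (rule stopped_exceeds[OF _ i(3,2)]) (use e in simp)
        then have "e ^ 2 \<le> \<bar>W_stopped m e j \<omega>\<bar> ^ 2" using e by (intro power_mono) auto
        then show "\<omega> \<in> ?B" using i(1) by simp
      qed
      then have "prob (A j) \<le> prob ?B"
        using borel_measurable_integrable[OF int] by (intro finite_measure_mono) simp_all
      also have "\<dots> \<le> (\<integral>\<omega>. W_stopped m e j \<omega> ^ 2 \<partial>M) / e ^ 2"
        using int e by (intro integral_Markov_inequality_measure[of _ _ "space M"]) auto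
      finally show ?thesis using C(2)[OF m, of e j] e by (meson divide_right_mono order_trans zero_le_power2)
    qed
    moreover have "(\<lambda>j. prob (A j)) \<longlonglongrightarrow> prob (\<Union>j. A j)"
      using A by (intro finite_Lim_measure_incseq) (auto simp: incseq_def A_def intro: order_trans)
    ultimately have "prob (\<Union>j. A j) \<le> C / sqrt (real m) / e ^ 2"
      by (intro LIMSEQ_le_const2) auto
    also have "(\<Union>j. A j) = {\<omega> \<in> space M. \<exists>i. \<bar>W_mart (m + i) \<omega> - W_mart m \<omega>\<bar> > e}"
      by (auto simp: A_def)
    finally show ?thesis .
  qed
  then show ?thesis using C(1) by blast
qed

lemma AE_W_mart_convergent: "AE \<omega> in M. convergent (\<lambda>n. W_mart n \<omega>)"
proof -
  obtain C where C: "\<And>m e. m \<ge> 1 \<Longrightarrow> e > 0 \<Longrightarrow>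
      \<P>(\<omega> in M. \<exists>i. \<bar>W_mart (m + i) \<omega> - W_mart m \<omega>\<bar> > e) \<le> C / sqrt (real m) / e ^ 2"
    using W_mart_maximal_inequality by blast
  have "AE \<omega> in M. \<exists>m. \<forall>i. \<bar>W_mart (Suc m + i) \<omega> - W_mart (Suc m) \<omega>\<bar> \<le> e" if e: "e > 0" for e
  proof -
    let ?A = "\<lambda>m. {\<omega> \<in> space M. \<exists>i. \<bar>W_mart (Suc m + i) \<omega> - W_mart (Suc m) \<omega>\<bar> > e}"
    have [measurable]: "W_mart (Suc m) \<in> borel_measurable M" for m by (rule measurable_X) simp
    have A: "?A m \<in> sets M" for m by simp
    have "prob (\<Inter>m. ?A m) \<le> C / sqrt (real (Suc m)) / e ^ 2" for m
      using A by (intro order_trans[OF finite_measure_mono C[of "Suc m" e]] e) auto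
    moreover have "(\<lambda>m. C / sqrt (real (Suc m)) / e ^ 2) \<longlonglongrightarrow> 0"
    proof -
      have "(\<lambda>m. 1 / sqrt (real (Suc m))) \<longlonglongrightarrow> 0" by real_asymp
      from tendsto_mult_left[OF this, of "C / e ^ 2"] show ?thesis by (simp add: mult.commute)
    qed
    ultimately have "prob (\<Inter>m. ?A m) \<le> 0" by (intro LIMSEQ_le_const) auto
    then have "AE \<omega> in M. \<omega> \<notin> (\<Inter>m. ?A m)"
      using A by (subst prob_eq_0[symmetric]) (auto simp: measure_le_0_iff)
    with AE_space show ?thesis by eventually_elim (auto simp: not_less)
  qed
  then have "AE \<omega> in M. \<forall>r. \<exists>m. \<forall>i. \<bar>W_mart (Suc m + i) \<omega> - W_mart (Suc m) \<omega>\<bar> \<le> 1 / real (Suc r)"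
    by (simp add: AE_all_countable)
  then show ?thesis
  proof eventually_elim
    case (elim \<omega>)
    have "Cauchy (\<lambda>n. W_mart n \<omega>)"
    proof (rule CauchyI)
      fix e :: real assume "e > 0"
      then obtain r where r: "1 / real (Suc r) < e / 2" using nat_approx_posE half_gt_zero by blast
      obtain m where m: "\<And>i. \<bar>W_mart (Suc m + i) \<omega> - W_mart (Suc m) \<omega>\<bar> \<le> 1 / real (Suc r)"
        using elim by blast
      have "norm (W_mart i \<omega> - W_mart j \<omega>) < e" if "i \<ge> Suc m" "j \<ge> Suc m" for i j
        using m[of "i - Suc m"] m[of "j - Suc m"] that r unfolding real_norm_def by simp
      then show "\<exists>N. \<forall>i\<ge>N. \<forall>j\<ge>N. norm (W_mart i \<omega> - W_mart j \<omega>) < e" by blast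
    qed
    then show ?case by (rule Cauchy_convergent)
  qed
qed

end

section \<open>Almost sure convergence of the rescaled Wiener index\<close>

lemma harm_le_ln: "n \<ge> 1 \<Longrightarrow> harm n \<le> 1 + ln (real n)"
proof (induction n rule: nat_induct_at_least)
  case base
  show ?case by (simp add: harm_expand)
next
  case (Suc n)
  then show ?case using decseqD[OF decseq_harm_diff_ln, of 0 n]
    by (simp add: harm_expand)
qed

lemma le_mean_square:
  fixes d s :: real
  assumes "s > 0"
  shows "d \<le> (s + d ^ 2 / s) / 2"
proof -
  have "0 \<le> (d - s) ^ 2 / s" using assms by simp
  also have "\<dots> = s + d ^ 2 / s - 2 * d"
    using assms by (simp add: field_simps power2_eq_square)
  finally show ?thesis by simp
qed

context harris_process
begin

lemma rescaled_wiener_eq: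
  assumes "n \<ge> 1" "\<omega> \<in> space M"
  shows "rescaled_wiener X n \<omega> = (1 + 1 / real n) * W_mart n \<omega> + harm n / real n - 2"
proof -
  have "w / real n ^ 2 - h =
    (1 + 1 / real n) * (w / (real n * (real n + 1)) - (h - 2 + 2 / (real n + 1))) + h / real n - 2" for w h
    using assms(1) by (simp add: divide_simps power2_eq_square) algebra
  then show ?thesis
    by (simp add: rescaled_wiener_def wiener_mart_def X_card[OF assms])
qed

lemma harm_over_n: "(\<lambda>n. harm n / real n) \<longlonglongrightarrow> 0"
proof (rule tendsto_sandwich[of "\<lambda>_. 0" _ _ "\<lambda>n. (1 + ln (real n)) / real n"])
  show "\<forall>\<^sub>F n in sequentially. (0::real) \<le> harm n / real n"
    by (intro always_eventually allI divide_nonneg_nonneg harm_nonneg) auto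
  show "\<forall>\<^sub>F n in sequentially. harm n / real n \<le> (1 + ln (real n)) / real n"
    using eventually_ge_at_top[of 1] by eventually_elim (intro divide_right_mono harm_le_ln, auto)
  show "(\<lambda>n. (1 + ln (real n)) / real n) \<longlonglongrightarrow> 0" by real_asymp
qed simp

lemma AE_convergent_rescaled_wiener: "AE \<omega> in M. convergent (\<lambda>n. rescaled_wiener X n \<omega>)"
  using AE_W_mart_convergent AE_space
proof eventually_elim
  case (elim \<omega>)
  obtain L where L: "(\<lambda>n. W_mart n \<omega>) \<longlonglongrightarrow> L" using elim(1) by (auto simp: convergent_def)
  have "(\<lambda>n. (1 + 1 / real n) * W_mart n \<omega> + harm n / real n - 2) \<longlonglongrightarrow> (1 + 0) * L + 0 - 2"
    by (intro tendsto_intros L harm_over_n lim_1_over_n)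
  then have "(\<lambda>n. rescaled_wiener X n \<omega>) \<longlonglongrightarrow> (1 + 0) * L + 0 - 2"
  proof (rule Lim_transform_eventually)
    show "\<forall>\<^sub>F n in sequentially. (1 + 1 / real n) * W_mart n \<omega> + harm n / real n - 2 = rescaled_wiener X n \<omega>"
      using eventually_ge_at_top[of 1] by eventually_elim (simp add: rescaled_wiener_eq elim(2))
  qed
  then show ?case by (auto simp: convergent_def)
qed

lemma rescaled_wiener_0: "rescaled_wiener X 0 = (\<lambda>_. 0)"
  by (simp add: rescaled_wiener_def harm_expand fun_eq_iff)

lemma measurable_rescaled_wiener: "rescaled_wiener X n \<in> borel_measurable M"
proof (cases "n \<ge> 1")
  case True
  then show ?thesis unfolding rescaled_wiener_def[abs_def]
    by (rule measurable_X[of n "\<lambda>x. 1 / (real n)\<^sup>2 * wiener_index x - harm n"])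
next
  case False
  then have "n = 0" by simp
  then show ?thesis by (simp add: rescaled_wiener_0)
qed

lemma integrable_rescaled_wiener: "integrable M (\<lambda>\<omega>. f (rescaled_wiener X n \<omega>) :: real)"
proof (cases "n \<ge> 1")
  case True
  then show ?thesis unfolding rescaled_wiener_def
    by (rule integrable_X[of n "\<lambda>x. f (1 / (real n)\<^sup>2 * wiener_index x - harm n)"])
next
  case False
  then have "n = 0" by simp
  then show ?thesis by (simp add: rescaled_wiener_0)
qed

lemma rescaled_wiener_moments:
  assumes m: "m \<ge> 1"
  shows "\<exists>C. \<forall>n. (\<integral>\<omega>. rescaled_wiener X n \<omega> ^ (2 * m) \<partial>M) \<le> C"
proof -
  obtain C where C: "\<And>n. n \<ge> 1 \<Longrightarrow> mean n (\<lambda>x. wiener_mart x ^ (2 * m)) \<le> C"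
    using W_mart_even_moments[OF m] by blast
  let ?K = "2 ^ (2 * m) * (2 ^ (2 * m) * C + 2 ^ (2 * m)) :: real"
  have "(\<integral>\<omega>. rescaled_wiener X n \<omega> ^ (2 * m) \<partial>M) \<le> max 0 ?K" for n
  proof (cases "n \<ge> 1")
    case False
    then have "n = 0" by simp
    then show ?thesis using m by (simp add: rescaled_wiener_0 power_0_left)
  next
    case n: True
    have h: "\<bar>harm n / real n - 2\<bar> \<le> (2::real)"
    proof -
      have "harm n \<le> real n"
      proof -
        have "harm n \<le> (\<Sum>k=1..n. 1::real)"
          unfolding harm_def by (intro sum_mono) (auto simp: divide_simps)
        then show ?thesis by simp
      qed
      moreover have "0 \<le> harm n / real n" by (simp add: harm_nonneg)
      ultimately show ?thesis using n by (simp add: field_simps abs_le_iff)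
    qed
    have "(\<integral>\<omega>. rescaled_wiener X n \<omega> ^ (2 * m) \<partial>M) \<le>
        mean n (\<lambda>x. 2 ^ (2 * m) * (2 ^ (2 * m) * wiener_mart x ^ (2 * m) + 2 ^ (2 * m)))"
      unfolding mean_def
    proof (rule integral_mono[OF integrable_rescaled_wiener integrable_X[OF n]])
      fix \<omega> assume \<omega>: "\<omega> \<in> space M"
      let ?a = "(1 + 1 / real n) * W_mart n \<omega>"
      have "rescaled_wiener X n \<omega> ^ (2 * m) = \<bar>?a + (harm n / real n - 2)\<bar> ^ (2 * m)"
        by (simp add: rescaled_wiener_eq[OF n \<omega>] power_even_abs add_diff_eq)
      also have "\<dots> \<le> 2 ^ (2 * m) * (\<bar>?a\<bar> ^ (2 * m) + \<bar>harm n / real n - 2\<bar> ^ (2 * m))"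
        by (rule power_sum_bound)
      also have "\<dots> \<le> 2 ^ (2 * m) * ((2 * \<bar>W_mart n \<omega>\<bar>) ^ (2 * m) + 2 ^ (2 * m))"
        using n h by (intro mult_left_mono add_mono power_mono)
          (auto simp: abs_mult intro!: mult_right_mono)
      finally show "rescaled_wiener X n \<omega> ^ (2 * m) \<le>
          2 ^ (2 * m) * (2 ^ (2 * m) * W_mart n \<omega> ^ (2 * m) + 2 ^ (2 * m))"
        by (simp add: power_mult_distrib power_even_abs)
    qed
    also have "\<dots> = 2 ^ (2 * m) * (2 ^ (2 * m) * mean n (\<lambda>x. wiener_mart x ^ (2 * m)) + 2 ^ (2 * m))"
      using n by (simp only: mean_cmult mean_add mean_const)
    also have "\<dots> \<le> ?K"
      by (intro mult_left_mono add_right_mono C n) auto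
    finally show ?thesis by simp
  qed
  then show ?thesis by blast
qed

end

section \<open>Limits of moment bounds\<close>

text \<open>
  Fatou's lemma in the form in which estimates for trees with \<open>n\<close> nodes are passed on to the limit.
\<close>

lemma nn_integral_limit_le:
  fixes f :: "nat \<Rightarrow> 'a \<Rightarrow> real"
  assumes meas: "\<And>n. f n \<in> borel_measurable M"
    and lim: "AE x in M. (\<lambda>n. f n x) \<longlonglongrightarrow> g x"
    and le: "\<forall>\<^sub>F n in sequentially. (\<integral>\<^sup>+x. ennreal (f n x) \<partial>M) \<le> ennreal (c n)"
    and c: "c \<longlonglongrightarrow> c0"
  shows "(\<integral>\<^sup>+x. ennreal (g x) \<partial>M) \<le> ennreal c0"
proof -
  have "(\<integral>\<^sup>+x. ennreal (g x) \<partial>M) = (\<integral>\<^sup>+x. liminf (\<lambda>n. ennreal (f n x)) \<partial>M)"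
  proof (rule nn_integral_cong_AE)
    show "AE x in M. ennreal (g x) = liminf (\<lambda>n. ennreal (f n x))"
      using lim by eventually_elim
        (rule lim_imp_Liminf[symmetric], auto intro: tendsto_ennrealI)
  qed
  also have "\<dots> \<le> liminf (\<lambda>n. (\<integral>\<^sup>+x. ennreal (f n x) \<partial>M))"
    using meas by (intro nn_integral_liminf) measurable
  also have "\<dots> \<le> liminf (\<lambda>n. ennreal (c n))"
    using le by (intro Liminf_mono)
  also have "\<dots> = ennreal c0"
    using c by (intro lim_imp_Liminf tendsto_ennrealI) auto
  finally show ?thesis .
qed

lemma integral_limit_le:
  fixes f :: "nat \<Rightarrow> 'a \<Rightarrow> real"
  assumes "\<And>n. integrable M (f n)" "\<And>n x. 0 \<le> f n x" "AE x in M. (\<lambda>n. f n x) \<longlonglongrightarrow> g x"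
    and "\<And>n. (\<integral>x. f n x \<partial>M) \<le> c n" "c \<longlonglongrightarrow> c0"
  shows "(\<integral>\<^sup>+x. ennreal (g x) \<partial>M) \<le> ennreal c0"
  using assms by (intro nn_integral_limit_le[of f])
    (auto simp: nn_integral_eq_integral intro!: always_eventually ennreal_leI)

lemma powr_truncation:
  fixes d p R :: real
  assumes "0 \<le> d" "0 < p" "1 \<le> R" "p + 1 \<le> 2 * real m"
  shows "d powr p \<le> min d R powr p + d ^ (2 * m) / R"
proof (cases "d \<le> R")
  case True
  then show ?thesis using assms by (simp add: min_def)
next
  case False
  then have d: "d > 1" "R \<le> d" using assms by auto
  have "d powr p \<le> d powr (2 * real m - 1)" using assms d by (intro powr_mono) auto
  also have "\<dots> = d ^ (2 * m) / d" using d by (simp add: powr_diff powr_realpow[symmetric])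
  also have "\<dots> \<le> d ^ (2 * m) / R" using d assms by (intro divide_left_mono) auto
  finally show ?thesis by (simp add: add_increasing)
qed

text \<open>
  Truncation at the level \<open>R\<close>: dominated convergence deals with the truncated differences, and
  the excess is at most a higher moment divided by \<open>R\<close>.
\<close>

lemma (in prob_space) tendsto_Lp_of_bounded_moments:
  fixes f :: "nat \<Rightarrow> 'a \<Rightarrow> real"
  assumes f: "\<And>n. f n \<in> borel_measurable M" and g: "g \<in> borel_measurable M"
    and lim: "AE x in M. (\<lambda>n. f n x) \<longlonglongrightarrow> g x"
    and int: "\<And>n m. integrable M (\<lambda>x. f n x ^ (2 * m))"
    and bound: "\<And>m. m \<ge> 1 \<Longrightarrow> \<exists>C. \<forall>n. (\<integral>x. f n x ^ (2 * m) \<partial>M) \<le> C"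
    and p: "p > 0"
  shows "tendsto_Lp M p f g"
proof -
  note [measurable] = f g
  obtain k where k: "p \<le> real k" using real_arch_simple by blast
  define m where "m = k + 1"
  have m: "m \<ge> 1" "p + 1 \<le> 2 * real m" using p k unfolding m_def by auto
  let ?M = "2 * m"
  obtain C where C: "\<And>n. (\<integral>x. f n x ^ ?M \<partial>M) \<le> C" using bound[OF m(1)] by blast
  have "(\<integral>\<^sup>+x. ennreal (g x ^ ?M) \<partial>M) \<le> ennreal C"
    using lim by (intro integral_limit_le[where f = "\<lambda>n x. f n x ^ ?M" and c = "\<lambda>_. C"] int)
      (auto simp: C elim!: eventually_mono intro: tendsto_power)
  then have "(\<integral>\<^sup>+x. ennreal (g x ^ ?M) \<partial>M) < \<infinity>" by (rule le_less_trans) simp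
  then have intg: "integrable M (\<lambda>x. g x ^ ?M)"
    by (intro integrableI_nonneg) auto
  have small: "integrable M (\<lambda>x. \<bar>h x\<bar> powr p)"
    if [measurable]: "h \<in> borel_measurable M" and h: "integrable M (\<lambda>x. h x ^ ?M)" for h :: "'a \<Rightarrow> real"
  proof (rule Bochner_Integration.integrable_bound)
    show "integrable M (\<lambda>x. 1 + h x ^ ?M)" using h by simp
    show "AE x in M. norm (\<bar>h x\<bar> powr p) \<le> norm (1 + h x ^ ?M)"
    proof (rule AE_I2)
      fix x
      have "\<bar>h x\<bar> powr p \<le> min \<bar>h x\<bar> 1 powr p + \<bar>h x\<bar> ^ ?M / 1"
        using p m by (intro powr_truncation) auto
      also have "min \<bar>h x\<bar> 1 powr p \<le> 1 powr p" using p by (intro powr_mono2) auto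
      finally show "norm (\<bar>h x\<bar> powr p) \<le> norm (1 + h x ^ ?M)"
        by (simp add: power_even_abs)
    qed
  qed measurable
  let ?d = "\<lambda>n x. \<bar>f n x - g x\<bar>"
  let ?K = "2 ^ ?M * (C + (\<integral>x. g x ^ ?M \<partial>M))"
  have d_le: "?d n x ^ ?M \<le> 2 ^ ?M * (f n x ^ ?M + g x ^ ?M)" for n x
    using power_sum_bound[of "f n x" "- g x" ?M] by (simp add: power_even_abs)
  have int_d: "integrable M (\<lambda>x. ?d n x ^ ?M)" for n
  proof (rule Bochner_Integration.integrable_bound)
    show "integrable M (\<lambda>x. 2 ^ ?M * (f n x ^ ?M + g x ^ ?M))" using int intg by simp
    show "AE x in M. norm (?d n x ^ ?M) \<le> norm (2 ^ ?M * (f n x ^ ?M + g x ^ ?M))"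
      using d_le by (intro AE_I2) (simp add: abs_of_nonneg)
  qed measurable
  have K: "(\<integral>x. ?d n x ^ ?M \<partial>M) \<le> ?K" for n
  proof -
    have "(\<integral>x. ?d n x ^ ?M \<partial>M) \<le> (\<integral>x. 2 ^ ?M * (f n x ^ ?M + g x ^ ?M) \<partial>M)"
      using int_d int intg d_le by (intro integral_mono) auto
    also have "\<dots> = 2 ^ ?M * ((\<integral>x. f n x ^ ?M \<partial>M) + (\<integral>x. g x ^ ?M \<partial>M))"
      using int intg by simp
    also have "\<dots> \<le> ?K" using C[of n] by simp
    finally show ?thesis .
  qed
  have K0: "?K \<ge> 0" using K[of 0] by (rule order_trans[rotated]) simp
  have conv: "(\<lambda>n. \<integral>x. ?d n x powr p \<partial>M) \<longlonglongrightarrow> 0"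
  proof (rule LIMSEQ_I)
    fix e :: real assume e: "e > 0"
    define R where "R = 2 * ?K / e + 1"
    have R: "R \<ge> 1" using K0 e by (simp add: R_def)
    have "(\<lambda>n. \<integral>x. min (?d n x) R powr p \<partial>M) \<longlonglongrightarrow> (\<integral>x. 0 \<partial>M)"
    proof (rule integral_dominated_convergence[where w = "\<lambda>_. R powr p"])
      show "AE x in M. (\<lambda>n. min (?d n x) R powr p) \<longlonglongrightarrow> 0"
        using lim
      proof eventually_elim
        case (elim x)
        then have "(\<lambda>n. \<bar>f n x - g x\<bar>) \<longlonglongrightarrow> 0"
          by (simp add: LIM_zero_iff tendsto_rabs_zero_iff)
        then have "(\<lambda>n. min (?d n x) R) \<longlonglongrightarrow> min 0 R"
          by (intro tendsto_min tendsto_const)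
        then have *: "(\<lambda>n. min (?d n x) R) \<longlonglongrightarrow> 0" using R by simp
        have "(\<lambda>n. min (?d n x) R powr p) \<longlonglongrightarrow> 0 powr p"
          using * R p by (intro tendsto_powr'[OF * tendsto_const]) (auto intro!: always_eventually)
        then show ?case by simp
      qed
      show "AE x in M. norm (min (?d n x) R powr p) \<le> R powr p" for n
        using R p by (intro AE_I2) (auto intro!: powr_mono2)
    qed auto
    then have "\<forall>\<^sub>F n in sequentially. (\<integral>x. min (?d n x) R powr p \<partial>M) < e / 2"
      using e by (intro order_tendstoD(2)) auto
    then obtain N where N: "\<And>n. n \<ge> N \<Longrightarrow> (\<integral>x. min (?d n x) R powr p \<partial>M) < e / 2"
      by (auto simp: eventually_sequentially)
    have "norm ((\<integral>x. ?d n x powr p \<partial>M) - 0) < e" if n: "n \<ge> N" for n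
    proof -
      have i1: "integrable M (\<lambda>x. min (?d n x) R powr p)"
        using R p by (intro integrable_const_bound[where B = "R powr p"] AE_I2)
          (auto intro!: powr_mono2)
      have "(\<integral>x. ?d n x powr p \<partial>M) \<le> (\<integral>x. min (?d n x) R powr p + ?d n x ^ ?M / R \<partial>M)"
        using small[of "\<lambda>x. f n x - g x"] int_d[of n] i1 p m R
        by (intro integral_mono powr_truncation) (auto simp: power_even_abs)
      also have "\<dots> = (\<integral>x. min (?d n x) R powr p \<partial>M) + (\<integral>x. ?d n x ^ ?M \<partial>M) / R"
        using int_d[of n] i1 by simp
      also have "(\<integral>x. ?d n x ^ ?M \<partial>M) / R \<le> ?K / R"
        using K[of n] R by (intro divide_right_mono) auto
      also have "?K / R \<le> e / 2"
        using R e K0 by (simp add: R_def field_simps)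
      also note N[OF n]
      finally have "(\<integral>x. ?d n x powr p \<partial>M) < e" by simp
      moreover have "0 \<le> (\<integral>x. ?d n x powr p \<partial>M)" by simp
      ultimately show ?thesis by simp
    qed
    then show "\<exists>no. \<forall>n\<ge>no. norm ((\<integral>x. ?d n x powr p \<partial>M) - 0) < e" by blast
  qed
  show ?thesis
    unfolding tendsto_Lp_def using f g small[OF g intg] small[OF f int] conv by blast
qed

section \<open>Geometric decay of the subtree sizes\<close>

text \<open>
  The set of \<open>w\<close>, its later siblings and their descendants, together with the parent of \<open>w\<close>.  Once
  \<open>w\<close> is present, the new node falls into this set exactly if its parent does; the parent of \<open>w\<close>
  has to be included because its further children are later siblings of \<open>w\<close>.  Hence the number \<open>M\<close>
  of nodes in the set increases with probability \<open>M/n\<close>, as in a Polya urn.  The length of the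
  path to \<open>w\<close> in the binary tree formed by first children and next siblings is \<open>|w|\<^sub>1\<close>.
\<close>

definition branch :: "nat list \<Rightarrow> nat list set" where
  "branch w = {y. y = butlast w \<or> (\<exists>i\<ge>last w. prefix (butlast w @ [i]) y)}"

definition branch_size :: "nat list set \<Rightarrow> nat list \<Rightarrow> real" where
  "branch_size x w = real (card (x \<inter> branch w))"

lemma new_node_in_branch:
  assumes x: "harris_tree x" and u: "u \<in> x" and w: "w \<in> x" "w \<noteq> []"
  shows "new_node x u \<in> branch w \<longleftrightarrow> u \<in> branch w"
proof -
  obtain p j where w_eq: "w = p @ [j]" using w(2) by (metis rev_exhaust)
  have p: "p \<in> x" using harris_prefix[OF x _ w(1), of p] by (simp add: w_eq)
  have "new_node x u \<noteq> p" using p new_node_notin[OF x] by auto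
  moreover have "j \<le> deg x p" using w(1) by (simp add: w_eq child_iff[OF x])
  ultimately show ?thesis
    by (auto simp: branch_def w_eq new_node_def intro: exI[of _ "Suc (deg x p)"])
qed

lemma branch_size_grow:
  assumes x: "harris_tree x" and u: "u \<in> x" and w: "w \<in> x" "w \<noteq> []"
  shows "branch_size (grow x u) w = branch_size x w + of_bool (u \<in> branch w)"
proof -
  have "grow x u \<inter> branch w =
      (if u \<in> branch w then insert (new_node x u) (x \<inter> branch w) else x \<inter> branch w)"
    using new_node_in_branch[OF assms] by (auto simp: grow_def)
  then show ?thesis
    using new_node_notin[OF x, of u] harris_finite[OF x] by (simp add: branch_size_def)
qed

lemma branch_size_new_node:
  assumes x: "harris_tree x" and u: "u \<in> x"
  shows "branch_size (grow x u) (new_node x u) = 2"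
proof -
  have "y = u" if y: "y \<in> x" "y \<in> branch (new_node x u)" for y
  proof (rule ccontr)
    assume "y \<noteq> u"
    then obtain i where i: "i \<ge> Suc (deg x u)" "prefix (u @ [i]) y"
      using y by (auto simp: branch_def new_node_def)
    then have "u @ [i] \<in> x" using harris_prefix[OF x] y by blast
    then show False using i by (simp add: child_iff[OF x])
  qed
  then have "grow x u \<inter> branch (new_node x u) = {u, new_node x u}"
    using u by (auto simp: grow_def branch_def new_node_def)
  moreover have "u \<noteq> new_node x u" by (simp add: new_node_def)
  ultimately show ?thesis by (simp add: branch_size_def)
qed

text \<open>
  When \<open>w\<close> appears, its branch has two nodes and contributes \<open>6\<close> times its weight.  The possible
  places for this are the next children of the present nodes, whose weights \<open>fringe\<close> sums up to a
  factor \<open>5/4\<close>.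
\<close>

definition spread :: "nat list set \<Rightarrow> real" where
  "spread x = (\<Sum>w\<in>x - {[]}. (5/4) ^ sum_list w * (branch_size x w * (branch_size x w + 1)))"

definition fringe :: "nat list set \<Rightarrow> real" where
  "fringe x = (\<Sum>v\<in>x. (5/4) ^ (sum_list v + deg x v))"

lemma spread_grow:
  assumes x: "harris_tree x" and u: "u \<in> x"
  shows "spread (grow x u) = spread x +
    (\<Sum>w\<in>x - {[]}. of_bool (u \<in> branch w) * ((5/4) ^ sum_list w * (2 * (branch_size x w + 1)))) +
    15/2 * (5/4) ^ (sum_list u + deg x u)"
proof -
  let ?z = "new_node x u"
  let ?f = "\<lambda>w. (5/4) ^ sum_list w * (branch_size (grow x u) w * (branch_size (grow x u) w + 1))"
  have "grow x u - {[]} = insert ?z (x - {[]})"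
    by (auto simp: grow_def new_node_def)
  then have "spread (grow x u) = ?f ?z + (\<Sum>w\<in>x - {[]}. ?f w)"
    unfolding spread_def using new_node_notin[OF x, of u] harris_finite[OF x] by simp
  also have "(\<Sum>w\<in>x - {[]}. ?f w) = spread x +
      (\<Sum>w\<in>x - {[]}. of_bool (u \<in> branch w) * ((5/4) ^ sum_list w * (2 * (branch_size x w + 1))))"
    unfolding spread_def sum.distrib[symmetric]
    by (intro sum.cong refl) (auto simp: branch_size_grow[OF x u] algebra_simps)
  also have "?f ?z = 15/2 * (5/4) ^ (sum_list u + deg x u)"
    unfolding branch_size_new_node[OF x u] by (simp add: new_node_def power_add)
  finally show ?thesis by simp
qed

lemma fringe_grow:
  assumes x: "harris_tree x" and u: "u \<in> x"
  shows "fringe (grow x u) = fringe x + 3/2 * (5/4) ^ (sum_list u + deg x u)"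
proof -
  let ?z = "new_node x u"
  have "(\<Sum>v\<in>x. (5/4 :: real) ^ (sum_list v + deg (grow x u) v)) =
      (\<Sum>v\<in>x. (5/4) ^ (sum_list v + deg x v) +
        (if v = u then 1/4 * (5/4) ^ (sum_list u + deg x u) else 0))"
    using new_node_notin[OF x, of u] deg_grow[OF x u]
    by (intro sum.cong refl) (auto simp: grow_def)
  also have "\<dots> = fringe x + 1/4 * (5/4) ^ (sum_list u + deg x u)"
    using u harris_finite[OF x] by (simp add: sum.distrib fringe_def)
  finally have "(\<Sum>v\<in>x. (5/4 :: real) ^ (sum_list v + deg (grow x u) v)) = \<dots>" .
  moreover have "deg (grow x u) ?z = 0"
    using deg_grow[OF x u, of ?z] by (simp add: grow_def)
  moreover have "(5/4 :: real) ^ sum_list ?z = 5/4 * (5/4) ^ (sum_list u + deg x u)"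
    by (simp add: new_node_def power_add)
  ultimately show ?thesis
    by (simp add: fringe_def[of "grow x u"] sum_grow[OF x])
qed

text \<open>
  The coefficient of \<open>fringe\<close> that closes the recursion is \<open>15\<close> because \<open>15/2 + 15 \<cdot> 3/2 = 2 \<cdot> 15\<close>;
  any base of the weights in \<open>{1<..<3/2}\<close> admits such a coefficient.
\<close>

lemma spread_drift:
  assumes x: "harris_tree x"
  shows "(\<Sum>u\<in>x. spread (grow x u) + 15 * fringe (grow x u)) \<le>
    (real (card x) + 2) * (spread x + 15 * fringe x)"
proof -
  note fin = harris_finite[OF x]
  have "(\<Sum>u\<in>x. \<Sum>w\<in>x - {[]}. of_bool (u \<in> branch w) *
      ((5/4) ^ sum_list w * (2 * (branch_size x w + 1)))) = 2 * spread x"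
  proof -
    have "(\<Sum>u\<in>x. of_bool (u \<in> branch w)) = branch_size x w" for w
      using fin by (simp add: branch_size_def Int_def flip: sum.inter_filter)
    then have "(\<Sum>w\<in>x - {[]}. \<Sum>u\<in>x. of_bool (u \<in> branch w) *
        ((5/4) ^ sum_list w * (2 * (branch_size x w + 1)))) =
      (\<Sum>w\<in>x - {[]}. branch_size x w * ((5/4) ^ sum_list w * (2 * (branch_size x w + 1))))"
      by (simp only: sum_distrib_right[symmetric])
    also have "\<dots> = 2 * spread x"
      unfolding spread_def sum_distrib_left by (intro sum.cong refl) (simp add: algebra_simps)
    finally show ?thesis by (subst sum.swap)
  qed
  then have "(\<Sum>u\<in>x. spread (grow x u)) = real (card x) * spread x + 2 * spread x + 15/2 * fringe x"
    by (simp add: spread_grow[OF x] sum.distrib fringe_def sum_distrib_left)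
  moreover have "(\<Sum>u\<in>x. fringe (grow x u)) = real (card x) * fringe x + 3/2 * fringe x"
  proof -
    have "(\<Sum>u\<in>x. fringe (grow x u)) = (\<Sum>u\<in>x. fringe x + 3/2 * (5/4) ^ (sum_list u + deg x u))"
      by (intro sum.cong refl) (rule fringe_grow[OF x])
    also have "\<dots> = (\<Sum>u\<in>x. fringe x) + 3/2 * (\<Sum>u\<in>x. (5/4) ^ (sum_list u + deg x u))"
      by (simp only: sum.distrib sum_distrib_left)
    finally show ?thesis by (simp add: fringe_def)
  qed
  moreover have "(\<Sum>u\<in>x. spread (grow x u) + 15 * fringe (grow x u)) =
      (\<Sum>u\<in>x. spread (grow x u)) + 15 * (\<Sum>u\<in>x. fringe (grow x u))"
    by (simp only: sum.distrib sum_distrib_left)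
  ultimately show ?thesis by (simp add: algebra_simps)
qed

lemma (in harris_process) mean_spread:
  assumes n: "n \<ge> 1"
  shows "mean n spread \<le> 15 * real n ^ 2"
proof -
  have "deg {[]} [] = 0" by (simp add: deg_def)
  then have 0: "spread {[]} + 15 * fringe {[]} = 15" by (simp add: spread_def fringe_def)
  have "mean n spread \<le> mean n (\<lambda>x. spread x + 15 * fringe x)"
    by (rule mean_mono[OF n]) (simp add: fringe_def sum_nonneg)
  also have "\<dots> \<le> real n * (real n + 1) / 2 * 15"
    using quadratic_drift[OF spread_drift n] by (simp only: 0)
  also have "\<dots> \<le> real n * (real n + real n) / 2 * 15"
    using n by (intro mult_right_mono divide_right_mono mult_left_mono) auto
  finally show ?thesis by (simp add: power2_eq_square)
qed

text \<open>
  This bounds everything that is neglected after cutting along \<open>F\<close>.  Nodes outside \<open>F\<close> have a weight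
  of at least \<open>(5/4)\<^sup>k\<close> in \<open>spread\<close> if \<open>F\<close> contains all nodes with \<open>|u|\<^sub>1 \<le> k\<close>.
\<close>

definition outer :: "nat list set \<Rightarrow> nat list set \<Rightarrow> real" where
  "outer F x = (\<Sum>w\<in>x - F. branch_size x w * (branch_size x w + 1))"

lemma outer_le_spread:
  assumes x: "harris_tree x" and F: "{u \<in> nodes. sum_list u \<le> k} \<subseteq> F"
  shows "outer F x \<le> (4/5) ^ k * spread x"
proof -
  have "[] \<in> F" using F by (auto simp: nodes_def)
  have "outer F x \<le> (\<Sum>w\<in>x - F. (4/5) ^ k *
      ((5/4) ^ sum_list w * (branch_size x w * (branch_size x w + 1))))"
    unfolding outer_def
  proof (rule sum_mono)
    fix w assume w: "w \<in> x - F"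
    then have "w \<in> nodes" using harris_nodes[OF x] by blast
    then have "k \<le> sum_list w" using w F by force
    then have "1 \<le> (4/5 :: real) ^ k * (5/4) ^ sum_list w"
      using power_increasing[of k "sum_list w" "5/4 :: real"]
      by (simp add: power_divide field_simps)
    from mult_right_mono[OF this, of "branch_size x w * (branch_size x w + 1)"]
    show "branch_size x w * (branch_size x w + 1) \<le> (4/5) ^ k *
      ((5/4) ^ sum_list w * (branch_size x w * (branch_size x w + 1)))"
      by (simp add: branch_size_def mult_ac)
  qed
  also have "\<dots> \<le> (\<Sum>w\<in>x - {[]}. (4/5) ^ k *
      ((5/4) ^ sum_list w * (branch_size x w * (branch_size x w + 1))))"
    using \<open>[] \<in> F\<close> harris_finite[OF x]
    by (intro sum_mono2) (auto simp: branch_size_def)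
  finally show ?thesis by (simp add: spread_def sum_distrib_left)
qed

lemma (in harris_process) mean_outer:
  assumes n: "n \<ge> 1" and F: "{u \<in> nodes. sum_list u \<le> k} \<subseteq> F"
  shows "mean n (outer F) \<le> 15 * real n ^ 2 * (4/5) ^ k"
proof -
  have "mean n (outer F) \<le> mean n (\<lambda>x. (4/5) ^ k * spread x)"
    by (rule mean_mono[OF n]) (rule outer_le_spread[OF _ F])
  also have "\<dots> \<le> (4/5) ^ k * (15 * real n ^ 2)"
    using mean_spread[OF n] by (simp add: mean_cmult)
  finally show ?thesis by (simp add: mult_ac)
qed

section \<open>Cutting a tree along a finite tree\<close>

text \<open>
  The longest prefix in \<open>F\<close>, defined through the list of all prefixes so that it can be computed by
  recursion from the end of the node.
\<close>

definition owner :: "nat list set \<Rightarrow> nat list \<Rightarrow> nat list" where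
  "owner F v = last (filter (\<lambda>w. w \<in> F) (prefixes v))"

lemma owner_snoc: "owner F (v @ [i]) = (if v @ [i] \<in> F then v @ [i] else owner F v)"
  by (simp add: owner_def)

lemma owner_Nil: "[] \<in> F \<Longrightarrow> owner F [] = []"
  by (simp add: owner_def)

lemma owner_self: "v \<in> F \<Longrightarrow> owner F v = v"
  by (cases v rule: rev_cases) (auto simp: owner_snoc owner_Nil)

lemma owner_props:
  assumes "harris_tree F"
  shows "owner F v \<in> F \<and> prefix (owner F v) v"
  using harris_Nil[OF assms]
  by (induction v rule: rev_induct) (auto simp: owner_snoc owner_Nil)

lemma prefix_owner_iff:
  assumes F: "harris_tree F" and w: "w \<in> F"
  shows "prefix w (owner F v) \<longleftrightarrow> prefix w v"
  using harris_Nil[OF F] w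
  by (induction v rule: rev_induct) (auto simp: owner_snoc owner_Nil prefix_snoc)

definition piece :: "nat list set \<Rightarrow> nat list set \<Rightarrow> nat list \<Rightarrow> nat list set" where
  "piece F x u = {v \<in> x. owner F v = u}"

definition piece_size :: "nat list set \<Rightarrow> nat list set \<Rightarrow> nat list \<Rightarrow> nat" where
  "piece_size F x u = card (piece F x u)"

text \<open>
  The mean of the path length of a random tree with \<open>N\<close> nodes is \<open>N (H\<^sub>N - 1)\<close>; in every piece this
  is distributed evenly over the nodes.
\<close>

definition deviation :: "nat list set \<Rightarrow> nat list set \<Rightarrow> nat list \<Rightarrow> real" where
  "deviation F x v = real (length v) - real (length (owner F v)) - harm (piece_size F x (owner F v)) + 1"

definition total_dev :: "nat list set \<Rightarrow> nat list set \<Rightarrow> real" where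
  "total_dev F x = (\<Sum>v\<in>x. deviation F x v)"

definition square_dev :: "nat list set \<Rightarrow> nat list set \<Rightarrow> real" where
  "square_dev F x = (\<Sum>v\<in>x. deviation F x v ^ 2)"

definition piece_energy :: "nat list set \<Rightarrow> nat list set \<Rightarrow> real" where
  "piece_energy F x = (\<Sum>v\<in>x. real (piece_size F x (owner F v)) + 1)"

text \<open>
  One step changes the mean of \<open>total_dev\<^sup>2\<close> by \<open>2/n\<close> times itself and by \<open>1/n\<close> times \<open>square_dev\<close>.
  Including \<open>square_dev\<close> and the number of nodes closes the recursion: on average the three terms
  together gain at most \<open>2/n\<close> times their value, minus \<open>1/n\<close> for every node whose child would
  open a new piece.  Half of \<open>piece_energy\<close> follows this recursion exactly, and the difference
  starts at \<open>0\<close>.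
\<close>

definition cut_potential :: "nat list set \<Rightarrow> nat list set \<Rightarrow> real" where
  "cut_potential F x = total_dev F x ^ 2 + square_dev F x + real (card x) - piece_energy F x / 2"

lemma cut_grow_inside:
  assumes F: "harris_tree F" and x: "harris_tree x" and v: "v \<in> x" and z: "new_node x v \<notin> F"
  defines "N \<equiv> real (piece_size F x (owner F v))"
  shows "total_dev F (grow x v) = total_dev F x + deviation F x v"
    and "square_dev F (grow x v) \<le> square_dev F x + deviation F x v ^ 2 +
      2 * N / (N + 1) * deviation F x v -
      2 / (N + 1) * (\<Sum>w\<in>piece F x (owner F v). deviation F x w) + 1"
    and "piece_energy F (grow x v) = piece_energy F x + 2 * (N + 1)"
proof -
  let ?z = "new_node x v" and ?o = "owner F v"
  have oz: "owner F ?z = ?o" using z by (simp add: new_node_def owner_snoc)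
  have N0: "N \<ge> 0" by (simp add: N_def)
  have pc: "piece F (grow x v) u = (if u = ?o then insert ?z (piece F x u) else piece F x u)" for u
    using oz by (auto simp: piece_def grow_def)
  have fin: "finite (piece F x u)" for u using harris_finite[OF x] by (simp add: piece_def)
  have znot: "?z \<notin> piece F x u" for u using new_node_notin[OF x] by (simp add: piece_def)
  have ps: "piece_size F (grow x v) u = (if u = ?o then Suc (piece_size F x u) else piece_size F x u)" for u
    using fin znot by (simp add: piece_size_def pc)
  have dw: "deviation F (grow x v) w = deviation F x w - of_bool (owner F w = ?o) / (N + 1)" for w
    by (simp add: deviation_def ps harm_Suc N_def inverse_eq_divide add.commute)
  have dz: "deviation F (grow x v) ?z = deviation F x v + N / (N + 1)"
  proof -
    have "length ?z = Suc (length v)" by (simp add: new_node_def)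
    then show ?thesis
      using N0 by (simp add: deviation_def ps oz harm_Suc N_def[symmetric] field_simps)
  qed
  have cnt: "(\<Sum>w\<in>x. of_bool (owner F w = ?o) * c) = N * c" for c :: real
    using harris_finite[OF x]
    by (simp add: N_def piece_size_def piece_def Int_def flip: sum_distrib_right)
  show "total_dev F (grow x v) = total_dev F x + deviation F x v"
    using cnt[of "1 / (N + 1)"] by (simp add: total_dev_def sum_grow[OF x] dz) (simp add: dw sum_subtractf)
  have "square_dev F (grow x v) =
      (\<Sum>w\<in>x. deviation F x w ^ 2 - 2 / (N + 1) * (of_bool (owner F w = ?o) * deviation F x w) +
        of_bool (owner F w = ?o) * (1 / (N + 1) ^ 2)) + (deviation F x v + N / (N + 1)) ^ 2"
    unfolding square_dev_def sum_grow[OF x] dz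
    by (intro arg_cong2[of _ _ _ _ "(+)"] sum.cong refl)
      (auto simp: dw power2_diff power_divide)
  also have "\<dots> = square_dev F x - 2 / (N + 1) * (\<Sum>w\<in>piece F x ?o. deviation F x w) +
      N * (1 / (N + 1) ^ 2) + (deviation F x v + N / (N + 1)) ^ 2"
  proof -
    have "(\<Sum>w\<in>x. of_bool (owner F w = ?o) * deviation F x w) = (\<Sum>w\<in>piece F x ?o. deviation F x w)"
      unfolding piece_def using harris_finite[OF x]
      by (intro sum.mono_neutral_cong_right) auto
    then show ?thesis
      by (simp only: sum.distrib sum_subtractf sum_distrib_left[symmetric] cnt square_dev_def)
  qed
  also have "(deviation F x v + N / (N + 1)) ^ 2 = deviation F x v ^ 2 +
      2 * N / (N + 1) * deviation F x v + N * (N / (N + 1) ^ 2)"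
    by (simp add: power2_eq_square algebra_simps)
  finally have "square_dev F (grow x v) = square_dev F x + deviation F x v ^ 2 +
      2 * N / (N + 1) * deviation F x v -
      2 / (N + 1) * (\<Sum>w\<in>piece F x ?o. deviation F x w) + N * ((1 + N) / (N + 1) ^ 2)"
    by (simp add: algebra_simps add_divide_distrib)
  moreover have "N * ((1 + N) / (N + 1) ^ 2) \<le> 1"
  proof -
    have "N * (1 + N) \<le> 1 * (N + 1) ^ 2" using N0 by (simp add: power2_eq_square algebra_simps)
    moreover have "(N + 1) ^ 2 > 0" using N0 by simp
    ultimately show ?thesis by (simp add: pos_divide_le_eq)
  qed
  ultimately show "square_dev F (grow x v) \<le> square_dev F x + deviation F x v ^ 2 +
      2 * N / (N + 1) * deviation F x v -
      2 / (N + 1) * (\<Sum>w\<in>piece F x (owner F v). deviation F x w) + 1"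
    by simp
  have "piece_energy F (grow x v) = (\<Sum>w\<in>x. real (piece_size F x (owner F w)) + 1 +
      of_bool (owner F w = ?o) * 1) + (N + 2)"
  proof -
    have "real (piece_size F (grow x v) (owner F w)) + 1 =
        real (piece_size F x (owner F w)) + 1 + of_bool (owner F w = ?o) * 1" for w
      by (simp add: ps)
    moreover have "real (piece_size F (grow x v) (owner F ?z)) + 1 = N + 2"
      by (simp add: ps oz N_def)
    ultimately show ?thesis unfolding piece_energy_def sum_grow[OF x] by (simp only:)
  qed
  also have "\<dots> = piece_energy F x + 2 * (N + 1)"
    unfolding sum.distrib[of "\<lambda>w. real (piece_size F x (owner F w)) + 1"] cnt
    by (simp add: piece_energy_def)
  finally show "piece_energy F (grow x v) = piece_energy F x + 2 * (N + 1)" .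
qed

text \<open>
  If the new node belongs to \<open>F\<close>, then so do its earlier siblings.  At this time the piece of its
  parent therefore consists of the parent only, and the new node opens a piece of its own.
\<close>

lemma cut_grow_on_cut:
  assumes F: "harris_tree F" and x: "harris_tree x" and v: "v \<in> x" and z: "new_node x v \<in> F"
  shows "piece F x (owner F v) = {v}" "deviation F x v = 0"
    and "total_dev F (grow x v) = total_dev F x"
    and "square_dev F (grow x v) = square_dev F x"
    and "piece_energy F (grow x v) = piece_energy F x + 2"
proof -
  let ?z = "new_node x v"
  have "v \<in> F" using harris_prefix[OF F _ z, of v] by (simp add: new_node_def)
  then have ov: "owner F v = v" by (rule owner_self)
  show pv: "piece F x (owner F v) = {v}"
  proof -
    have "w = v" if w: "w \<in> x" "owner F w = v" for w
    proof (rule ccontr)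
      assume "w \<noteq> v"
      moreover have "prefix v w" using owner_props[OF F, of w] w by simp
      ultimately obtain i where i: "prefix (v @ [i]) w"
        by (metis append_Cons append_Nil append_eq_append_conv2 neq_Nil_conv prefix_def append.assoc append_self_conv)
      then have "v @ [i] \<in> x" using harris_prefix[OF x] w by blast
      then have "1 \<le> i" "i \<le> deg x v" by (simp_all add: child_iff[OF x])
      then have "v @ [i] \<in> F" using harris_sibling[OF F, of v "Suc (deg x v)" i] z
        by (simp add: new_node_def)
      then have "prefix (v @ [i]) v" using prefix_owner_iff[OF F, of "v @ [i]" w] i w by simp
      then show False using prefix_length_le by fastforce
    qed
    then show ?thesis using v ov by (auto simp: piece_def)
  qed
  show dv: "deviation F x v = 0"
    using pv by (simp add: deviation_def piece_size_def ov harm_expand)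
  have oz: "owner F ?z = ?z" using z by (rule owner_self)
  have ow: "owner F w \<noteq> ?z" if "w \<in> x" for w
    using owner_props[OF F, of w] not_prefix_new_node[OF x that, of v] by metis
  have pc: "piece F (grow x v) u = piece F x u" if "u \<noteq> ?z" for u
    using that oz by (auto simp: piece_def grow_def)
  have pz: "piece F (grow x v) ?z = {?z}"
    using oz ow by (auto simp: piece_def grow_def)
  have dw: "deviation F (grow x v) w = deviation F x w" if "w \<in> x" for w
    using ow[OF that] by (simp add: deviation_def piece_size_def pc)
  have dz: "deviation F (grow x v) ?z = 0"
    by (simp add: deviation_def piece_size_def oz pz harm_expand)
  show "total_dev F (grow x v) = total_dev F x" "square_dev F (grow x v) = square_dev F x"
    by (simp_all add: total_dev_def square_dev_def sum_grow[OF x] dw dz)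
  show "piece_energy F (grow x v) = piece_energy F x + 2"
    by (simp add: piece_energy_def sum_grow[OF x] piece_size_def oz pz pc ow)
qed

lemma cut_potential_drift:
  assumes F: "harris_tree F" and x: "harris_tree x"
  shows "(\<Sum>v\<in>x. cut_potential F (grow x v)) \<le> (real (card x) + 2) * cut_potential F x"
proof -
  let ?N = "\<lambda>v. real (piece_size F x (owner F v))" and ?d = "deviation F x"
  let ?S = "\<lambda>v. \<Sum>w\<in>piece F x (owner F v). ?d w"
  let ?A = "total_dev F x"
  \<comment> \<open>The bound covers both kinds of growth: in the second one \<open>?N v = 1\<close> and \<open>?d v = 0\<close>.\<close>
  have step: "cut_potential F (grow x v) \<le> cut_potential F x + 2 * ?A * ?d v + 2 * ?d v ^ 2 +
      2 * ?N v / (?N v + 1) * ?d v - 2 / (?N v + 1) * ?S v + 2 - (?N v + 1)" if v: "v \<in> x" for v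
  proof (cases "new_node x v \<in> F")
    case False
    have arith: "a + d + c + s' + (1 + n) - (e + 2 * (N + 1)) / 2 \<le>
        a + s + n - e / 2 + c + 2 * d + t - r + 2 - (N + 1)"
      if "s' \<le> s + d + t - r + 1" for a c d e n r s s' t N :: real
      using that by (simp add: field_simps)
    show ?thesis
      unfolding cut_potential_def card_grow[OF x] cut_grow_inside(1,3)[OF F x v False]
        power2_sum of_nat_Suc
      by (rule arith[OF cut_grow_inside(2)[OF F x v False]])
  next
    case True
    then show ?thesis
      using cut_grow_on_cut[OF F x v True]
      by (simp add: cut_potential_def card_grow[OF x] piece_size_def add_divide_distrib)
  qed
  \<comment> \<open>The terms that are linear in the deviations cancel on average.\<close>
  have swap: "(\<Sum>v\<in>x. 2 / (?N v + 1) * ?S v) = (\<Sum>w\<in>x. 2 * ?N w / (?N w + 1) * ?d w)"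
  proof -
    have "(\<Sum>v\<in>x. 2 / (?N v + 1) * ?S v) =
        (\<Sum>v\<in>x. \<Sum>w\<in>x. if owner F w = owner F v then 2 / (?N v + 1) * ?d w else 0)"
      unfolding piece_def using harris_finite[OF x]
      by (simp add: sum.inter_filter sum_distrib_left if_distrib cong: if_cong)
    also have "\<dots> = (\<Sum>w\<in>x. \<Sum>v\<in>x. if owner F v = owner F w then 2 / (?N w + 1) * ?d w else 0)"
      by (subst sum.swap) (auto intro!: sum.cong)
    also have "\<dots> = (\<Sum>w\<in>x. ?N w * (2 / (?N w + 1) * ?d w))"
      using harris_finite[OF x]
      by (intro sum.cong refl) (simp add: piece_size_def piece_def flip: sum.inter_filter)
    finally show ?thesis by (simp add: mult_ac)
  qed
  have "(\<Sum>v\<in>x. cut_potential F (grow x v)) \<le>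
      (\<Sum>v\<in>x. cut_potential F x + 2 * ?A * ?d v + 2 * ?d v ^ 2 +
      2 * ?N v / (?N v + 1) * ?d v - 2 / (?N v + 1) * ?S v + 2 - (?N v + 1))"
    by (rule sum_mono) (rule step)
  also have "\<dots> = real (card x) * cut_potential F x + 2 * ?A * ?A + 2 * square_dev F x +
      2 * real (card x) - piece_energy F x"
    unfolding sum.distrib sum_subtractf swap
    by (simp add: total_dev_def square_dev_def piece_energy_def sum.distrib flip: sum_distrib_left)
  also have "\<dots> = (real (card x) + 2) * cut_potential F x"
    by (simp add: cut_potential_def power2_eq_square algebra_simps)
  finally show ?thesis .
qed

lemma (in harris_process) mean_total_dev:
  assumes F: "harris_tree F" and n: "n \<ge> 1"
  shows "mean n (\<lambda>x. total_dev F x ^ 2) \<le> mean n (piece_energy F) / 2"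
proof -
  have o: "owner F [] = []" using harris_Nil[OF F] by (rule owner_Nil)
  have "piece F {[]} [] = {[]}" by (auto simp: piece_def o)
  then have 0: "cut_potential F {[]} = 0"
    by (simp add: cut_potential_def total_dev_def square_dev_def piece_energy_def deviation_def
      piece_size_def o harm_expand)
  have "mean n (\<lambda>x. total_dev F x ^ 2) \<le> mean n (\<lambda>x. cut_potential F x + piece_energy F x / 2)"
    by (rule mean_mono[OF n]) (simp add: cut_potential_def square_dev_def sum_nonneg)
  also have "\<dots> = mean n (cut_potential F) + mean n (piece_energy F) / 2"
    using n by (simp add: mean_add mean_divide)
  also have "\<dots> \<le> 0 + mean n (piece_energy F) / 2"
    using quadratic_drift[OF cut_potential_drift[OF F] n] by (simp add: 0)
  finally show ?thesis by simp
qed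

lemma sum_over_owners:
  assumes F: "harris_tree F" and x: "harris_tree x"
  shows "(\<Sum>v\<in>x. g (owner F v)) = (\<Sum>u\<in>F. real (piece_size F x u) * g u)"
proof -
  have "(\<Sum>v\<in>x. g (owner F v)) = (\<Sum>u\<in>F. \<Sum>v\<in>{v \<in> x. owner F v = u}. g (owner F v))"
    using owner_props[OF F] harris_finite[OF F] harris_finite[OF x]
    by (intro sum.group[symmetric]) auto
  also have "\<dots> = (\<Sum>u\<in>F. \<Sum>v\<in>{v \<in> x. owner F v = u}. g u)"
    by (intro sum.cong refl) auto
  finally show ?thesis by (simp add: piece_size_def piece_def)
qed

text \<open>
  Apart from \<open>u\<close> itself, a piece consists of the children of \<open>u\<close> outside \<open>F\<close> and their descendants;
  the first of these children is the next child of \<open>u\<close> in \<open>F\<close>.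
\<close>

lemma piece_in_branch:
  assumes F: "harris_tree F" and x: "harris_tree x" and u: "u \<in> F"
    and v: "v \<in> piece F x u" "v \<noteq> u"
  shows "new_node F u \<in> x \<and> v \<in> branch (new_node F u)"
proof -
  have o: "owner F v = u" and vx: "v \<in> x" using v by (simp_all add: piece_def)
  then have "prefix u v" using owner_props[OF F, of v] by simp
  then obtain i r where ir: "v = u @ i # r" using v(2) by (metis append_Nil2 list.exhaust prefix_def)
  then have i: "prefix (u @ [i]) v" by simp
  have "u @ [i] \<notin> F"
  proof
    assume "u @ [i] \<in> F"
    then have "prefix (u @ [i]) u" using prefix_owner_iff[OF F, of "u @ [i]" v] i o by simp
    then show False using prefix_length_le by fastforce
  qed
  moreover have "1 \<le> i" using vx harris_nodes[OF x] ir by (auto simp: nodes_def)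
  ultimately have i_ge: "Suc (deg F u) \<le> i" by (simp add: child_iff[OF F] not_le)
  have "u @ [i] \<in> x" using harris_prefix[OF x i vx] .
  then have "new_node F u \<in> x"
    using harris_sibling[OF x, of u i "Suc (deg F u)"] i_ge by (simp add: new_node_def)
  then show ?thesis using i i_ge by (auto simp: branch_def new_node_def)
qed

lemma piece_energy_le:
  assumes F: "harris_tree F" and x: "harris_tree x"
  shows "piece_energy F x \<le> 2 * real (card F) + outer F x"
proof -
  let ?N = "\<lambda>u. real (piece_size F x u)" and ?B = "\<lambda>w. branch_size x w * (branch_size x w + 1)"
  have piece: "?N u * (?N u + 1) \<le> 2 + (if new_node F u \<in> x then ?B (new_node F u) else 0)"
    if u: "u \<in> F" for u
  proof (cases "new_node F u \<in> x")
    case True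
    have "u \<in> x \<inter> branch (new_node F u)"
      using harris_prefix[OF x _ True, of u] by (simp add: new_node_def branch_def)
    moreover have "v \<in> x" if "v \<in> piece F x u" for v using that by (simp add: piece_def)
    ultimately have "piece F x u \<subseteq> x \<inter> branch (new_node F u)"
      using piece_in_branch[OF F x u] by blast
    then have "?N u \<le> branch_size x (new_node F u)"
      unfolding piece_size_def branch_size_def using harris_finite[OF x]
      by (intro of_nat_mono card_mono) auto
    then have "?N u * (?N u + 1) \<le> ?B (new_node F u)" by (intro mult_mono) auto
    then show ?thesis using True by simp
  next
    case False
    then have "piece F x u \<subseteq> {u}" using piece_in_branch[OF F x u] by auto
    then have "piece_size F x u \<le> 1"
      unfolding piece_size_def using card_mono[of "{u}" "piece F x u"] by simp
    then have "?N u * (?N u + 1) \<le> 1 * (1 + 1)" by (intro mult_mono) auto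
    then show ?thesis using False by simp
  qed
  have inj: "inj_on (new_node F) F" by (auto simp: inj_on_def new_node_def)
  have "piece_energy F x = (\<Sum>u\<in>F. ?N u * (?N u + 1))"
    unfolding piece_energy_def by (rule sum_over_owners[OF F x])
  also have "\<dots> \<le> (\<Sum>u\<in>F. 2 + (if new_node F u \<in> x then ?B (new_node F u) else 0))"
    by (rule sum_mono) (rule piece)
  also have "\<dots> = 2 * real (card F) + (\<Sum>w\<in>new_node F ` F. if w \<in> x then ?B w else 0)"
    by (simp add: sum.distrib sum.reindex[OF inj])
  also have "(\<Sum>w\<in>new_node F ` F. if w \<in> x then ?B w else 0) = (\<Sum>w\<in>new_node F ` F \<inter> x. ?B w)"
    using harris_finite[OF F] by (simp add: sum.inter_restrict)
  also have "\<dots> \<le> outer F x"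
    unfolding outer_def using harris_finite[OF x] new_node_notin[OF F]
    by (intro sum_mono2) (auto simp: branch_size_def)
  finally show ?thesis by simp
qed

section \<open>The Wiener index in terms of the cut\<close>

definition sub_size :: "nat list set \<Rightarrow> nat list \<Rightarrow> real" where
  "sub_size x w = real (card {v \<in> x. prefix w v})"

lemma card_subtree:
  assumes x: "harris_tree x"
  shows "real (card (subtree x w)) = sub_size x w"
proof -
  have "{v \<in> x. prefix w v} = (\<lambda>v. w @ v) ` subtree x w"
    using harris_nodes[OF x] by (auto simp: subtree_def prefix_def nodes_def)
  then have "card {v \<in> x. prefix w v} = card (subtree x w)"
    by (simp add: card_image inj_on_def)
  then show ?thesis by (simp add: sub_size_def)
qed

lemma sub_size_Nil: "sub_size x [] = real (card x)"
  by (simp add: sub_size_def)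

lemma sub_size_eq_0: "harris_tree x \<Longrightarrow> w \<notin> x \<Longrightarrow> sub_size x w = 0"
proof -
  assume "harris_tree x" "w \<notin> x"
  then have "{v \<in> x. prefix w v} = {}" using harris_prefix by blast
  then show "sub_size x w = 0" unfolding sub_size_def by (metis card.empty of_nat_0)
qed

lemma sub_size_le_branch_size:
  assumes "harris_tree x" "w \<noteq> []"
  shows "sub_size x w \<le> branch_size x w"
proof -
  have "{v \<in> x. prefix w v} \<subseteq> x \<inter> branch w"
    using assms(2) by (auto simp: branch_def intro!: exI[of _ "last w"])
  then show ?thesis unfolding sub_size_def branch_size_def
    using harris_finite[OF assms(1)] by (intro of_nat_mono card_mono) auto
qed

lemma outer_sub_size:
  assumes x: "harris_tree x" and F: "[] \<in> F"
  shows "(\<Sum>w\<in>x - F. sub_size x w ^ 2) \<le> outer F x"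
  unfolding outer_def
proof (rule sum_mono)
  fix w assume w: "w \<in> x - F"
  then have "w \<noteq> []" using F by auto
  then have "sub_size x w \<le> branch_size x w" by (rule sub_size_le_branch_size[OF x])
  moreover have "0 \<le> sub_size x w" by (simp add: sub_size_def)
  ultimately have "sub_size x w * sub_size x w \<le> branch_size x w * (branch_size x w + 1)"
    by (intro mult_mono) auto
  then show "sub_size x w ^ 2 \<le> branch_size x w * (branch_size x w + 1)"
    by (simp add: power2_eq_square)
qed

text \<open>
  Double counting: the length of a node is the number of its nonempty prefixes.
\<close>

lemma sum_length_owner:
  assumes F: "harris_tree F" and x: "harris_tree x"
  shows "(\<Sum>v\<in>x. real (length (owner F v))) = (\<Sum>w\<in>F - {[]}. sub_size x w)"
proof -
  have "real (length (owner F v)) = (\<Sum>w\<in>F - {[]}. of_bool (prefix w v))" for v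
  proof -
    have "w \<in> F" if "prefix w (owner F v)" for w
      using harris_prefix[OF F that] owner_props[OF F, of v] by simp
    then have "{w. w \<noteq> [] \<and> prefix w (owner F v)} = (F - {[]}) \<inter> {w. prefix w v}"
      using prefix_owner_iff[OF F] by blast
    then show ?thesis using harris_finite[OF F] card_prefixes[of "owner F v"] by simp
  qed
  then have "(\<Sum>v\<in>x. real (length (owner F v))) = (\<Sum>v\<in>x. \<Sum>w\<in>F - {[]}. of_bool (prefix w v))"
    by simp
  also have "\<dots> = (\<Sum>w\<in>F - {[]}. \<Sum>v\<in>x. of_bool (prefix w v))" by (rule sum.swap)
  also have "\<dots> = (\<Sum>w\<in>F - {[]}. sub_size x w)"
    using harris_finite[OF x] by (simp add: sub_size_def Int_def)
  finally show ?thesis .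
qed

lemma wiener_subtree_formula:
  assumes x: "harris_tree x"
  shows "wiener_index x =
    real (card x) * (\<Sum>v\<in>x. real (length v)) - (\<Sum>w\<in>x. sub_size x w ^ 2) + real (card x) ^ 2"
proof -
  note fin = harris_finite[OF x]
  have cd: "real (common_depth u v) = (\<Sum>w\<in>x - {[]}. of_bool (prefix w u) * of_bool (prefix w v))"
    if "u \<in> x" "v \<in> x" for u v
  proof -
    have "{w. w \<noteq> [] \<and> prefix w u \<and> prefix w v} = (x - {[]}) \<inter> {w. prefix w u \<and> prefix w v}"
      using harris_prefix[OF x] that by auto
    then show ?thesis using fin by (simp add: common_depth_def flip: of_bool_conj)
  qed
  have "(\<Sum>u\<in>x. \<Sum>v\<in>x. real (common_depth u v)) =
      (\<Sum>u\<in>x. \<Sum>v\<in>x. \<Sum>w\<in>x - {[]}. of_bool (prefix w u) * of_bool (prefix w v))"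
    by (simp add: cd)
  also have "\<dots> = (\<Sum>u\<in>x. \<Sum>w\<in>x - {[]}. \<Sum>v\<in>x. of_bool (prefix w u) * of_bool (prefix w v))"
    by (intro sum.cong refl sum.swap)
  also have "\<dots> = (\<Sum>w\<in>x - {[]}. \<Sum>u\<in>x. \<Sum>v\<in>x. of_bool (prefix w u) * of_bool (prefix w v))"
    by (rule sum.swap)
  also have "\<dots> = (\<Sum>w\<in>x - {[]}. sub_size x w ^ 2)"
  proof (rule sum.cong[OF refl])
    fix w
    have "(\<Sum>v\<in>x. of_bool (prefix w v)) = sub_size x w" using fin by (simp add: sub_size_def Int_def)
    then show "(\<Sum>u\<in>x. \<Sum>v\<in>x. of_bool (prefix w u) * of_bool (prefix w v)) = sub_size x w ^ 2"
      by (simp only: sum_product[symmetric] power2_eq_square)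
  qed
  finally have c: "(\<Sum>u\<in>x. \<Sum>v\<in>x. real (common_depth u v)) = (\<Sum>w\<in>x - {[]}. sub_size x w ^ 2)" .
  have "wiener_index x = real (card x) * (\<Sum>v\<in>x. real (length v)) - (\<Sum>w\<in>x - {[]}. sub_size x w ^ 2)"
    unfolding wiener_eq[OF x] tree_dist_def
    by (simp add: sum.distrib sum_subtractf c flip: sum_distrib_left)
  also have "(\<Sum>w\<in>x - {[]}. sub_size x w ^ 2) = (\<Sum>w\<in>x. sub_size x w ^ 2) - real (card x) ^ 2"
    using sum.remove[OF fin harris_Nil[OF x], of "\<lambda>w. sub_size x w ^ 2"] by (simp add: sub_size_Nil)
  finally show ?thesis by simp
qed

text \<open>
  The part of the rescaled Wiener index that depends on finitely many subtree sizes only.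
\<close>

definition inner_part :: "nat list set \<Rightarrow> nat list set \<Rightarrow> real" where
  "inner_part F x = (\<Sum>u\<in>F. real (piece_size F x u) / real (card x) *
      (harm (piece_size F x u) - harm (card x)) +
      sub_size x u / real (card x) - (sub_size x u / real (card x)) ^ 2) - 1"

lemma wiener_cut_formula:
  assumes F: "harris_tree F" and x: "harris_tree x"
  defines "n \<equiv> real (card x)"
  shows "wiener_index x / n ^ 2 - harm (card x) =
    total_dev F x / n + inner_part F x - (\<Sum>w\<in>x - F. sub_size x w ^ 2) / n ^ 2"
proof -
  have n: "n > 0" using card_harris_pos[OF x] by (simp add: n_def)
  note finF = harris_finite[OF F] and finx = harris_finite[OF x]
  let ?h = "\<Sum>u\<in>F. real (piece_size F x u) * harm (piece_size F x u)"
  have ol: "(\<Sum>v\<in>x. real (length (owner F v))) = (\<Sum>w\<in>F. sub_size x w) - n"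
    using sum.remove[OF finF harris_Nil[OF F], of "sub_size x"]
    by (simp add: sum_length_owner[OF F x] sub_size_Nil n_def)
  have "total_dev F x = (\<Sum>v\<in>x. real (length v)) - ((\<Sum>w\<in>F. sub_size x w) - n) - ?h + n"
    unfolding total_dev_def deviation_def
    by (simp add: sum.distrib sum_subtractf ol n_def sum_over_owners[OF F x, of "\<lambda>u. harm (piece_size F x u)"])
  then have len: "(\<Sum>v\<in>x. real (length v)) = total_dev F x + ?h + (\<Sum>w\<in>F. sub_size x w) - 2 * n"
    by simp
  have sq: "(\<Sum>w\<in>x. sub_size x w ^ 2) = (\<Sum>w\<in>F. sub_size x w ^ 2) + (\<Sum>w\<in>x - F. sub_size x w ^ 2)"
  proof -
    have "(\<Sum>w\<in>x. sub_size x w ^ 2) = (\<Sum>w\<in>x \<union> F. sub_size x w ^ 2)"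
      using finx finF sub_size_eq_0[OF x] by (intro sum.mono_neutral_left) auto
    also have "x \<union> F = F \<union> (x - F)" by auto
    also have "(\<Sum>w\<in>F \<union> (x - F). sub_size x w ^ 2) =
        (\<Sum>w\<in>F. sub_size x w ^ 2) + (\<Sum>w\<in>x - F. sub_size x w ^ 2)"
      using finx finF by (intro sum.union_disjoint) auto
    finally show ?thesis .
  qed
  have tot: "(\<Sum>u\<in>F. real (piece_size F x u)) = n"
    using sum_over_owners[OF F x, of "\<lambda>_. 1"] by (simp add: n_def)
  have "inner_part F x = ?h / n - harm (card x) + (\<Sum>w\<in>F. sub_size x w) / n -
      (\<Sum>w\<in>F. sub_size x w ^ 2) / n ^ 2 - 1"
  proof -
    have "inner_part F x = (\<Sum>u\<in>F. real (piece_size F x u) * harm (piece_size F x u) / n -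
        harm (card x) / n * real (piece_size F x u) + sub_size x u / n - sub_size x u ^ 2 / n ^ 2) - 1"
      unfolding inner_part_def n_def[symmetric]
      by (simp add: right_diff_distrib power_divide[of _ n 2] mult.commute)
    also have "\<dots> = ?h / n - harm (card x) / n * n + (\<Sum>w\<in>F. sub_size x w) / n -
      (\<Sum>w\<in>F. sub_size x w ^ 2) / n ^ 2 - 1"
      by (simp only: sum.distrib sum_subtractf sum_divide_distrib[symmetric] sum_distrib_left[symmetric] tot)
    finally show ?thesis using n by simp
  qed
  moreover have "wiener_index x / n ^ 2 = (\<Sum>v\<in>x. real (length v)) / n -
      (\<Sum>w\<in>F. sub_size x w ^ 2) / n ^ 2 - (\<Sum>w\<in>x - F. sub_size x w ^ 2) / n ^ 2 + 1"
    unfolding wiener_subtree_formula[OF x] n_def[symmetric] sq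
    using n by (simp add: add_divide_distrib diff_divide_distrib power2_eq_square)
  ultimately show ?thesis
    unfolding len using n by (simp add: add_divide_distrib diff_divide_distrib)
qed

lemma piece_size_eq:
  assumes F: "harris_tree F" and x: "harris_tree x" and u: "u \<in> F"
  shows "real (piece_size F x u) = sub_size x u - (\<Sum>i=1..deg F u. sub_size x (u @ [i]))"
proof -
  let ?D = "\<lambda>w. {v \<in> x. prefix w v}"
  have "?D u = piece F x u \<union> (\<Union>i\<in>{1..deg F u}. ?D (u @ [i]))"
  proof (intro equalityI subsetI)
    fix v assume v: "v \<in> ?D u"
    then have pu: "prefix u (owner F v)" using prefix_owner_iff[OF F u] by simp
    show "v \<in> piece F x u \<union> (\<Union>i\<in>{1..deg F u}. ?D (u @ [i]))"
    proof (cases "owner F v = u")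
      case True
      then show ?thesis using v by (simp add: piece_def)
    next
      case False
      then obtain i r where ir: "owner F v = u @ i # r"
        using pu by (metis append_Nil2 list.exhaust prefix_def)
      then have i: "prefix (u @ [i]) (owner F v)" by simp
      then have "u @ [i] \<in> F" using harris_prefix[OF F] owner_props[OF F, of v] by blast
      moreover from this have "prefix (u @ [i]) v" using prefix_owner_iff[OF F] i by blast
      ultimately show ?thesis using v by (auto simp: child_iff[OF F])
    qed
  next
    fix v assume "v \<in> piece F x u \<union> (\<Union>i\<in>{1..deg F u}. ?D (u @ [i]))"
    then show "v \<in> ?D u"
      using owner_props[OF F, of v] by (auto simp: piece_def dest: append_prefixD)
  qed
  moreover have "piece F x u \<inter> (\<Union>i\<in>{1..deg F u}. ?D (u @ [i])) = {}"
  proof -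
    have "owner F v \<noteq> u" if "i \<in> {1..deg F u}" "prefix (u @ [i]) v" for v i
    proof
      assume o: "owner F v = u"
      have "u @ [i] \<in> F" using that(1) by (simp add: child_iff[OF F])
      then have "prefix (u @ [i]) u" using prefix_owner_iff[OF F, of "u @ [i]" v] that(2) o by simp
      then show False using prefix_length_le by fastforce
    qed
    then show ?thesis unfolding piece_def by blast
  qed
  ultimately have "card (?D u) = card (piece F x u) + card (\<Union>i\<in>{1..deg F u}. ?D (u @ [i]))"
    using harris_finite[OF x] by (simp add: card_Un_disjoint piece_def)
  also have "card (\<Union>i\<in>{1..deg F u}. ?D (u @ [i])) = (\<Sum>i=1..deg F u. card (?D (u @ [i])))"
  proof (rule card_UN_disjoint)
    show "\<forall>i\<in>{1..deg F u}. \<forall>j\<in>{1..deg F u}. i \<noteq> j \<longrightarrow> ?D (u @ [i]) \<inter> ?D (u @ [j]) = {}"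
      by (auto simp: prefix_def)
  qed (use harris_finite[OF x] in auto)
  finally show ?thesis by (simp add: sub_size_def piece_size_def)
qed

lemma (in harris_process) mean_piece_energy:
  assumes F: "harris_tree F" and k: "{u \<in> nodes. sum_list u \<le> k} \<subseteq> F" and n: "n \<ge> 1"
  shows "mean n (piece_energy F) \<le> 2 * real (card F) + 15 * real n ^ 2 * (4/5) ^ k"
proof -
  have "mean n (piece_energy F) \<le> mean n (\<lambda>x. 2 * real (card F) + outer F x)"
    by (rule mean_mono[OF n]) (rule piece_energy_le[OF F])
  also have "\<dots> = 2 * real (card F) + mean n (outer F)"
    unfolding mean_add[OF n] mean_const ..
  finally show ?thesis using mean_outer[OF n k] by simp
qed

text \<open>
  The free parameter \<open>s\<close> stems from \<open>a \<le> (s + a\<^sup>2/s) / 2\<close>, which replaces the Cauchy-Schwarz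
  inequality for the deviation; a good choice is the square root of \<open>(4/5)\<^sup>k\<close>.
\<close>

lemma (in harris_process) mean_inner_part:
  assumes F: "harris_tree F" and k: "{u \<in> nodes. sum_list u \<le> k} \<subseteq> F" and n: "n \<ge> 1" and s: "s > 0"
  shows "mean n (\<lambda>x. \<bar>wiener_index x / real n ^ 2 - harm n - inner_part F x\<bar>) \<le>
    (s + (real (card F) / real n ^ 2 + 15/2 * (4/5) ^ k) / s) / 2 + 15 * (4/5) ^ k"
proof -
  have "mean n (\<lambda>x. \<bar>wiener_index x / real n ^ 2 - harm n - inner_part F x\<bar>) \<le>
      mean n (\<lambda>x. (s + total_dev F x ^ 2 / (real n ^ 2 * s)) / 2 + outer F x / real n ^ 2)"
  proof (rule mean_mono[OF n])
    fix x assume x: "harris_tree x" and c: "card x = n"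
    have "wiener_index x / real n ^ 2 - harm n - inner_part F x =
        total_dev F x / real n - (\<Sum>w\<in>x - F. sub_size x w ^ 2) / real n ^ 2"
      using wiener_cut_formula[OF F x] by (simp add: c)
    moreover have "0 \<le> (\<Sum>w\<in>x - F. sub_size x w ^ 2) / real n ^ 2"
      by (simp add: sum_nonneg)
    moreover have "(\<Sum>w\<in>x - F. sub_size x w ^ 2) / real n ^ 2 \<le> outer F x / real n ^ 2"
      by (intro divide_right_mono outer_sub_size x harris_Nil F) auto
    moreover have "\<bar>total_dev F x / real n\<bar> \<le> (s + total_dev F x ^ 2 / (real n ^ 2 * s)) / 2"
      using le_mean_square[OF s, of "\<bar>total_dev F x / real n\<bar>"] by (simp add: power_divide)
    ultimately show "\<bar>wiener_index x / real n ^ 2 - harm n - inner_part F x\<bar> \<le>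
        (s + total_dev F x ^ 2 / (real n ^ 2 * s)) / 2 + outer F x / real n ^ 2"
      by linarith
  qed
  also have "\<dots> = (s + mean n (\<lambda>x. total_dev F x ^ 2) / (real n ^ 2 * s)) / 2 + mean n (outer F) / real n ^ 2"
    unfolding mean_add[OF n] mean_divide mean_const ..
  also have "\<dots> \<le> (s + (real (card F) + 15/2 * real n ^ 2 * (4/5) ^ k) / (real n ^ 2 * s)) / 2 +
      15 * real n ^ 2 * (4/5) ^ k / real n ^ 2"
    using mean_total_dev[OF F n] mean_piece_energy[OF F k n] s
    by (intro add_mono divide_right_mono mean_outer[OF n k] order_refl) auto
  also have "\<dots> = (s + (real (card F) / real n ^ 2 + 15/2 * (4/5) ^ k) / s) / 2 + 15 * (4/5) ^ k"
    using n s by (simp add: add_divide_distrib)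
  finally show ?thesis .
qed

lemma (in harris_process) mean_piece_size:
  assumes F: "harris_tree F" and k: "{u \<in> nodes. sum_list u \<le> k} \<subseteq> F" and n: "n \<ge> 1" and u: "u \<in> F"
  shows "mean n (\<lambda>x. (real (piece_size F x u) / real n) ^ 2) \<le>
    2 * real (card F) / real n ^ 2 + 15 * (4/5) ^ k"
proof -
  have "mean n (\<lambda>x. (real (piece_size F x u) / real n) ^ 2) \<le> mean n (\<lambda>x. piece_energy F x / real n ^ 2)"
  proof (rule mean_mono[OF n])
    fix x assume x: "harris_tree x"
    let ?N = "\<lambda>u. real (piece_size F x u)"
    have "?N u ^ 2 \<le> ?N u * (?N u + 1)" by (simp add: power2_eq_square algebra_simps)
    also have "\<dots> \<le> (\<Sum>u\<in>F. ?N u * (?N u + 1))"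
      using u harris_finite[OF F] by (intro member_le_sum) auto
    also have "\<dots> = piece_energy F x"
      unfolding piece_energy_def by (rule sum_over_owners[OF F x, symmetric])
    finally show "(?N u / real n) ^ 2 \<le> piece_energy F x / real n ^ 2"
      by (simp add: power_divide divide_right_mono)
  qed
  also have "\<dots> \<le> (2 * real (card F) + 15 * real n ^ 2 * (4/5) ^ k) / real n ^ 2"
    unfolding mean_divide by (intro divide_right_mono mean_piece_energy F k n) auto
  finally show ?thesis using n by (simp add: add_divide_distrib)
qed

section \<open>Entropy terms in the limit\<close>

definition x_log_x :: "real \<Rightarrow> real" where
  "x_log_x x = x * ln x"

lemma x_log_x_0 [simp]: "x_log_x 0 = 0"
  and x_log_x_1 [simp]: "x_log_x 1 = 0"
  by (simp_all add: x_log_x_def)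

lemma x_log_x_nonpos: "0 \<le> x \<Longrightarrow> x \<le> 1 \<Longrightarrow> x_log_x x \<le> 0"
  by (cases "x = 0") (simp_all add: x_log_x_def mult_le_0_iff)

lemma tendsto_x_log_x:
  assumes r: "r \<longlonglongrightarrow> q" and nonneg: "\<And>n. 0 \<le> r n"
  shows "(\<lambda>n. x_log_x (r n)) \<longlonglongrightarrow> x_log_x q"
proof (cases "q = 0")
  case True
  have "(x_log_x \<longlongrightarrow> x_log_x 0) (at_right 0)"
    unfolding x_log_x_def[abs_def] by simp real_asymp
  then have "continuous (at 0 within {0..}) x_log_x"
    by (simp add: continuous_within at_within_Ici_at_right)
  then show ?thesis unfolding True
    by (rule continuous_within_tendsto_compose'[of _ "{0..}"]) (use r nonneg True in auto)
next
  case False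
  then show ?thesis unfolding x_log_x_def by (intro tendsto_intros r)
qed

text \<open>
  As \<open>e n = H\<^sub>n - ln n\<close> converges, the difference of the harmonic numbers is \<open>ln (N n / n)\<close> up to
  \<open>e (N n) - e n\<close>.  The latter tends to \<open>0\<close> if \<open>N n\<close> does not stay behind \<open>n\<close>, and otherwise it is
  bounded and multiplied by a null sequence.
\<close>

lemma harm_entropy_limit:
  fixes N :: "nat \<Rightarrow> nat"
  assumes r: "(\<lambda>n. real (N n) / real n) \<longlonglongrightarrow> q"
  shows "(\<lambda>n. real (N n) / real n * (harm (N n) - harm n)) \<longlonglongrightarrow> x_log_x q"
proof -
  define e :: "nat \<Rightarrow> real" where "e n = harm n - ln (real n)" for n
  have e: "e \<longlonglongrightarrow> euler_mascheroni"
    unfolding e_def[abs_def] by (rule euler_mascheroni_LIMSEQ)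
  have "(\<lambda>n. real (N n) / real n * (e (N n) - e n)) \<longlonglongrightarrow> 0"
  proof (cases "q = 0")
    case True
    have "convergent e" using e by (auto simp: convergent_def)
    then have "Bseq e" by (rule convergent_imp_Bseq)
    then obtain K where K: "\<And>n. norm (e n) \<le> K" by (auto simp: Bseq_def)
    have bound: "norm (e (N n) - e n) \<le> 2 * K" for n
      using norm_triangle_ineq4[of "e (N n)" "e n"] K[of n] K[of "N n"] by linarith
    show ?thesis
    proof (rule Lim_null_comparison[of _ "\<lambda>n. real (N n) / real n * (2 * K)"])
      show "\<forall>\<^sub>F n in sequentially. norm (real (N n) / real n * (e (N n) - e n)) \<le> real (N n) / real n * (2 * K)"
        using bound by (intro always_eventually allI) (simp add: abs_mult divide_right_mono mult_left_mono)
      show "(\<lambda>n. real (N n) / real n * (2 * K)) \<longlonglongrightarrow> 0"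
        using tendsto_mult_right[OF r, of "2 * K"] True by simp
    qed
  next
    case False
    have "q \<ge> 0" using LIMSEQ_le_const[OF r, of 0] by auto
    then have "q > 0" using False by simp
    then have "filterlim (\<lambda>n. real (N n) / real n * real n) at_top sequentially"
      using r by (intro filterlim_tendsto_pos_mult_at_top[OF r] filterlim_real_sequentially) auto
    then have "filterlim (\<lambda>n. real (N n)) at_top sequentially"
      by (rule filterlim_mono_eventually[OF _ order_refl order_refl])
        (auto simp: eventually_sequentially intro: exI[of _ 1])
    then have "filterlim N at_top sequentially" by (simp add: filterlim_sequentially_iff_filterlim_real)
    from filterlim_compose[OF e this]
    have "(\<lambda>n. real (N n) / real n * (e (N n) - e n)) \<longlonglongrightarrow> q * (euler_mascheroni - euler_mascheroni)"
      by (intro tendsto_mult r tendsto_diff e)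
    then show ?thesis by simp
  qed
  moreover have "(\<lambda>n. x_log_x (real (N n) / real n)) \<longlonglongrightarrow> x_log_x q"
    by (rule tendsto_x_log_x[OF r]) simp
  ultimately have "(\<lambda>n. x_log_x (real (N n) / real n) + real (N n) / real n * (e (N n) - e n)) \<longlonglongrightarrow> x_log_x q + 0"
    by (rule tendsto_add[rotated])
  then have lim: "(\<lambda>n. x_log_x (real (N n) / real n) + real (N n) / real n * (e (N n) - e n)) \<longlonglongrightarrow> x_log_x q"
    by simp
  show ?thesis
  proof (rule Lim_transform_eventually[OF lim])
    show "\<forall>\<^sub>F n in sequentially. x_log_x (real (N n) / real n) + real (N n) / real n * (e (N n) - e n) =
        real (N n) / real n * (harm (N n) - harm n)"
      using eventually_ge_at_top[of 1]
    proof eventually_elim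
      case (elim n)
      then show ?case
        by (cases "N n = 0") (simp_all add: x_log_x_def e_def ln_div algebra_simps diff_divide_distrib)
    qed
  qed
qed

section \<open>Truncation trees\<close>

text \<open>
  The sums \<open>Y\<^sub>k\<close> range over \<open>low_nodes k\<close>, but every summand involves all children of its node.  This
  is approximated with the finite trees \<open>wide_nodes k l\<close> as \<open>l \<rightarrow> \<infinity>\<close>.
\<close>

definition low_nodes :: "nat \<Rightarrow> nat list set" where
  "low_nodes k = {u \<in> nodes. sum_list u \<le> k}"

definition wide_nodes :: "nat \<Rightarrow> nat \<Rightarrow> nat list set" where
  "wide_nodes k l = low_nodes k \<union> {u @ [i] | u i. u \<in> low_nodes k \<and> 1 \<le> i \<and> i \<le> l}"

lemma finite_low_nodes: "finite (low_nodes k)"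
  unfolding low_nodes_def by (rule finite_nodes_sum_le)

lemma Nil_low_nodes: "[] \<in> low_nodes k"
  by (simp add: low_nodes_def nodes_def)

lemma low_nodes_prefix: "u @ v \<in> low_nodes k \<Longrightarrow> u \<in> low_nodes k"
  by (simp add: low_nodes_def nodes_def)

lemma low_nodes_mono: "j \<le> k \<Longrightarrow> low_nodes j \<subseteq> low_nodes k"
  by (auto simp: low_nodes_def)

lemma harris_low_nodes: "harris_tree (low_nodes k)"
  unfolding harris_tree_def
proof (intro conjI allI impI)
  show "low_nodes k \<noteq> {}" using Nil_low_nodes by auto
  show "u @ [j] \<in> low_nodes k" if "u @ [i] \<in> low_nodes k \<and> i > 1 \<and> 1 \<le> j \<and> j \<le> i - 1" for u i j
    using that by (auto simp: low_nodes_def nodes_def)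
qed (auto simp: finite_low_nodes low_nodes_prefix, simp add: low_nodes_def)

lemma finite_wide_nodes: "finite (wide_nodes k l)"
proof -
  have "{u @ [i] | u i. u \<in> low_nodes k \<and> 1 \<le> i \<and> i \<le> l} \<subseteq>
      (\<lambda>(u, i). u @ [i]) ` (low_nodes k \<times> {1..l})" by auto
  then show ?thesis unfolding wide_nodes_def
    using finite_low_nodes by (meson finite_SigmaI finite_UnI finite_atLeastAtMost finite_imageI finite_subset)
qed

lemma harris_wide_nodes: "harris_tree (wide_nodes k l)"
  unfolding harris_tree_def
proof (intro conjI allI impI)
  show "finite (wide_nodes k l)" by (rule finite_wide_nodes)
  show "wide_nodes k l \<noteq> {}" using Nil_low_nodes by (auto simp: wide_nodes_def)
  show "wide_nodes k l \<subseteq> nodes" by (auto simp: wide_nodes_def low_nodes_def nodes_def)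
  show "u \<in> wide_nodes k l" if uv: "u @ v \<in> wide_nodes k l" for u v
  proof (cases "u @ v \<in> low_nodes k")
    case True
    then show ?thesis using low_nodes_prefix by (auto simp: wide_nodes_def)
  next
    case False
    then obtain w i where w: "u @ v = w @ [i]" "w \<in> low_nodes k"
      using uv by (auto simp: wide_nodes_def)
    show ?thesis
    proof (cases "v = []")
      case True
      then show ?thesis using uv by simp
    next
      case False
      then obtain v' where "v = v' @ [i]" using w(1)
        by (metis append_butlast_last_id last_appendR last_snoc)
      then have "u @ v' \<in> low_nodes k" using w by simp
      then show ?thesis using low_nodes_prefix by (auto simp: wide_nodes_def)
    qed
  qed
  show "u @ [j] \<in> wide_nodes k l" if h: "u @ [i] \<in> wide_nodes k l \<and> i > 1 \<and> 1 \<le> j \<and> j \<le> i - 1" for u i j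
  proof (cases "u @ [i] \<in> low_nodes k")
    case True
    then have "u @ [j] \<in> low_nodes k" using h by (auto simp: low_nodes_def nodes_def)
    then show ?thesis by (simp add: wide_nodes_def)
  next
    case False
    then show ?thesis using h by (auto simp: wide_nodes_def)
  qed
qed

lemma deg_low_nodes:
  assumes "u \<in> low_nodes k"
  shows "deg (low_nodes k) u = k - sum_list u"
proof -
  have "{i. u @ [i] \<in> low_nodes k} = {1..k - sum_list u}"
    using assms by (auto simp: low_nodes_def nodes_def)
  then show ?thesis by (simp add: deg_def)
qed

lemma low_nodes_child_le: "u @ [i] \<in> low_nodes k \<Longrightarrow> 1 \<le> i \<and> i \<le> k"
  by (auto simp: low_nodes_def nodes_def)

lemma deg_wide_nodes:
  assumes "k \<le> l" "u \<in> wide_nodes k l"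
  shows "deg (wide_nodes k l) u = (if u \<in> low_nodes k then l else 0)"
proof -
  have "1 \<le> i \<and> i \<le> l \<and> u \<in> low_nodes k" if "u @ [i] \<in> low_nodes k" for i
    using low_nodes_child_le[OF that] low_nodes_prefix[OF that] assms(1) by simp
  then have "{i. u @ [i] \<in> wide_nodes k l} = (if u \<in> low_nodes k then {1..l} else {})"
    by (auto simp: wide_nodes_def)
  then show ?thesis by (simp add: deg_def)
qed

lemma sum_wide_nodes:
  assumes "k \<le> l"
  shows "(\<Sum>w\<in>wide_nodes k l. g w) = g [] + (\<Sum>u\<in>low_nodes k. \<Sum>i=1..l. g (u @ [i]) :: real)"
proof -
  have "wide_nodes k l = insert [] ((\<lambda>(u, i). u @ [i]) ` (low_nodes k \<times> {1..l}))" (is "_ = ?B")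
  proof
    show "wide_nodes k l \<subseteq> ?B"
    proof
      fix w assume w: "w \<in> wide_nodes k l"
      show "w \<in> ?B"
      proof (cases w rule: rev_cases)
        case (snoc u i)
        have "u \<in> low_nodes k \<and> 1 \<le> i \<and> i \<le> l"
          using w assms low_nodes_child_le[of u i k] low_nodes_prefix[of u "[i]" k]
          unfolding snoc by (auto simp: wide_nodes_def)
        then show ?thesis using snoc by force
      qed simp
    qed
    show "?B \<subseteq> wide_nodes k l" using Nil_low_nodes by (auto simp: wide_nodes_def)
  qed
  moreover have "inj_on (\<lambda>(u, i). u @ [i]) (low_nodes k \<times> {1..l})" by (auto simp: inj_on_def)
  moreover have "[] \<notin> (\<lambda>(u, i). u @ [i]) ` (low_nodes k \<times> {1..l})" by auto
  ultimately show ?thesis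
    using finite_low_nodes by (simp add: sum.reindex sum.cartesian_product case_prod_unfold)
qed

lemma finite_subset_low_nodes:
  assumes "finite A" "A \<subseteq> nodes"
  shows "\<exists>k. A \<subseteq> low_nodes k"
proof -
  have "sum_list u \<le> Max (insert 0 (sum_list ` A))" if "u \<in> A" for u
    using assms(1) that by (intro Max_ge) auto
  then show ?thesis using assms(2) by (auto simp: low_nodes_def)
qed

section \<open>Limits of the inner part\<close>

text \<open>
  Here \<open>p\<close> stands for the family of masses of the sets \<open>A\<^sub>u\<close> in the limit.
\<close>

definition residue :: "nat list set \<Rightarrow> (nat list \<Rightarrow> real) \<Rightarrow> nat list \<Rightarrow> real" where
  "residue F p u = p u - (\<Sum>i=1..deg F u. p (u @ [i]))"

definition entropy_part :: "nat list set \<Rightarrow> (nat list \<Rightarrow> real) \<Rightarrow> real" where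
  "entropy_part F p = (\<Sum>u\<in>F. x_log_x (residue F p u) + p u) - 1"

definition mass_limit :: "(nat \<Rightarrow> nat list set) \<Rightarrow> (nat list \<Rightarrow> real) \<Rightarrow> bool" where
  "mass_limit x p \<longleftrightarrow> (\<forall>n\<ge>1. harris_tree (x n) \<and> card (x n) = n) \<and>
     (\<forall>u\<in>nodes. (\<lambda>n. sub_size (x n) u / real n) \<longlonglongrightarrow> p u)"

lemma mass_limit_piece_size:
  assumes l: "mass_limit x p" and F: "harris_tree F" and u: "u \<in> F"
  shows "(\<lambda>n. real (piece_size F (x n) u) / real n) \<longlonglongrightarrow> residue F p u"
proof -
  have un: "u \<in> nodes" using u harris_nodes[OF F] by auto
  have child: "u @ [i] \<in> nodes" if "i \<in> {1..deg F u}" for i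
    using that harris_nodes[OF F] child_iff[OF F, of u i] by auto
  have "(\<lambda>n. sub_size (x n) u / real n - (\<Sum>i=1..deg F u. sub_size (x n) (u @ [i]) / real n))
      \<longlonglongrightarrow> residue F p u"
    unfolding residue_def using l un child
    by (intro tendsto_diff tendsto_sum) (auto simp: mass_limit_def)
  then show ?thesis
  proof (rule Lim_transform_eventually)
    show "\<forall>\<^sub>F n in sequentially. sub_size (x n) u / real n - (\<Sum>i=1..deg F u. sub_size (x n) (u @ [i]) / real n) =
        real (piece_size F (x n) u) / real n"
      using eventually_ge_at_top[of 1]
    proof eventually_elim
      case (elim n)
      then have "harris_tree (x n)" using l by (simp add: mass_limit_def)
      from piece_size_eq[OF F this u] show ?case by (simp add: diff_divide_distrib sum_divide_distrib)
    qed
  qed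
qed

lemma mass_limit_residue_nonneg:
  assumes "mass_limit x p" "harris_tree F" "u \<in> F"
  shows "0 \<le> residue F p u"
  using LIMSEQ_le_const[OF mass_limit_piece_size[OF assms], of 0] by auto

lemma mass_limit_Nil: "mass_limit x p \<Longrightarrow> p [] = 1"
proof -
  assume l: "mass_limit x p"
  then have "(\<lambda>n. sub_size (x n) [] / real n) \<longlonglongrightarrow> p []" by (simp add: mass_limit_def nodes_def)
  moreover have "(\<lambda>n. sub_size (x n) [] / real n) \<longlonglongrightarrow> 1"
  proof (rule Lim_transform_eventually[OF tendsto_const])
    show "\<forall>\<^sub>F n in sequentially. 1 = sub_size (x n) [] / real n"
      using eventually_ge_at_top[of 1] by eventually_elim (use l in \<open>simp add: mass_limit_def sub_size_Nil\<close>)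
  qed
  ultimately show ?thesis by (rule LIMSEQ_unique)
qed

lemma mass_limit_nonneg: "mass_limit x p \<Longrightarrow> u \<in> nodes \<Longrightarrow> 0 \<le> p u"
  using LIMSEQ_le_const[of "\<lambda>n. sub_size (x n) u / real n" "p u" 0]
  by (auto simp: mass_limit_def sub_size_def)

lemma mass_limit_inner_part:
  assumes l: "mass_limit x p" and F: "harris_tree F"
  shows "(\<lambda>n. inner_part F (x n)) \<longlonglongrightarrow> entropy_part F p - (\<Sum>u\<in>F. p u ^ 2)"
proof -
  have "(\<lambda>n. (\<Sum>u\<in>F. real (piece_size F (x n) u) / real n * (harm (piece_size F (x n) u) - harm n) +
      sub_size (x n) u / real n - (sub_size (x n) u / real n) ^ 2) - 1)
      \<longlonglongrightarrow> (\<Sum>u\<in>F. x_log_x (residue F p u) + p u - p u ^ 2) - 1"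
    using l harris_nodes[OF F] unfolding mass_limit_def
    by (intro tendsto_intros harm_entropy_limit mass_limit_piece_size[OF l F]) auto
  then have "(\<lambda>n. inner_part F (x n)) \<longlonglongrightarrow> (\<Sum>u\<in>F. x_log_x (residue F p u) + p u - p u ^ 2) - 1"
  proof (rule Lim_transform_eventually)
    show "\<forall>\<^sub>F n in sequentially. (\<Sum>u\<in>F. real (piece_size F (x n) u) / real n * (harm (piece_size F (x n) u) - harm n) +
      sub_size (x n) u / real n - (sub_size (x n) u / real n) ^ 2) - 1 = inner_part F (x n)"
      using eventually_ge_at_top[of 1]
      by eventually_elim (use l in \<open>simp add: mass_limit_def inner_part_def\<close>)
  qed
  then show ?thesis by (simp add: entropy_part_def sum_subtractf algebra_simps)
qed

definition C_partial :: "nat \<Rightarrow> (nat list \<Rightarrow> real) \<Rightarrow> nat list \<Rightarrow> real" where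
  "C_partial l p u = p u * (1 + (\<Sum>i=1..l. x_log_x (p (u @ [i]) / p u)))"

text \<open>
  The entropy sum telescopes when \<open>x ln x\<close> of the mass of a child is expressed by the mass relative
  to its parent.  The correction terms vanish with the residues.
\<close>

lemma entropy_part_wide_nodes:
  assumes l: "mass_limit x p" and kl: "k \<le> l"
  shows "entropy_part (wide_nodes k l) p = (\<Sum>u\<in>low_nodes k. C_partial l p u +
    (x_log_x (residue (wide_nodes k l) p u) - residue (wide_nodes k l) p u * (ln (p u) + 1)))"
proof -
  let ?F = "wide_nodes k l"
  let ?r = "residue ?F p"
  have LF: "low_nodes k \<subseteq> ?F" by (auto simp: wide_nodes_def)
  note F = harris_wide_nodes[of k l]
  have r_low: "?r u = p u - (\<Sum>i=1..l. p (u @ [i]))" if "u \<in> low_nodes k" for u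
    using that LF kl by (auto simp: residue_def deg_wide_nodes)
  have r_high: "?r u = p u" if "u \<in> ?F - low_nodes k" for u
    using that kl by (auto simp: residue_def deg_wide_nodes)
  have split: "(\<Sum>u\<in>?F. g u) = (\<Sum>u\<in>low_nodes k. g u) + (\<Sum>u\<in>?F - low_nodes k. g u)" for g :: "nat list \<Rightarrow> real"
    using sum.subset_diff[OF LF finite_wide_nodes] by (simp add: add.commute)
  have "(\<Sum>u\<in>?F. x_log_x (?r u)) =
      (\<Sum>u\<in>low_nodes k. x_log_x (?r u)) + (\<Sum>u\<in>?F - low_nodes k. x_log_x (p u))"
    unfolding split by (simp add: r_high)
  also have "(\<Sum>u\<in>?F - low_nodes k. x_log_x (p u)) =
      (\<Sum>u\<in>?F. x_log_x (p u)) - (\<Sum>u\<in>low_nodes k. x_log_x (p u))"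
    by (simp add: split)
  finally have "entropy_part ?F p = (\<Sum>u\<in>low_nodes k. x_log_x (?r u)) +
      (\<Sum>u\<in>?F. x_log_x (p u) + p u) - (\<Sum>u\<in>low_nodes k. x_log_x (p u)) - 1"
    by (simp add: entropy_part_def sum.distrib)
  also have "(\<Sum>u\<in>?F. x_log_x (p u) + p u) =
      1 + (\<Sum>u\<in>low_nodes k. \<Sum>i=1..l. x_log_x (p (u @ [i])) + p (u @ [i]))"
    by (simp add: sum_wide_nodes[OF kl] mass_limit_Nil[OF l])
  finally have "entropy_part ?F p = (\<Sum>u\<in>low_nodes k. x_log_x (?r u) +
      (\<Sum>i=1..l. x_log_x (p (u @ [i])) + p (u @ [i])) - x_log_x (p u))"
    by (simp add: sum.distrib sum_subtractf)
  also have "\<dots> = (\<Sum>u\<in>low_nodes k. C_partial l p u + (x_log_x (?r u) - ?r u * (ln (p u) + 1)))"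
  proof (rule sum.cong[OF refl])
    fix u assume u: "u \<in> low_nodes k"
    have un: "u @ [i] \<in> nodes" if "i \<in> {1..l}" for i
      using u that by (auto simp: low_nodes_def nodes_def)
    have le: "p (u @ [i]) \<le> p u" if i: "i \<in> {1..l}" for i
    proof -
      have "p (u @ [i]) \<le> (\<Sum>i=1..l. p (u @ [i]))"
        using i mass_limit_nonneg[OF l un] by (intro member_le_sum) auto
      also have "\<dots> \<le> p u"
        using mass_limit_residue_nonneg[OF l F, of u] LF u r_low[OF u] by auto
      finally show ?thesis .
    qed
    \<comment> \<open>If \<open>p u = 0\<close> then all children have mass \<open>0\<close> as well, and \<open>0 / 0 = 0\<close> is harmless.\<close>
    have "x_log_x (p (u @ [i])) = p u * x_log_x (p (u @ [i]) / p u) + p (u @ [i]) * ln (p u)"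
      if i: "i \<in> {1..l}" for i
    proof (cases "p (u @ [i]) = 0")
      case False
      then have pos: "p (u @ [i]) > 0" using mass_limit_nonneg[OF l un[OF i]] by simp
      then have "p u > 0" using le[OF i] by simp
      then show ?thesis using pos by (simp add: x_log_x_def ln_div algebra_simps)
    qed simp
    then have "(\<Sum>i=1..l. x_log_x (p (u @ [i]))) =
        p u * (\<Sum>i=1..l. x_log_x (p (u @ [i]) / p u)) + (p u - ?r u) * ln (p u)"
      by (simp add: sum.distrib r_low[OF u] flip: sum_distrib_left sum_distrib_right)
    then show "x_log_x (?r u) + (\<Sum>i=1..l. x_log_x (p (u @ [i])) + p (u @ [i])) - x_log_x (p u) =
        C_partial l p u + (x_log_x (?r u) - ?r u * (ln (p u) + 1))"
      by (simp add: sum.distrib C_partial_def r_low[OF u] x_log_x_def[of "p u"] algebra_simps)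
  qed
  finally show ?thesis .
qed

lemma C_partial_decreasing:
  assumes l: "mass_limit x p" and u: "u \<in> nodes"
  shows "decseq (\<lambda>l. C_partial l p u)" "C_partial l p u \<le> p u"
proof -
  have F: "u \<in> wide_nodes (sum_list u) j" for j
    using u by (simp add: wide_nodes_def low_nodes_def)
  have uc: "u @ [i] \<in> nodes" if "1 \<le> i" for i using u that by (auto simp: nodes_def)
  have le: "p (u @ [i]) \<le> p u" if i: "1 \<le> i" for i
  proof -
    define j where "j = max i (sum_list u)"
    have "residue (wide_nodes (sum_list u) j) p u = p u - (\<Sum>i=1..j. p (u @ [i]))"
      using deg_wide_nodes[of "sum_list u" j u] F u
      by (simp add: residue_def j_def low_nodes_def)
    then have "(\<Sum>i=1..j. p (u @ [i])) \<le> p u"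
      using mass_limit_residue_nonneg[OF l harris_wide_nodes F, of j] by simp
    moreover have "p (u @ [i]) \<le> (\<Sum>i=1..j. p (u @ [i]))"
      using i mass_limit_nonneg[OF l uc] by (intro member_le_sum) (auto simp: j_def)
    ultimately show ?thesis by simp
  qed
  have np: "x_log_x (p (u @ [i]) / p u) \<le> 0" if "1 \<le> i" for i
    using le[OF that] mass_limit_nonneg[OF l uc[OF that]]
    by (intro x_log_x_nonpos) (auto simp: divide_le_eq_1)
  have pu: "0 \<le> p u" by (rule mass_limit_nonneg[OF l u])
  show "decseq (\<lambda>l. C_partial l p u)"
    unfolding C_partial_def using np pu by (intro decseq_SucI mult_left_mono) auto
  have "(\<Sum>i=1..l. x_log_x (p (u @ [i]) / p u)) \<le> 0" using np by (intro sum_nonpos) auto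
  then show "C_partial l p u \<le> p u"
    unfolding C_partial_def using mult_left_mono[of _ 0, OF _ pu] by (simp add: distrib_left)
qed

lemma Y_partial_eq:
  assumes lim: "\<And>u. u \<in> low_nodes k \<Longrightarrow> (\<lambda>l. C_partial l (\<lambda>u. measure \<mu> (cyl u)) u) \<longlonglongrightarrow> c u"
  shows "Y_partial k \<mu> = ereal (\<Sum>u\<in>low_nodes k. c u)"
proof -
  let ?p = "\<lambda>u. measure \<mu> (cyl u)"
  have "ereal (?p u) * C_fun (rho \<mu> u) = ereal (c u)" if u: "u \<in> low_nodes k" for u
  proof (cases "?p u = 0")
    case True
    then have "(\<lambda>l. 0) \<longlonglongrightarrow> c u" using lim[OF u] by (simp add: C_partial_def)
    then have "c u = 0" by (simp add: LIMSEQ_const_iff)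
    then show ?thesis using True by (simp flip: zero_ereal_def)
  next
    case False
    then have pos: "?p u > 0" by (simp add: zero_less_measure_iff)
    have "(\<lambda>l. C_partial l ?p u / ?p u - 1) \<longlonglongrightarrow> c u / ?p u - 1"
      using lim[OF u] by (intro tendsto_intros) (use pos in auto)
    moreover have "(\<lambda>l. C_partial l ?p u / ?p u - 1) = (\<lambda>l. \<Sum>i<l. rho \<mu> u (Suc i) * ln (rho \<mu> u (Suc i)))"
    proof
      fix l
      have "(\<Sum>i=1..l. x_log_x (?p (u @ [i]) / ?p u)) = (\<Sum>i<l. x_log_x (?p (u @ [Suc i]) / ?p u))"
        by (simp add: sum.atLeast1_atMost_eq)
      then show "C_partial l ?p u / ?p u - 1 = (\<Sum>i<l. rho \<mu> u (Suc i) * ln (rho \<mu> u (Suc i)))"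
        using pos by (simp add: C_partial_def rho_def x_log_x_def)
    qed
    ultimately have "(\<lambda>i. rho \<mu> u (Suc i) * ln (rho \<mu> u (Suc i))) sums (c u / ?p u - 1)"
      by (simp add: sums_def)
    then have "(\<lambda>i. ereal (rho \<mu> u (Suc i) * ln (rho \<mu> u (Suc i)))) sums ereal (c u / ?p u - 1)"
      by (simp add: sums_ereal)
    then have "C_fun (rho \<mu> u) = 1 + ereal (c u / ?p u - 1)"
      unfolding C_fun_def by (simp add: sums_unique[symmetric])
    then have "C_fun (rho \<mu> u) = ereal (c u / ?p u)" by (simp add: one_ereal_def)
    then show ?thesis using pos by simp
  qed
  then have "Y_partial k \<mu> = (\<Sum>u\<in>low_nodes k. ereal (c u))"
    unfolding Y_partial_def low_nodes_def[symmetric] by (intro sum.cong refl)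
  then show ?thesis by simp
qed

lemma entropy_part_limit:
  assumes l: "mass_limit x p" and res: "\<And>u. u \<in> low_nodes k \<Longrightarrow> (\<lambda>l. \<Sum>i=1..l. p (u @ [i])) \<longlonglongrightarrow> p u"
  shows "(\<lambda>l. entropy_part (wide_nodes k l) p - (\<Sum>u\<in>low_nodes k. C_partial l p u)) \<longlonglongrightarrow> 0"
proof -
  let ?r = "\<lambda>l u. p u - (\<Sum>i=1..l. p (u @ [i]))"
  have r0: "(\<lambda>l. ?r l u) \<longlonglongrightarrow> 0" if "u \<in> low_nodes k" for u
    using tendsto_diff[OF tendsto_const res[OF that], of "p u"] by simp
  have r_eq: "residue (wide_nodes k l) p u = ?r l u" if "u \<in> low_nodes k" "k \<le> l" for u l
    using that deg_wide_nodes[of k l u] by (simp add: residue_def wide_nodes_def)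
  have nn: "0 \<le> ?r l u" if u: "u \<in> low_nodes k" for l u
  proof -
    have un: "u @ [i] \<in> nodes" if "i \<in> {1..max k l}" for i
      using u that by (auto simp: low_nodes_def nodes_def)
    have "0 \<le> ?r (max k l) u"
      using mass_limit_residue_nonneg[OF l harris_wide_nodes, of u k "max k l"] r_eq[OF u, of "max k l"] u
      by (simp add: wide_nodes_def)
    also have "\<dots> \<le> ?r l u"
      using mass_limit_nonneg[OF l un] by (intro diff_left_mono sum_mono2) auto
    finally show ?thesis .
  qed
  have "(\<lambda>l. \<Sum>u\<in>low_nodes k. x_log_x (?r l u) - ?r l u * (ln (p u) + 1)) \<longlonglongrightarrow>
      (\<Sum>u\<in>low_nodes k. x_log_x 0 - 0 * (ln (p u) + 1))"
    by (intro tendsto_sum tendsto_diff tendsto_mult tendsto_const r0 tendsto_x_log_x nn)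
  then have lim: "(\<lambda>l. \<Sum>u\<in>low_nodes k. x_log_x (?r l u) - ?r l u * (ln (p u) + 1)) \<longlonglongrightarrow> 0" by simp
  show ?thesis
  proof (rule Lim_transform_eventually[OF lim])
    show "\<forall>\<^sub>F l in sequentially. (\<Sum>u\<in>low_nodes k. x_log_x (?r l u) - ?r l u * (ln (p u) + 1)) =
        entropy_part (wide_nodes k l) p - (\<Sum>u\<in>low_nodes k. C_partial l p u)"
      using eventually_ge_at_top[of k]
      by eventually_elim (simp add: entropy_part_wide_nodes[OF l] sum.distrib r_eq)
  qed
qed

text \<open>
  The first equation also covers divergent sums, with their default value \<open>0\<close>; this is what makes
  \<open>W\<^sub>\<infinity>\<close> a measurable function.
\<close>

lemma infsum_eq_lim_low_nodes:
  fixes f :: "nat list \<Rightarrow> real"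
  assumes nonneg: "\<And>u. 0 \<le> f u"
  shows "(\<Sum>\<^sub>\<infinity>u\<in>nodes. f u) =
    (if \<exists>B::nat. \<forall>k. (\<Sum>u\<in>low_nodes k. f u) \<le> real B then lim (\<lambda>k. \<Sum>u\<in>low_nodes k. f u) else 0)"
    and "(\<forall>k. (\<Sum>u\<in>low_nodes k. f u) \<le> C) \<Longrightarrow>
      (\<lambda>k. \<Sum>u\<in>low_nodes k. f u) \<longlonglongrightarrow> (\<Sum>\<^sub>\<infinity>u\<in>nodes. f u)"
proof -
  let ?V = "\<lambda>k. \<Sum>u\<in>low_nodes k. f u"
  have sub: "low_nodes k \<subseteq> nodes" for k by (auto simp: low_nodes_def)
  have bounded: "f summable_on nodes" if B: "\<forall>k. ?V k \<le> B" for B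
  proof (rule nonneg_bdd_above_summable_on)
    show "bdd_above (sum f ` {F. F \<subseteq> nodes \<and> finite F})"
    proof (rule bdd_aboveI2[where M = B])
      fix F assume "F \<in> {F. F \<subseteq> nodes \<and> finite F}"
      then obtain k where "F \<subseteq> low_nodes k" using finite_subset_low_nodes by blast
      then have "sum f F \<le> ?V k" using nonneg finite_low_nodes by (intro sum_mono2) auto
      then show "sum f F \<le> B" using B by (meson order_trans)
    qed
  qed (rule nonneg)
  have conv: "?V \<longlonglongrightarrow> infsum f nodes" if "f summable_on nodes"
  proof -
    have "filterlim low_nodes (finite_subsets_at_top nodes) sequentially"
      unfolding filterlim_finite_subsets_at_top
    proof (intro allI impI)
      fix A assume "finite A \<and> A \<subseteq> nodes"
      then obtain k where "A \<subseteq> low_nodes k" using finite_subset_low_nodes by blast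
      then have "\<forall>\<^sub>F j in sequentially. A \<subseteq> low_nodes j"
        using low_nodes_mono unfolding eventually_sequentially by blast
      then show "\<forall>\<^sub>F j in sequentially. finite (low_nodes j) \<and> A \<subseteq> low_nodes j \<and> low_nodes j \<subseteq> nodes"
        using sub finite_low_nodes by simp
    qed
    with has_sum_infsum[OF that] show ?thesis
      unfolding has_sum_def by (rule filterlim_compose)
  qed
  show "?V \<longlonglongrightarrow> infsum f nodes" if "\<forall>k. ?V k \<le> C"
    by (rule conv[OF bounded[OF that]])
  show "infsum f nodes = (if \<exists>B::nat. \<forall>k. ?V k \<le> real B then lim ?V else 0)"
  proof (cases "\<exists>B::nat. \<forall>k. ?V k \<le> real B")
    case True
    then have "?V \<longlonglongrightarrow> infsum f nodes" using conv bounded by blast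
    then show ?thesis using True by (simp add: limI)
  next
    case False
    have "\<not> f summable_on nodes"
    proof
      assume s: "f summable_on nodes"
      have "?V k \<le> infsum f nodes" for k
        using s finite_low_nodes sub nonneg by (intro finite_sum_le_infsum) auto
      moreover obtain B :: nat where "infsum f nodes \<le> real B" using real_arch_simple by blast
      ultimately show False using False by (meson order_trans)
    qed
    then show ?thesis unfolding if_not_P[OF False] by (rule infsum_not_exists)
  qed
qed

lemma tendsto_L1:
  assumes "tendsto_Lp M 1 f g"
  shows "integrable M (f n)" "integrable M g" "(\<lambda>n. \<integral>\<omega>. \<bar>f n \<omega> - g \<omega>\<bar> \<partial>M) \<longlonglongrightarrow> 0"
proof -
  have 1: "f n \<in> borel_measurable M" "integrable M (\<lambda>\<omega>. \<bar>f n \<omega>\<bar>)" for n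
    using assms by (simp_all add: tendsto_Lp_def)
  have 2: "g \<in> borel_measurable M" "integrable M (\<lambda>\<omega>. \<bar>g \<omega>\<bar>)"
    using assms by (simp_all add: tendsto_Lp_def)
  show "integrable M (f n)" "integrable M g"
    using integrable_norm_cancel[of M "f n"] integrable_norm_cancel[of M g] 1[of n] 2 by simp_all
  show "(\<lambda>n. \<integral>\<omega>. \<bar>f n \<omega> - g \<omega>\<bar> \<partial>M) \<longlonglongrightarrow> 0"
    using assms by (simp add: tendsto_Lp_def)
qed

section \<open>The limit of the chain\<close>

locale harris_limit = harris_process M X
  for M :: "'w measure" and X :: "nat \<Rightarrow> 'w \<Rightarrow> nat list set" +
  fixes Xinf :: "'w \<Rightarrow> bar_node measure"
  assumes doob: "doob_martin_limit M X Xinf"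
begin

definition mass :: "'w \<Rightarrow> nat list \<Rightarrow> real" where
  "mass \<omega> u = measure (Xinf \<omega>) (cyl u)"

definition decay :: "nat \<Rightarrow> real" where
  "decay k = sqrt ((4/5) ^ k)"

lemma decay_pos: "decay k > 0" and decay_sq: "decay k * decay k = (4/5) ^ k"
  and pow_le_decay: "(4/5) ^ k \<le> decay k" and decay_0: "decay \<longlonglongrightarrow> 0"
proof -
  show "decay k > 0" "decay k * decay k = (4/5) ^ k" by (simp_all add: decay_def)
  have "sqrt ((4/5) ^ k) * sqrt ((4/5) ^ k) \<le> 1 * sqrt ((4/5 :: real) ^ k)"
    by (intro mult_right_mono) (auto simp: power_le_one)
  then show "(4/5) ^ k \<le> decay k" by (simp add: decay_def)
  have "(\<lambda>k. sqrt ((4/5 :: real) ^ k)) \<longlonglongrightarrow> sqrt 0"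
    by (intro tendsto_real_sqrt LIMSEQ_power_zero) auto
  then show "decay \<longlonglongrightarrow> 0" by (simp add: decay_def[abs_def])
qed

lemma mass_nonneg: "0 \<le> mass \<omega> u"
  by (simp add: mass_def)

lemma measurable_mass [measurable]: "u \<in> nodes \<Longrightarrow> (\<lambda>\<omega>. mass \<omega> u) \<in> borel_measurable M"
proof -
  assume u: "u \<in> nodes"
  have "cyl ` nodes \<subseteq> Pow bar_nodes" by (auto simp: cyl_def)
  then have "cyl u \<in> sets bar_space"
    unfolding bar_space_def using u by (simp add: sigma_sets.Basic)
  from measurable_compose[OF _ measurable_measure_prob_algebra[OF this]] doob
  show ?thesis unfolding mass_def doob_martin_limit_def by blast
qed

lemma low_nodes_subset: "u \<in> low_nodes k \<Longrightarrow> u \<in> nodes"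
  by (simp add: low_nodes_def)

lemma AE_mass_limit: "AE \<omega> in M. mass_limit (\<lambda>n. X n \<omega>) (mass \<omega>)"
proof -
  have "AE \<omega> in M. \<forall>u\<in>nodes.
      (\<lambda>n. real (card (subtree (X n \<omega>) u)) / real n) \<longlonglongrightarrow> measure (Xinf \<omega>) (cyl u)"
    using doob by (simp add: doob_martin_limit_def)
  with AE_space show ?thesis
  proof eventually_elim
    case (elim \<omega>)
    have "(\<lambda>n. sub_size (X n \<omega>) u / real n) \<longlonglongrightarrow> mass \<omega> u" if u: "u \<in> nodes" for u
    proof (rule Lim_transform_eventually)
      show "(\<lambda>n. real (card (subtree (X n \<omega>) u)) / real n) \<longlonglongrightarrow> mass \<omega> u"
        using elim u by (simp add: mass_def)
      show "\<forall>\<^sub>F n in sequentially. real (card (subtree (X n \<omega>) u)) / real n = sub_size (X n \<omega>) u / real n"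
        using eventually_ge_at_top[of 1]
        by eventually_elim (use X_harris elim(1) in \<open>simp add: card_subtree\<close>)
    qed
    then show ?case using X_harris X_card elim(1) by (simp add: mass_limit_def)
  qed
qed

lemma card_over_square: "(\<lambda>n. c / real (Suc n) ^ 2) \<longlonglongrightarrow> 0"
  by real_asymp

lemma nn_integral_residue:
  assumes F: "harris_tree F" and k: "low_nodes k \<subseteq> F" and u: "u \<in> F"
  shows "(\<integral>\<^sup>+\<omega>. ennreal (residue F (mass \<omega>) u ^ 2) \<partial>M) \<le> ennreal (15 * (4/5) ^ k)"
proof (rule integral_limit_le)
  let ?f = "\<lambda>n \<omega>. (real (piece_size F (X (Suc n) \<omega>) u) / real (Suc n)) ^ 2"
  show "integrable M (?f n)" for n by (rule integrable_X) simp
  show "AE \<omega> in M. (\<lambda>n. ?f n \<omega>) \<longlonglongrightarrow> residue F (mass \<omega>) u ^ 2"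
    using AE_mass_limit
    by eventually_elim (intro tendsto_power LIMSEQ_Suc[OF mass_limit_piece_size[OF _ F u]])
  show "(\<integral>\<omega>. ?f n \<omega> \<partial>M) \<le> 2 * real (card F) / real (Suc n) ^ 2 + 15 * (4/5) ^ k" for n
    using mean_piece_size[OF F k[unfolded low_nodes_def] _ u, of "Suc n"] by (simp add: mean_def)
  show "(\<lambda>n. 2 * real (card F) / real (Suc n) ^ 2 + 15 * (4/5) ^ k) \<longlonglongrightarrow> 15 * (4/5) ^ k"
    using tendsto_add[OF card_over_square tendsto_const] by simp
qed simp

text \<open>
  A priori the limit measure may charge the ends \<open>(u, \<infinity>, \<infinity>, \<dots>)\<close>, or the nodes themselves.  The
  missing mass is bounded by residues, whose second moments decay geometrically.
\<close>

lemma AE_children_mass: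
  "AE \<omega> in M. \<forall>u\<in>nodes. (\<lambda>l. \<Sum>i=1..l. mass \<omega> (u @ [i])) \<longlonglongrightarrow> mass \<omega> u"
proof -
  have "AE \<omega> in M. (\<lambda>l. \<Sum>i=1..l. mass \<omega> (u @ [i])) \<longlonglongrightarrow> mass \<omega> u" if u: "u \<in> nodes" for u
  proof -
    have child: "u @ [i] \<in> nodes" if "i \<ge> 1" for i using u that by (simp add: nodes_def)
    let ?s = "\<lambda>\<omega> l. mass \<omega> u - (\<Sum>i=1..l. mass \<omega> (u @ [i]))"
    have meas [measurable]: "(\<lambda>\<omega>. ?s \<omega> l) \<in> borel_measurable M" for l
      using u child by (intro borel_measurable_diff borel_measurable_sum measurable_mass) auto
    have in_low: "u \<in> low_nodes (l + sum_list u)" for l using u by (simp add: low_nodes_def)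
    have res: "residue (low_nodes (l + sum_list u)) (mass \<omega>) u = ?s \<omega> l" for \<omega> l
      by (simp add: residue_def deg_low_nodes[OF in_low])
    have conv: "AE \<omega> in M. (\<lambda>l. ?s \<omega> l) \<longlonglongrightarrow> lim (\<lambda>l. ?s \<omega> l)"
      using AE_mass_limit
    proof eventually_elim
      case (elim \<omega>)
      have "decseq (\<lambda>l. ?s \<omega> l)" by (rule decseq_SucI) (simp add: mass_nonneg)
      moreover have "0 \<le> ?s \<omega> l" for l
        using mass_limit_residue_nonneg[OF elim harris_low_nodes in_low[of l]] by (simp add: res)
      ultimately have "convergent (\<lambda>l. ?s \<omega> l)"
        using decseq_convergent[of "\<lambda>l. ?s \<omega> l" 0] by (metis convergent_def)
      then show ?case by (simp add: convergent_LIMSEQ_iff)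
    qed
    have "(\<integral>\<^sup>+\<omega>. ennreal (lim (\<lambda>l. ?s \<omega> l) ^ 2) \<partial>M) \<le> ennreal 0"
    proof (rule nn_integral_limit_le[where f = "\<lambda>l \<omega>. ?s \<omega> l ^ 2" and c = "\<lambda>l. 15 * (4/5) ^ l"])
      show "AE \<omega> in M. (\<lambda>l. ?s \<omega> l ^ 2) \<longlonglongrightarrow> lim (\<lambda>l. ?s \<omega> l) ^ 2"
        using conv by eventually_elim (rule tendsto_power)
      have "(\<integral>\<^sup>+\<omega>. ennreal (?s \<omega> l ^ 2) \<partial>M) \<le> ennreal (15 * (4/5) ^ l)" for l
      proof -
        have "low_nodes l \<subseteq> low_nodes (l + sum_list u)" by (rule low_nodes_mono) simp
        from nn_integral_residue[OF harris_low_nodes this in_low] show ?thesis by (simp add: res)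
      qed
      then show "\<forall>\<^sub>F l in sequentially. (\<integral>\<^sup>+\<omega>. ennreal (?s \<omega> l ^ 2) \<partial>M) \<le> ennreal (15 * (4/5) ^ l)"
        by simp
      have "(\<lambda>l. 15 * (4/5 :: real) ^ l) \<longlonglongrightarrow> 15 * 0"
        by (intro tendsto_mult tendsto_const LIMSEQ_power_zero) auto
      then show "(\<lambda>l. 15 * (4/5 :: real) ^ l) \<longlonglongrightarrow> 0" by simp
    qed measurable
    then have "(\<integral>\<^sup>+\<omega>. ennreal (lim (\<lambda>l. ?s \<omega> l) ^ 2) \<partial>M) = 0" by simp
    then have "AE \<omega> in M. ennreal (lim (\<lambda>l. ?s \<omega> l) ^ 2) = 0"
      by (subst (asm) nn_integral_0_iff_AE) measurable
    with conv show ?thesis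
    proof eventually_elim
      case (elim \<omega>)
      then have "(\<lambda>l. mass \<omega> u - (\<Sum>i=1..l. mass \<omega> (u @ [i]))) \<longlonglongrightarrow> 0" by simp
      from tendsto_diff[OF tendsto_const[of "mass \<omega> u"] this] show ?case by simp
    qed
  qed
  moreover have "countable nodes" by (rule countableI_type)
  ultimately show ?thesis by (simp add: AE_ball_countable)
qed

lemma nn_integral_squares_tail:
  assumes "k \<le> K"
  shows "(\<integral>\<^sup>+\<omega>. ennreal (\<Sum>u\<in>low_nodes K - low_nodes k. mass \<omega> u ^ 2) \<partial>M) \<le> ennreal (15 * (4/5) ^ k)"
proof (rule integral_limit_le)
  let ?D = "low_nodes K - low_nodes k"
  let ?f = "\<lambda>n \<omega>. \<Sum>u\<in>?D. (sub_size (X (Suc n) \<omega>) u / real (Suc n)) ^ 2"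
  show "integrable M (?f n)" for n by (rule integrable_X) simp
  show "AE \<omega> in M. (\<lambda>n. ?f n \<omega>) \<longlonglongrightarrow> (\<Sum>u\<in>?D. mass \<omega> u ^ 2)"
    using AE_mass_limit
  proof eventually_elim
    case (elim \<omega>)
    then show ?case
      by (intro tendsto_sum tendsto_power LIMSEQ_Suc[where f = "\<lambda>n. sub_size (X n \<omega>) _ / real n"])
        (auto simp: mass_limit_def low_nodes_def)
  qed
  show "(\<integral>\<omega>. ?f n \<omega> \<partial>M) \<le> 15 * (4/5) ^ k" for n
  proof -
    have "mean (Suc n) (\<lambda>x. \<Sum>u\<in>?D. (sub_size x u / real (Suc n)) ^ 2) \<le>
        mean (Suc n) (\<lambda>x. outer (low_nodes k) x / real (Suc n) ^ 2)"
    proof (rule mean_mono)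
      fix x assume x: "harris_tree x"
      have "(\<Sum>u\<in>?D. sub_size x u ^ 2) = (\<Sum>u\<in>?D \<inter> x. sub_size x u ^ 2)"
        using finite_low_nodes sub_size_eq_0[OF x] by (intro sum.mono_neutral_right) auto
      also have "\<dots> \<le> (\<Sum>u\<in>x - low_nodes k. sub_size x u ^ 2)"
        using harris_finite[OF x] by (intro sum_mono2) auto
      also have "\<dots> \<le> outer (low_nodes k) x" by (rule outer_sub_size[OF x Nil_low_nodes])
      finally show "(\<Sum>u\<in>?D. (sub_size x u / real (Suc n)) ^ 2) \<le> outer (low_nodes k) x / real (Suc n) ^ 2"
        unfolding power_divide sum_divide_distrib[symmetric] by (rule divide_right_mono) simp
    qed simp
    also have "\<dots> \<le> 15 * real (Suc n) ^ 2 * (4/5) ^ k / real (Suc n) ^ 2"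
      unfolding mean_divide by (intro divide_right_mono mean_outer) (auto simp: low_nodes_def)
    finally show ?thesis by (simp add: mean_def)
  qed
qed (auto intro: sum_nonneg)

definition square_mass :: "nat \<Rightarrow> 'w \<Rightarrow> real" where
  "square_mass k \<omega> = (\<Sum>u\<in>low_nodes k. mass \<omega> u ^ 2)"

lemma measurable_square_mass [measurable]: "square_mass k \<in> borel_measurable M"
  unfolding square_mass_def[abs_def]
  by (intro borel_measurable_sum borel_measurable_power measurable_mass low_nodes_subset)

lemma square_mass_mono: "j \<le> k \<Longrightarrow> square_mass j \<omega> \<le> square_mass k \<omega>"
  unfolding square_mass_def using low_nodes_mono finite_low_nodes by (intro sum_mono2) auto

lemma square_mass_diff:
  "k \<le> K \<Longrightarrow> square_mass K \<omega> - square_mass k \<omega> = (\<Sum>u\<in>low_nodes K - low_nodes k. mass \<omega> u ^ 2)"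
  unfolding square_mass_def using low_nodes_mono finite_low_nodes by (subst sum_diff) auto

abbreviation W :: "'w \<Rightarrow> real" where "W \<omega> \<equiv> W_inf (Xinf \<omega>)"

abbreviation wide_entropy :: "nat \<Rightarrow> nat \<Rightarrow> 'w \<Rightarrow> real" where
  "wide_entropy k l \<omega> \<equiv> entropy_part (wide_nodes k l) (mass \<omega>)"

lemma measurable_W [measurable]: "W \<in> borel_measurable M"
proof -
  have "W = (\<lambda>\<omega>. if \<exists>B::nat. \<forall>k. square_mass k \<omega> \<le> real B then lim (\<lambda>k. square_mass k \<omega>) else 0)"
    unfolding W_inf_def square_mass_def mass_def
    by (rule ext, rule infsum_eq_lim_low_nodes(1)) simp
  moreover have "\<dots> \<in> borel_measurable M" by measurable
  ultimately show ?thesis by simp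
qed

lemma AE_square_mass_tendsto: "AE \<omega> in M. (\<lambda>k. square_mass k \<omega>) \<longlonglongrightarrow> W \<omega>"
proof -
  let ?d = "\<lambda>K \<omega>. square_mass K \<omega> - square_mass 0 \<omega>"
  have "(\<integral>\<^sup>+\<omega>. (SUP K. ennreal (?d K \<omega>)) \<partial>M) = (SUP K. (\<integral>\<^sup>+\<omega>. ennreal (?d K \<omega>) \<partial>M))"
    by (intro nn_integral_monotone_convergence_SUP)
      (auto simp: incseq_def le_fun_def intro!: ennreal_leI square_mass_mono)
  also have "\<dots> \<le> ennreal (15 * (4/5) ^ 0)"
  proof (rule SUP_least)
    fix K :: nat
    show "(\<integral>\<^sup>+\<omega>. ennreal (?d K \<omega>) \<partial>M) \<le> ennreal (15 * (4/5) ^ 0)"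
      using nn_integral_squares_tail[of 0 K] by (simp only: square_mass_diff[of 0 K] le0)
  qed
  also have "\<dots> < \<infinity>" by simp
  finally have fin: "(\<integral>\<^sup>+\<omega>. (SUP K. ennreal (?d K \<omega>)) \<partial>M) < \<infinity>" .
  have "AE \<omega> in M. (SUP K. ennreal (?d K \<omega>)) \<noteq> \<infinity>"
  proof (rule nn_integral_PInf_AE)
    show "(\<lambda>\<omega>. SUP K. ennreal (?d K \<omega>)) \<in> borel_measurable M" by measurable
  qed (use fin in simp)
  then show ?thesis
  proof eventually_elim
    case (elim \<omega>)
    then obtain r where r: "r \<ge> 0" "(SUP K. ennreal (?d K \<omega>)) = ennreal r"
      by (cases "SUP K. ennreal (?d K \<omega>)") auto
    have "?d K \<omega> \<le> r" for K
    proof -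
      have "ennreal (?d K \<omega>) \<le> (SUP K. ennreal (?d K \<omega>))" by (rule SUP_upper) simp
      then show ?thesis using r by simp
    qed
    then have "\<forall>K. (\<Sum>u\<in>low_nodes K. mass \<omega> u ^ 2) \<le> r + square_mass 0 \<omega>"
      by (auto simp: square_mass_def algebra_simps)
    from infsum_eq_lim_low_nodes(2)[OF _ this] show ?case
      by (simp add: W_inf_def square_mass_def mass_def)
  qed
qed

lemma AE_square_mass_le_W: "AE \<omega> in M. \<forall>k. square_mass k \<omega> \<le> W \<omega>"
  using AE_square_mass_tendsto
proof eventually_elim
  case (elim \<omega>)
  show ?case
  proof
    fix k
    show "square_mass k \<omega> \<le> W \<omega>"
      using LIMSEQ_le_const[OF elim, of "square_mass k \<omega>"] square_mass_mono by blast
  qed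
qed

lemma nn_integral_W_tail: "(\<integral>\<^sup>+\<omega>. ennreal (W \<omega> - square_mass k \<omega>) \<partial>M) \<le> ennreal (15 * (4/5) ^ k)"
proof (rule nn_integral_limit_le[where f = "\<lambda>K \<omega>. square_mass K \<omega> - square_mass k \<omega>"])
  show "AE \<omega> in M. (\<lambda>K. square_mass K \<omega> - square_mass k \<omega>) \<longlonglongrightarrow> W \<omega> - square_mass k \<omega>"
    using AE_square_mass_tendsto by eventually_elim (intro tendsto_diff tendsto_const)
  show "\<forall>\<^sub>F K in sequentially. (\<integral>\<^sup>+\<omega>. ennreal (square_mass K \<omega> - square_mass k \<omega>) \<partial>M) \<le> ennreal (15 * (4/5) ^ k)"
    using eventually_ge_at_top[of k]
    by eventually_elim (use nn_integral_squares_tail in \<open>simp add: square_mass_diff\<close>)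
qed auto

definition wiener_limit :: "'w \<Rightarrow> real" where
  "wiener_limit \<omega> = lim (\<lambda>n. rescaled_wiener X n \<omega>)"

lemma measurable_wiener_limit [measurable]: "wiener_limit \<in> borel_measurable M"
  unfolding wiener_limit_def[abs_def]
  by (intro borel_measurable_lim_metric measurable_rescaled_wiener)

lemma AE_wiener_limit: "AE \<omega> in M. (\<lambda>n. rescaled_wiener X n \<omega>) \<longlonglongrightarrow> wiener_limit \<omega>"
  using AE_convergent_rescaled_wiener
  by eventually_elim (simp add: wiener_limit_def convergent_LIMSEQ_iff)

lemma measurable_entropy_part:
  assumes F: "harris_tree F"
  shows "(\<lambda>\<omega>. entropy_part F (mass \<omega>)) \<in> borel_measurable M"
proof -
  have [measurable]: "(\<lambda>\<omega>. mass \<omega> u) \<in> borel_measurable M" if "u \<in> F" for u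
    using that harris_nodes[OF F] by (intro measurable_mass) auto
  have [measurable]: "(\<lambda>\<omega>. residue F (mass \<omega>) u) \<in> borel_measurable M" if u: "u \<in> F" for u
    unfolding residue_def using u child_iff[OF F, of u] harris_nodes[OF F]
    by (intro borel_measurable_diff borel_measurable_sum measurable_mass) auto
  show ?thesis
    unfolding entropy_part_def x_log_x_def
    by (intro borel_measurable_diff borel_measurable_sum borel_measurable_add) measurable
qed

lemma nn_integral_inner_part:
  assumes F: "harris_tree F" and k: "low_nodes k \<subseteq> F"
  shows "(\<integral>\<^sup>+\<omega>. ennreal \<bar>wiener_limit \<omega> - (entropy_part F (mass \<omega>) - (\<Sum>u\<in>F. mass \<omega> u ^ 2))\<bar> \<partial>M)
    \<le> ennreal (20 * decay k)"
proof -
  let ?s = "decay k" and ?q = "(4/5 :: real) ^ k"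
  let ?f = "\<lambda>n \<omega>. \<bar>rescaled_wiener X (Suc n) \<omega> - inner_part F (X (Suc n) \<omega>)\<bar>"
  let ?c = "\<lambda>n. (?s + (real (card F) / real (Suc n) ^ 2 + 15/2 * ?q) / ?s) / 2 + 15 * ?q"
  have "(\<integral>\<^sup>+\<omega>. ennreal \<bar>wiener_limit \<omega> - (entropy_part F (mass \<omega>) - (\<Sum>u\<in>F. mass \<omega> u ^ 2))\<bar> \<partial>M)
    \<le> ennreal ((?s + (0 + 15/2 * ?q) / ?s) / 2 + 15 * ?q)"
  proof (rule integral_limit_le[where f = ?f and c = ?c])
    show "integrable M (?f n)" for n
      unfolding rescaled_wiener_def by (rule integrable_X) simp
    show "AE \<omega> in M. (\<lambda>n. ?f n \<omega>) \<longlonglongrightarrow>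
        \<bar>wiener_limit \<omega> - (entropy_part F (mass \<omega>) - (\<Sum>u\<in>F. mass \<omega> u ^ 2))\<bar>"
      using AE_wiener_limit AE_mass_limit
      by eventually_elim
        (intro tendsto_rabs tendsto_diff[where f = "\<lambda>n. rescaled_wiener X (Suc n) _"]
          LIMSEQ_Suc[OF mass_limit_inner_part[OF _ F]] LIMSEQ_Suc)
    show "(\<integral>\<omega>. ?f n \<omega> \<partial>M) \<le> ?c n" for n
      using mean_inner_part[OF F k[unfolded low_nodes_def] _ decay_pos, of "Suc n" k]
      by (simp add: mean_def rescaled_wiener_def)
    show "?c \<longlonglongrightarrow> (?s + (0 + 15/2 * ?q) / ?s) / 2 + 15 * ?q"
      by (intro tendsto_intros card_over_square) (use decay_pos[of k] in auto)
  qed simp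
  also have "(?s + (0 + 15/2 * ?q) / ?s) / 2 + 15 * ?q \<le> 20 * decay k"
  proof -
    have "?q / ?s = ?s" using decay_pos[of k] by (simp add: decay_sq[symmetric])
    then have "(?s + (0 + 15/2 * ?q) / ?s) / 2 = 17/4 * ?s" by simp
    then show ?thesis using pow_le_decay[of k] decay_pos[of k] by linarith
  qed
  finally show ?thesis by (simp add: ennreal_leI)
qed

text \<open>
  Replacing the squares of the masses in the finite tree by \<open>W\<^sub>\<infinity>\<close> costs no more than the tail of
  \<open>W\<^sub>\<infinity>\<close> outside \<open>low_nodes k\<close>.
\<close>

lemma nn_integral_entropy_part:
  assumes kl: "k \<le> l"
  shows "(\<integral>\<^sup>+\<omega>. ennreal \<bar>wiener_limit \<omega> + W \<omega> - wide_entropy k l \<omega>\<bar> \<partial>M)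
    \<le> ennreal (35 * decay k)"
proof -
  let ?F = "wide_nodes k l"
  note F = harris_wide_nodes[of k l]
  have LF: "low_nodes k \<subseteq> ?F" by (auto simp: wide_nodes_def)
  have FL: "?F \<subseteq> low_nodes (k + l)" by (auto simp: wide_nodes_def low_nodes_def nodes_def)
  let ?V = "\<lambda>\<omega>. \<Sum>u\<in>?F. mass \<omega> u ^ 2"
  have [measurable]: "(\<lambda>\<omega>. entropy_part ?F (mass \<omega>)) \<in> borel_measurable M"
    by (rule measurable_entropy_part[OF F])
  have [measurable]: "?V \<in> borel_measurable M"
    using harris_nodes[OF F] by (intro borel_measurable_sum borel_measurable_power measurable_mass) auto
  have "(\<integral>\<^sup>+\<omega>. ennreal \<bar>wiener_limit \<omega> + W \<omega> - entropy_part ?F (mass \<omega>)\<bar> \<partial>M) \<le>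
      (\<integral>\<^sup>+\<omega>. ennreal \<bar>wiener_limit \<omega> - (entropy_part ?F (mass \<omega>) - ?V \<omega>)\<bar> +
        ennreal (W \<omega> - square_mass k \<omega>) \<partial>M)"
  proof (rule nn_integral_mono_AE)
    show "AE \<omega> in M. ennreal \<bar>wiener_limit \<omega> + W \<omega> - entropy_part ?F (mass \<omega>)\<bar> \<le>
        ennreal \<bar>wiener_limit \<omega> - (entropy_part ?F (mass \<omega>) - ?V \<omega>)\<bar> + ennreal (W \<omega> - square_mass k \<omega>)"
      using AE_square_mass_le_W
    proof eventually_elim
      case (elim \<omega>)
      have "square_mass k \<omega> \<le> ?V \<omega>"
        unfolding square_mass_def using LF finite_wide_nodes by (intro sum_mono2) auto
      moreover have "?V \<omega> \<le> square_mass (k + l) \<omega>"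
        unfolding square_mass_def using FL finite_low_nodes by (intro sum_mono2) auto
      moreover have "square_mass (k + l) \<omega> \<le> W \<omega>" "square_mass k \<omega> \<le> W \<omega>" using elim by auto
      ultimately have "\<bar>wiener_limit \<omega> + W \<omega> - entropy_part ?F (mass \<omega>)\<bar> \<le>
          \<bar>wiener_limit \<omega> - (entropy_part ?F (mass \<omega>) - ?V \<omega>)\<bar> + (W \<omega> - square_mass k \<omega>)"
        by linarith
      from ennreal_leI[OF this] show ?case
        using \<open>square_mass k \<omega> \<le> W \<omega>\<close> by (subst (asm) ennreal_plus) auto
    qed
  qed
  also have "\<dots> = (\<integral>\<^sup>+\<omega>. ennreal \<bar>wiener_limit \<omega> - (entropy_part ?F (mass \<omega>) - ?V \<omega>)\<bar> \<partial>M) +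
        (\<integral>\<^sup>+\<omega>. ennreal (W \<omega> - square_mass k \<omega>) \<partial>M)"
    by (intro nn_integral_add) measurable
  also have "\<dots> \<le> ennreal (20 * decay k) + ennreal (15 * (4/5) ^ k)"
    by (intro add_mono nn_integral_inner_part F LF nn_integral_W_tail)
  also have "\<dots> = ennreal (20 * decay k + 15 * (4/5) ^ k)"
    using decay_pos[of k] by (intro ennreal_plus[symmetric]) auto
  also have "\<dots> \<le> ennreal (35 * decay k)"
    using pow_le_decay[of k] by (intro ennreal_leI) linarith
  finally show ?thesis .
qed

text \<open>
  This is the almost sure finiteness of \<open>C(\<rho>(X\<^sub>\<infinity>, u))\<close>.  The partial sums decrease in \<open>l\<close>; if one of
  them tended to \<open>- \<infinity>\<close> then so would the entropy sums, whose distance from \<open>R + W\<^sub>\<infinity>\<close> is bounded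
  in the mean.
\<close>

lemma AE_C_partial_convergent:
  "AE \<omega> in M. \<forall>u\<in>low_nodes k. convergent (\<lambda>l. C_partial l (mass \<omega>) u)"
proof -
  let ?G = "\<lambda>l. wide_entropy k (k + l)"
  let ?f = "\<lambda>l \<omega>. \<bar>wiener_limit \<omega> + W \<omega> - ?G l \<omega>\<bar>"
  have [measurable]: "?G l \<in> borel_measurable M" for l
    by (rule measurable_entropy_part[OF harris_wide_nodes])
  have "(\<integral>\<^sup>+\<omega>. liminf (\<lambda>l. ennreal (?f l \<omega>)) \<partial>M) \<le> liminf (\<lambda>l. (\<integral>\<^sup>+\<omega>. ennreal (?f l \<omega>) \<partial>M))"
    by (intro nn_integral_liminf) measurable
  also have "\<dots> \<le> liminf (\<lambda>l. ennreal (35 * decay k))"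
    by (intro Liminf_mono always_eventually allI nn_integral_entropy_part) simp
  also have "\<dots> < \<infinity>" by (simp add: Liminf_const)
  finally have fin: "(\<integral>\<^sup>+\<omega>. liminf (\<lambda>l. ennreal (?f l \<omega>)) \<partial>M) < \<infinity>" .
  have "AE \<omega> in M. liminf (\<lambda>l. ennreal (?f l \<omega>)) \<noteq> \<infinity>"
  proof (rule nn_integral_PInf_AE)
    show "(\<lambda>\<omega>. liminf (\<lambda>l. ennreal (?f l \<omega>))) \<in> borel_measurable M" by measurable
  qed (use fin in simp)
  with AE_mass_limit AE_children_mass show ?thesis
  proof eventually_elim
    case (elim \<omega>)
    let ?p = "mass \<omega>"
    let ?S = "\<lambda>l. \<Sum>u\<in>low_nodes k. C_partial l ?p u"
    obtain r where r: "r \<ge> 0" "liminf (\<lambda>l. ennreal (?f l \<omega>)) = ennreal r"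
      using elim(3) by (cases "liminf (\<lambda>l. ennreal (?f l \<omega>))") auto
    have "\<not> (\<forall>\<^sub>F l in sequentially. ennreal (r + 1) \<le> ennreal (?f l \<omega>))"
    proof
      assume "\<forall>\<^sub>F l in sequentially. ennreal (r + 1) \<le> ennreal (?f l \<omega>)"
      then have "ennreal (r + 1) \<le> liminf (\<lambda>l. ennreal (?f l \<omega>))" by (rule Liminf_bounded)
      then show False using r by simp
    qed
    then have freq: "\<exists>l\<ge>N. ?f l \<omega> < r + 1" for N
      unfolding eventually_sequentially by (metis ennreal_leI not_le)
    have "(\<lambda>l. wide_entropy k l \<omega> - ?S l) \<longlonglongrightarrow> 0"
      using elim low_nodes_subset by (intro entropy_part_limit) auto
    from LIMSEQ_D[OF this, of 1] obtain N where
      N: "\<And>l. l \<ge> N \<Longrightarrow> \<bar>wide_entropy k l \<omega> - ?S l\<bar> < 1" by auto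
    have dec: "decseq (\<lambda>l. C_partial l ?p u)" "C_partial l ?p u \<le> ?p u" if "u \<in> low_nodes k" for u l
      using C_partial_decreasing[OF elim(1)] low_nodes_subset[OF that] by auto
    define b where "b = wiener_limit \<omega> + W \<omega> - r - 2"
    have S: "b \<le> ?S l" for l
    proof -
      obtain j where j: "j \<ge> max l N" "?f j \<omega> < r + 1" using freq by blast
      have "\<bar>?G j \<omega> - ?S (k + j)\<bar> < 1" using N[of "k + j"] j by simp
      then have "b \<le> ?S (k + j)" using j(2) unfolding b_def by linarith
      also have "?S (k + j) \<le> ?S l"
        using j(1) by (intro sum_mono decseqD[OF dec(1)]) auto
      finally show ?thesis .
    qed
    show ?case
    proof
      fix u assume u: "u \<in> low_nodes k"
      have "b - (\<Sum>v\<in>low_nodes k - {u}. ?p v) \<le> C_partial l ?p u" for l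
      proof -
        have "?S l = C_partial l ?p u + (\<Sum>v\<in>low_nodes k - {u}. C_partial l ?p v)"
          using u finite_low_nodes by (rule sum.remove[rotated])
        also have "\<dots> \<le> C_partial l ?p u + (\<Sum>v\<in>low_nodes k - {u}. ?p v)"
          by (intro add_left_mono sum_mono dec) auto
        finally show ?thesis using S[of l] by linarith
      qed
      then obtain L where "(\<lambda>l. C_partial l ?p u) \<longlonglongrightarrow> L"
        using decseq_convergent[OF dec(1)[OF u]] by blast
      then show "convergent (\<lambda>l. C_partial l ?p u)" by (auto simp: convergent_def)
    qed
  qed
qed

lemma nn_integral_Y_partial:
  "(\<integral>\<^sup>+\<omega>. ennreal \<bar>wiener_limit \<omega> + W \<omega> - real_of_ereal (Y_partial k (Xinf \<omega>))\<bar> \<partial>M)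
    \<le> ennreal (35 * decay k)"
proof (rule nn_integral_limit_le[where
      f = "\<lambda>l \<omega>. \<bar>wiener_limit \<omega> + W \<omega> - wide_entropy k l \<omega>\<bar>"
      and c = "\<lambda>_. 35 * decay k"])
  have [measurable]: "(\<lambda>\<omega>. wide_entropy k l \<omega>) \<in> borel_measurable M" for l
    by (rule measurable_entropy_part[OF harris_wide_nodes])
  show "(\<lambda>\<omega>. \<bar>wiener_limit \<omega> + W \<omega> - wide_entropy k l \<omega>\<bar>) \<in> borel_measurable M" for l
    by measurable
  show "AE \<omega> in M. (\<lambda>l. \<bar>wiener_limit \<omega> + W \<omega> - wide_entropy k l \<omega>\<bar>) \<longlonglongrightarrow>
      \<bar>wiener_limit \<omega> + W \<omega> - real_of_ereal (Y_partial k (Xinf \<omega>))\<bar>"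
    using AE_mass_limit AE_children_mass AE_C_partial_convergent[of k]
  proof eventually_elim
    case (elim \<omega>)
    let ?S = "\<lambda>l. \<Sum>u\<in>low_nodes k. C_partial l (mass \<omega>) u"
    obtain c where c: "\<And>u. u \<in> low_nodes k \<Longrightarrow> (\<lambda>l. C_partial l (mass \<omega>) u) \<longlonglongrightarrow> c u"
      using elim(3) unfolding convergent_def by metis
    have Y: "Y_partial k (Xinf \<omega>) = ereal (\<Sum>u\<in>low_nodes k. c u)"
      using c unfolding mass_def by (rule Y_partial_eq)
    have "(\<lambda>l. wide_entropy k l \<omega> - ?S l) \<longlonglongrightarrow> 0"
      using elim low_nodes_subset by (intro entropy_part_limit) auto
    moreover have "?S \<longlonglongrightarrow> (\<Sum>u\<in>low_nodes k. c u)" by (intro tendsto_sum c)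
    ultimately have "(\<lambda>l. wide_entropy k l \<omega> - ?S l + ?S l) \<longlonglongrightarrow> 0 + (\<Sum>u\<in>low_nodes k. c u)"
      by (intro tendsto_add)
    then have "(\<lambda>l. wide_entropy k l \<omega>) \<longlonglongrightarrow> (\<Sum>u\<in>low_nodes k. c u)" by simp
    then show ?case unfolding Y by (intro tendsto_rabs tendsto_diff tendsto_const) simp
  qed
  show "\<forall>\<^sub>F l in sequentially. (\<integral>\<^sup>+\<omega>. ennreal
      \<bar>wiener_limit \<omega> + W \<omega> - wide_entropy k l \<omega>\<bar> \<partial>M) \<le> ennreal (35 * decay k)"
    using eventually_ge_at_top[of k] by eventually_elim (rule nn_integral_entropy_part)
qed simp

lemma AE_wiener_limit_eq:
  assumes Y: "is_Y_inf M Xinf Y"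
  shows "AE \<omega> in M. wiener_limit \<omega> = Y \<omega> - W \<omega>"
proof -
  let ?Y = "\<lambda>k \<omega>. real_of_ereal (Y_partial k (Xinf \<omega>))"
  have "tendsto_Lp M 1 ?Y Y" using Y by (simp add: is_Y_inf_def)
  note int = tendsto_L1[OF this]
  have [measurable]: "\<And>k. ?Y k \<in> borel_measurable M" "Y \<in> borel_measurable M"
    using int(1,2)[THEN borel_measurable_integrable] by auto
  note lim = int(3)
  have bound: "(\<integral>\<^sup>+\<omega>. ennreal \<bar>wiener_limit \<omega> + W \<omega> - Y \<omega>\<bar> \<partial>M) \<le>
      ennreal (35 * decay k + (\<integral>\<omega>. \<bar>?Y k \<omega> - Y \<omega>\<bar> \<partial>M))" for k
  proof -
    have "(\<integral>\<^sup>+\<omega>. ennreal \<bar>wiener_limit \<omega> + W \<omega> - Y \<omega>\<bar> \<partial>M) \<le>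
        (\<integral>\<^sup>+\<omega>. ennreal \<bar>wiener_limit \<omega> + W \<omega> - ?Y k \<omega>\<bar> + ennreal \<bar>?Y k \<omega> - Y \<omega>\<bar> \<partial>M)"
    proof (rule nn_integral_mono)
      fix \<omega>
      have "\<bar>wiener_limit \<omega> + W \<omega> - Y \<omega>\<bar> \<le>
          \<bar>wiener_limit \<omega> + W \<omega> - ?Y k \<omega>\<bar> + \<bar>?Y k \<omega> - Y \<omega>\<bar>" by linarith
      from ennreal_leI[OF this] show "ennreal \<bar>wiener_limit \<omega> + W \<omega> - Y \<omega>\<bar> \<le>
          ennreal \<bar>wiener_limit \<omega> + W \<omega> - ?Y k \<omega>\<bar> + ennreal \<bar>?Y k \<omega> - Y \<omega>\<bar>"
        by (subst (asm) ennreal_plus) auto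
    qed
    also have "\<dots> = (\<integral>\<^sup>+\<omega>. ennreal \<bar>wiener_limit \<omega> + W \<omega> - ?Y k \<omega>\<bar> \<partial>M) +
        (\<integral>\<^sup>+\<omega>. ennreal \<bar>?Y k \<omega> - Y \<omega>\<bar> \<partial>M)"
      by (intro nn_integral_add) measurable
    also have "(\<integral>\<^sup>+\<omega>. ennreal \<bar>?Y k \<omega> - Y \<omega>\<bar> \<partial>M) = ennreal (\<integral>\<omega>. \<bar>?Y k \<omega> - Y \<omega>\<bar> \<partial>M)"
      using int by (intro nn_integral_eq_integral) auto
    also have "(\<integral>\<^sup>+\<omega>. ennreal \<bar>wiener_limit \<omega> + W \<omega> - ?Y k \<omega>\<bar> \<partial>M) \<le> ennreal (35 * decay k)"
      by (rule nn_integral_Y_partial)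
    finally show ?thesis
      using decay_pos[of k] by (subst ennreal_plus) (auto simp: add_right_mono)
  qed
  have "(\<lambda>k. ennreal (35 * decay k + (\<integral>\<omega>. \<bar>?Y k \<omega> - Y \<omega>\<bar> \<partial>M))) \<longlonglongrightarrow> ennreal (35 * 0 + 0)"
    by (intro tendsto_ennrealI tendsto_add tendsto_mult tendsto_const decay_0 lim)
  then have "(\<integral>\<^sup>+\<omega>. ennreal \<bar>wiener_limit \<omega> + W \<omega> - Y \<omega>\<bar> \<partial>M) \<le> ennreal (35 * 0 + 0)"
    by (rule LIMSEQ_le_const) (use bound in blast)
  then have "(\<integral>\<^sup>+\<omega>. ennreal \<bar>wiener_limit \<omega> + W \<omega> - Y \<omega>\<bar> \<partial>M) = 0" by simp
  then have "AE \<omega> in M. ennreal \<bar>wiener_limit \<omega> + W \<omega> - Y \<omega>\<bar> = 0"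
    by (subst (asm) nn_integral_0_iff_AE) measurable
  then show ?thesis by eventually_elim simp
qed

end

theorem theorem12:
  fixes M :: "'w measure"
    and X :: "nat \<Rightarrow> 'w \<Rightarrow> nat list set"
    and Xinf :: "'w \<Rightarrow> bar_node measure"
    and Y :: "'w \<Rightarrow> real"
  assumes "harris_chain M X"
    and "doob_martin_limit M X Xinf"
    and "is_Y_inf M Xinf Y"
  shows "(AE \<omega> in M. (\<lambda>n. rescaled_wiener X n \<omega>) \<longlonglongrightarrow> Y \<omega> - W_inf (Xinf \<omega>)) \<and>
         (\<forall>p>0. tendsto_Lp M p (rescaled_wiener X) (\<lambda>\<omega>. Y \<omega> - W_inf (Xinf \<omega>)))"
proof -
  interpret harris_limit M X Xinf
    using assms by unfold_locales
  have Y: "Y \<in> borel_measurable M"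
    using assms(3) by (auto simp: is_Y_inf_def tendsto_Lp_def)
  have lim: "AE \<omega> in M. (\<lambda>n. rescaled_wiener X n \<omega>) \<longlonglongrightarrow> Y \<omega> - W_inf (Xinf \<omega>)"
    using AE_wiener_limit AE_wiener_limit_eq[OF assms(3)] by eventually_elim simp
  have "tendsto_Lp M p (rescaled_wiener X) (\<lambda>\<omega>. Y \<omega> - W_inf (Xinf \<omega>))" if "p > 0" for p
  proof (rule tendsto_Lp_of_bounded_moments)
    show "(\<lambda>\<omega>. Y \<omega> - W_inf (Xinf \<omega>)) \<in> borel_measurable M"
      using Y measurable_W by (rule borel_measurable_diff)
    show "integrable M (\<lambda>\<omega>. rescaled_wiener X n \<omega> ^ (2 * m))" for n m
      by (rule integrable_rescaled_wiener)
  qed (use that lim rescaled_wiener_moments measurable_rescaled_wiener in auto)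
  with lim show ?thesis by blast
qed

end
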